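(* Let $N$ be a positive integer, let $ABC$ be a triangle, and suppose $ABC$ is $N$-tiled by a triangle $T$ which is similar to $ABC$. Then either $N$ is a square, or $N$ is a sum of two squares, or $N$ is three times a square (squares of integers).
   Context: An $N$-tiling of a triangle $ABC$ by a triangle $T$ (the tile) is a set of $N$ triangles $T_1,\dots,T_N$, each congruent to $T$ (reflections allowed), with pairwise disjoint interiors, whose union is the closed triangle $ABC$. Tiles need not meet edge-to-edge. *)

theory Defs
  imports "HOL-Analysis.Analysis"
begin

text \<open>A triangle is a closed, nondegenerate triangular region of the Euclidean plane.\<close>

definition is_triangle :: "(real^2) set \<Rightarrow> bool" where
  "is_triangle S \<longleftrightarrow> (\<exists>a b c. \<not> collinear {a, b, c} \<and> S = convex hull {a, b, c})"

text \<open>The maps below act on the whole plane and may reverse orientation.\<close>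

definition similar_figures :: "(real^2) set \<Rightarrow> (real^2) set \<Rightarrow> bool" where
  "similar_figures S S' \<longleftrightarrow>
     (\<exists>r>0. \<exists>f :: real^2 \<Rightarrow> real^2. (\<forall>x y. dist (f x) (f y) = r * dist x y) \<and> f ` S = S')"

definition congruent_figures :: "(real^2) set \<Rightarrow> (real^2) set \<Rightarrow> bool" where
  "congruent_figures S S' \<longleftrightarrow>
     (\<exists>f :: real^2 \<Rightarrow> real^2. (\<forall>x y. dist (f x) (f y) = dist x y) \<and> f ` S = S')"

definition is_tiling :: "nat \<Rightarrow> (real^2) set \<Rightarrow> (real^2) set \<Rightarrow> (real^2) set set \<Rightarrow> bool" where
  "is_tiling N R T \<T> \<longleftrightarrow>
     finite \<T> \<and> card \<T> = N \<and>
     (\<forall>S\<in>\<T>. is_triangle S \<and> congruent_figures T S) \<and>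
     pairwise (\<lambda>S S'. interior S \<inter> interior S' = {}) \<T> \<and>
     \<Union>\<T> = R"

end

theory Submission
  imports Defs
begin

text \<open>Let \<open>e, f, g\<close> be the sides of the tile and \<open>E, F, G\<close> its angles; comparing areas, the sides of \<open>ABC\<close> are
  \<open>s e, s f, s g\<close> with \<open>s = sqrt N\<close>. Suppose that \<open>s\<close> is irrational. The sides of \<open>ABC\<close> are nonnegative
  integer combinations of \<open>e, f, g\<close>, so \<open>(e, f, g)\<close> is a positive eigenvector, with eigenvalue \<open>s\<close>, of a
  nonnegative integer matrix. Its Galois conjugate belongs to \<open>-s\<close>, and looking at the indices where the
  quotient of the two is maximal in absolute value yields, up to a permutation, either
  \<open>s e = x g, s f = y g\<close> (type I) or \<open>s e = p f, s f = q e\<close> (type II).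

  In type II, if not also in type I after relabelling, the side lengths force the corners \<open>E\<close> and \<open>F\<close> of \<open>ABC\<close> to be split, so that all angles are
  multiples of \<open>G = pi / n\<close>; then the Galois conjugate of \<open>cos G\<close> would have to be \<open>-cos (k G)\<close> with
  \<open>cos (k G) > cos G\<close>, and \<open>k = 0\<close> is excluded as well.

  In type I the corner \<open>G\<close> of \<open>ABC\<close> is split into angles \<open>E\<close> and \<open>F\<close>, so \<open>m E + n F = pi\<close> with \<open>m + n \<ge> 4\<close>. If
  \<open>E / pi\<close> is rational, Niven's theorem leaves only the conclusions of the theorem. Otherwise, if \<open>m\<close> or \<open>n\<close> is
  odd, there is a sign \<open>w\<close> on directions, odd under the half turn and multiplicative under rotations by
  \<open>E\<close> and \<open>F\<close>. Summing \<open>w\<close> times length over the oriented edges of a triangle is additive under tilings, and on each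
  tile the sum is \<open>\<plusminus>(g \<plusminus> f \<plusminus> e) \<noteq> 0\<close>, with the inner signs independent of the tile; hence \<open>s\<close> is an integer. If \<open>m\<close>
  and \<open>n\<close> are even and not both 2, at most \<open>h\<close> angles \<open>G\<close> meet at a vertex of total angle \<open>h pi\<close>, and none at
  the corners of \<open>ABC\<close>, although on average there is one for each \<open>pi = E + F + G\<close>.
  Finally \<open>m = n = 2\<close> means that \<open>G\<close> is a right angle, and \<open>N = x\<^sup>2 + y\<^sup>2\<close>.\<close>

section \<open>Angles and side lengths\<close>

definition tri_sides :: "real \<Rightarrow> real \<Rightarrow> real \<Rightarrow> bool" where
  "tri_sides e f g \<longleftrightarrow> 0 < e \<and> 0 < f \<and> 0 < g \<and> e < f + g \<and> f < g + e \<and> g < e + f"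

text \<open>Law of cosines: the angle opposite the side given first, so that
  \<open>ang e f g\<close>, \<open>ang f e g\<close>, \<open>ang g e f\<close> are the angles E, F,
  G.\<close>

definition ang :: "real \<Rightarrow> real \<Rightarrow> real \<Rightarrow> real" where
  "ang e f g = arccos ((f^2 + g^2 - e^2) / (2 * f * g))"

lemma tri_sides_swap: "tri_sides e f g \<Longrightarrow> tri_sides f e g" "tri_sides e f g \<Longrightarrow> tri_sides e g f"
  by (auto simp: tri_sides_def)

lemma ang_commute: "ang e f g = ang e g f"
  by (simp add: ang_def mult.commute mult.left_commute add.commute)

lemma ang_scale: "k > 0 \<Longrightarrow> ang (k * e) (k * f) (k * g) = ang e f g"
  unfolding ang_def
  by (rule arg_cong[where f=arccos]) (simp add: divide_simps, simp add: algebra_simps power2_eq_square)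

lemma ang_arg_bounds:
  assumes "tri_sides e f g"
  shows "-1 < (f^2 + g^2 - e^2) / (2 * f * g)" "(f^2 + g^2 - e^2) / (2 * f * g) < 1"
proof -
  have p: "0 < f" "0 < g" "0 < e" using assms by (auto simp: tri_sides_def)
  have "0 < (f + g + e) * (f + g - e)" using assms by (auto simp: tri_sides_def)
  then have "- (2 * f * g) < f^2 + g^2 - e^2" by (simp add: algebra_simps power2_eq_square)
  then show "-1 < (f^2 + g^2 - e^2) / (2 * f * g)" using p by (simp add: field_simps)
  have "0 < (e - f + g) * (e + f - g)" using assms by (auto simp: tri_sides_def)
  then have "f^2 + g^2 - e^2 < 2 * f * g" by (simp add: algebra_simps power2_eq_square)
  then show "(f^2 + g^2 - e^2) / (2 * f * g) < 1" using p by (simp add: field_simps)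
qed

lemma cos_ang: "tri_sides e f g \<Longrightarrow> cos (ang e f g) = (f^2 + g^2 - e^2) / (2 * f * g)"
  unfolding ang_def using ang_arg_bounds[of e f g] by (simp add: cos_arccos)

lemma ang_bounds:
  assumes "tri_sides e f g"
  shows "0 < ang e f g" "ang e f g < pi"
  unfolding ang_def using ang_arg_bounds[OF assms] arccos_lt_bounded by auto

lemma sin_ang_pos: "tri_sides e f g \<Longrightarrow> 0 < sin (ang e f g)"
  using ang_bounds sin_gt_zero by blast

text \<open>Four times the area by Heron's formula. Being symmetric in the sides, it is a common
  numerator for all three sines.\<close>

definition heron_root :: "real \<Rightarrow> real \<Rightarrow> real \<Rightarrow> real" where
  "heron_root e f g = sqrt ((e + f + g) * (f + g - e) * (g + e - f) * (e + f - g))"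

lemma heron_root_commute: "heron_root e f g = heron_root f e g" "heron_root e f g = heron_root e g f"
  by (simp_all add: heron_root_def algebra_simps)

lemma heron_root_pos: "tri_sides e f g \<Longrightarrow> 0 < heron_root e f g"
  by (auto simp: tri_sides_def heron_root_def intro!: mult_pos_pos)

text \<open>\<open>(2 f g)^2 - (f^2 + g^2 - e^2)^2\<close> factors into Heron's product by repeated
  differences of squares.\<close>

lemma sin_ang:
  assumes "tri_sides e f g"
  shows "sin (ang e f g) = heron_root e f g / (2 * f * g)"
proof (rule power2_eq_imp_eq)
  have p: "0 < f" "0 < g" "0 < e" using assms by (auto simp: tri_sides_def)
  have h: "0 \<le> (e + f + g) * (f + g - e) * (g + e - f) * (e + f - g)"
    using assms by (auto simp: tri_sides_def)
  have "(sin (ang e f g))^2 = 1 - ((f^2 + g^2 - e^2) / (2 * f * g))^2"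
    using cos_ang[OF assms] by (simp add: sin_squared_eq)
  also have "\<dots> = ((e + f + g) * (f + g - e) * (g + e - f) * (e + f - g)) / (2 * f * g)^2"
  proof -
    have "(2 * f * g)^2 - (f^2 + g^2 - e^2)^2 = (e + f + g) * (f + g - e) * (g + e - f) * (e + f - g)"
      by (simp add: algebra_simps power2_eq_square)
    moreover have "1 - (a / b)^2 = (b^2 - a^2) / b^2" if "b \<noteq> 0" for a b :: real
      using that by (simp add: field_simps)
    ultimately show ?thesis using p by simp
  qed
  also have "\<dots> = (heron_root e f g / (2 * f * g))^2"
    using h by (simp add: heron_root_def power_divide)
  finally show "(sin (ang e f g))^2 = (heron_root e f g / (2 * f * g))^2" .
  show "0 \<le> sin (ang e f g)" using sin_ang_pos[OF assms] by simp
  show "0 \<le> heron_root e f g / (2 * f * g)" using heron_root_pos[OF assms] p by simp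
qed

lemma projection_formula:
  assumes "tri_sides e f g"
  shows "f * cos (ang e f g) + e * cos (ang f e g) = g" "f * sin (ang e f g) = e * sin (ang f e g)"
proof -
  have p: "0 < f" "0 < g" "0 < e" using assms by (auto simp: tri_sides_def)
  show "f * cos (ang e f g) + e * cos (ang f e g) = g"
    unfolding cos_ang[OF assms] cos_ang[OF tri_sides_swap(1)[OF assms]]
    using p by (simp add: field_simps power2_eq_square)
  show "f * sin (ang e f g) = e * sin (ang f e g)"
    unfolding sin_ang[OF assms] sin_ang[OF tri_sides_swap(1)[OF assms]] heron_root_commute(1)[of f e g]
    using p by (simp add: field_simps)
qed

text \<open>The addition theorems give \<open>cos (E + F) = - cos G\<close> and a positive
  \<open>sin (E + F)\<close>. The latter keeps \<open>E + F\<close> below \<open>pi\<close>, where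
  the cosine is injective.\<close>

lemma ang_sum:
  assumes "tri_sides e f g"
  shows "ang e f g + ang f e g + ang g e f = pi"
proof -
  have p: "0 < f" "0 < g" "0 < e" using assms by (auto simp: tri_sides_def)
  have t2: "tri_sides f e g" and t3: "tri_sides g e f" using assms by (auto simp: tri_sides_def)
  let ?E = "ang e f g" and ?F = "ang f e g" and ?G = "ang g e f"
  let ?K = "heron_root e f g"
  have K2: "?K^2 = (e + f + g) * (f + g - e) * (g + e - f) * (e + f - g)"
    unfolding heron_root_def using assms by (subst real_sqrt_pow2) (auto simp: tri_sides_def)
  have KF: "heron_root f e g = ?K" and KG: "heron_root g e f = ?K"
    by (simp_all add: heron_root_def algebra_simps)
  have c: "cos (?E + ?F) = - cos ?G"
  proof -
    have "cos (?E + ?F) = ((f^2 + g^2 - e^2) / (2 * f * g)) * ((e^2 + g^2 - f^2) / (2 * e * g)) - ?K^2 / ((2 * f * g) * (2 * e * g))"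
      using cos_ang[OF assms] cos_ang[OF t2] sin_ang[OF assms] sin_ang[OF t2] KF
      by (simp add: cos_add power2_eq_square)
    also have "\<dots> = - ((e^2 + f^2 - g^2) / (2 * e * f))"
    proof -
      have "(a / (2 * f * g)) * (b / (2 * e * g)) - c / ((2 * f * g) * (2 * e * g)) = (a * b - c) / (4 * g^2 * (e * f))" for a b c
        using p by (simp add: field_simps power2_eq_square)
      moreover have "(f^2 + g^2 - e^2) * (e^2 + g^2 - f^2) - (e + f + g) * (f + g - e) * (g + e - f) * (e + f - g)
          = (- 2 * g^2) * (e^2 + f^2 - g^2)" by (simp add: algebra_simps power2_eq_square)
      moreover have "(- 2 * g^2) * X / (4 * g^2 * (e * f)) = - (X / (2 * e * f))" for X
        using p by (simp add: field_simps)
      ultimately show ?thesis unfolding K2 by metis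
    qed
    finally show ?thesis using cos_ang[OF t3] by simp
  qed
  have "sin (?E + ?F) = ?K / (2 * f * g) * ((e^2 + g^2 - f^2) / (2 * e * g)) + (f^2 + g^2 - e^2) / (2 * f * g) * (?K / (2 * e * g))"
    using cos_ang[OF assms] cos_ang[OF t2] sin_ang[OF assms] sin_ang[OF t2] KF
    by (simp add: sin_add)
  also have "\<dots> = ?K / (2 * e * f)"
  proof -
    have "?K / (2 * f * g) * (a / (2 * e * g)) + b / (2 * f * g) * (?K / (2 * e * g)) = ?K * (a + b) / (4 * g^2 * (e * f))" for a b
      using p by (simp add: field_simps power2_eq_square)
    then show ?thesis using p by simp
  qed
  also have "\<dots> > 0" using heron_root_pos[OF assms] p by simp
  finally have s: "0 < sin (?E + ?F)" .
  have b: "0 < ?E + ?F" "?E + ?F < 2 * pi" using ang_bounds[OF assms] ang_bounds[OF t2] by linarith+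
  have lt: "?E + ?F < pi"
  proof (rule ccontr)
    assume "\<not> ?E + ?F < pi"
    then have "sin (?E + ?F) \<le> 0" using sin_le_zero[of "?E + ?F"] b by simp
    then show False using s by simp
  qed
  have eq: "cos (?E + ?F) = cos (pi - ?G)" using c by simp
  have "0 \<le> ?E + ?F" "?E + ?F \<le> pi" "0 \<le> pi - ?G" "pi - ?G \<le> pi"
    using lt b(1) ang_bounds[OF t3] by linarith+
  from cos_inj_pi[OF this eq] show ?thesis by linarith
qed

lemma ang_eq_imp_sides_eq:
  assumes "tri_sides e f g" "ang e f g = ang f e g"
  shows "e = f"
  using projection_formula(2)[OF assms(1)] assms(2) sin_ang_pos[OF assms(1)] by simp

section \<open>Irrational scale factors and the shape of the side matrix\<close>

lemma sqrt_rational_imp_square: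
  assumes "sqrt (real N) \<in> \<rat>"
  shows "\<exists>k::int. int N = k^2"
proof -
  have "algebraic_int (real N)" by (simp add: int_imp_algebraic_int)
  then have "algebraic_int (sqrt (real N))" by (rule algebraic_int_sqrt)
  then have "sqrt (real N) \<in> \<int>" using assms rational_algebraic_int_is_int by blast
  then obtain k :: int where "sqrt (real N) = of_int k" by (elim Ints_cases)
  then have "real N = (of_int k)^2" by (metis of_nat_0_le_iff real_sqrt_pow2)
  then have "int N = k^2" by (metis of_int_eq_iff of_int_of_nat_eq of_int_power)
  then show ?thesis by blast
qed

text \<open>Equality case of the triangle inequality. Since \<open>w\<close> attains the largest
  allowed ratio \<open>rad\<close>, adding \<open>rad\<close> times the first equation to the second
  gives a sum of nonnegative terms that equals 0.\<close>

lemma extremal_row: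
  fixes v1 v2 v3 w1 w2 w3 v w rad s a b c :: real
  assumes "s * v = a * v1 + b * v2 + c * v3" "- s * w = a * w1 + b * w2 + c * w3"
    "\<bar>w1\<bar> \<le> rad * v1" "\<bar>w2\<bar> \<le> rad * v2" "\<bar>w3\<bar> \<le> rad * v3" "0 \<le> a" "0 \<le> b" "0 \<le> c"
    "w = rad * v"
  shows "(a = 0 \<or> w1 = - rad * v1) \<and> (b = 0 \<or> w2 = - rad * v2) \<and> (c = 0 \<or> w3 = - rad * v3)"
proof -
  have "a * (rad * v1 + w1) + b * (rad * v2 + w2) + c * (rad * v3 + w3)
      = rad * (a * v1 + b * v2 + c * v3) + (a * w1 + b * w2 + c * w3)" by (simp add: algebra_simps)
  also have "\<dots> = rad * (s * v) - s * w" using assms(1,2) by simp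
  also have "\<dots> = 0" using assms(9) by (simp add: algebra_simps)
  finally have z: "a * (rad * v1 + w1) + b * (rad * v2 + w2) + c * (rad * v3 + w3) = 0" .
  have n: "0 \<le> a * (rad * v1 + w1)" "0 \<le> b * (rad * v2 + w2)" "0 \<le> c * (rad * v3 + w3)"
    using assms by (auto intro!: mult_nonneg_nonneg)
  have "a * (rad * v1 + w1) = 0" "b * (rad * v2 + w2) = 0" "c * (rad * v3 + w3) = 0"
    using z n by linarith+
  then show ?thesis by (auto simp: add_eq_0_iff)
qed

lemma irrational_indep:
  fixes s :: real
  assumes "s \<notin> \<rat>" "p \<in> \<rat>" "q \<in> \<rat>" "p + q * s = 0"
  shows "p = 0" "q = 0"
proof -
  show "q = 0"
  proof (rule ccontr)
    assume "q \<noteq> 0"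
    then have "s = - p / q" using assms(4) by (simp add: field_simps add_eq_0_iff)
    then show False using assms(1-3) by auto
  qed
  then show "p = 0" using assms(4) by simp
qed

definition typeI :: "real \<Rightarrow> real \<Rightarrow> real \<Rightarrow> real \<Rightarrow> bool" where
  "typeI s e f g \<longleftrightarrow> (\<exists>x y::nat. s * e = real x * g \<and> s * f = real y * g)"

text \<open>The third equation is what later expresses \<open>g\<close> through \<open>e\<close>,
  \<open>f\<close> and \<open>s\<close>.\<close>

definition typeII :: "real \<Rightarrow> real \<Rightarrow> real \<Rightarrow> real \<Rightarrow> bool" where
  "typeII s e f g \<longleftrightarrow> (\<exists>p q t x y::nat. s * e = real p * f \<and> s * f = real q * e \<and>
     s * g = real t * g + real x * e + real y * f)"

text \<open>An eigenvector for \<open>s\<close> is the cross product of the first two rows of the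
  matrix minus \<open>s\<close> times the identity; its entries lie in Q(s). If its third entry is
  nonzero, replacing \<open>s\<close> by \<open>-s\<close> gives an eigenvector for
  \<open>-s\<close>. Otherwise the whole product vanishes, and the irrationality of \<open>s\<close>
  leaves only type II.\<close>

lemma conjugate_eigenvector:
  fixes a1 a2 a3 b1 b2 b3 c1 c2 c3 N :: nat and e f g s :: real
  assumes s: "s^2 = real N" "s \<notin> \<rat>" and pos: "0 < e" "0 < f" "0 < g"
    and rows: "s * e = a1 * e + a2 * f + a3 * g" "s * f = b1 * e + b2 * f + b3 * g"
      "s * g = c1 * e + c2 * f + c3 * g"
  obtains "typeII s e f g" | e' f' g' :: real where "e' \<noteq> 0 \<or> f' \<noteq> 0 \<or> g' \<noteq> 0"
    "- s * e' = a1 * e' + a2 * f' + a3 * g'" "- s * f' = b1 * e' + b2 * f' + b3 * g'"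
    "- s * g' = c1 * e' + c2 * f' + c3 * g'"
proof -
  \<comment> \<open>The entries of the cross product are \<open>u1 + r1 * s\<close>,
    \<open>u2 + r2 * s\<close>, \<open>u3 + r3 * s\<close>, with \<open>s^2\<close> replaced by
    \<open>N\<close>.\<close>
  define u1 u2 u3 where u: "u1 = real a2 * b3 - real a3 * b2" "u2 = real a3 * b1 - real a1 * b3" "u3 = real a1 * b2 + N - real a2 * b1"
  define r1 r2 r3 where r: "r1 = real a3" "r2 = real b3" "r3 = - (real a1 + real b2)"
  have rat: "u1 \<in> \<rat>" "u2 \<in> \<rat>" "u3 \<in> \<rat>" "r1 \<in> \<rat>" "r2 \<in> \<rat>" "r3 \<in> \<rat>" by (auto simp: u r)
  have N: "real N = s * s" using s(1) by (simp add: power2_eq_square)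
  define w where "w = u3 + r3 * s"
  have e: "e * w = g * (u1 + r1 * s)"
  proof -
    have "e * w - g * (u1 + r1 * s) = (b2 - s) * (a1 * e + a2 * f + a3 * g - s * e) - a2 * (b1 * e + b2 * f + b3 * g - s * f)"
      unfolding w_def u r N by (simp add: algebra_simps)
    then show ?thesis using rows by simp
  qed
  have f: "f * w = g * (u2 + r2 * s)"
  proof -
    have "f * w - g * (u2 + r2 * s) = (a1 - s) * (b1 * e + b2 * f + b3 * g - s * f) - b1 * (a1 * e + a2 * f + a3 * g - s * e)"
      unfolding w_def u r N by (simp add: algebra_simps)
    then show ?thesis using rows by simp
  qed
  show ?thesis
  proof (cases "w = 0")
    case True
    then have "u1 + r1 * s = 0" "u2 + r2 * s = 0" "u3 + r3 * s = 0" using e f pos w_def by auto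
    then have "r1 = 0" "r2 = 0" "r3 = 0" "u3 = 0"
      using irrational_indep[OF s(2)] rat by blast+
    then have z: "a3 = 0" "b3 = 0" "a1 = 0" "b2 = 0" by (auto simp: r)
    have "s * e = real a2 * f" "s * f = real b1 * e" using rows z by auto
    moreover have "s * g = real c3 * g + real c1 * e + real c2 * f" using rows by simp
    ultimately have "typeII s e f g" unfolding typeII_def by blast
    then show ?thesis by (rule that(1))
  next
    case False
    define e' f' g' where p: "e' = u1 - r1 * s" "f' = u2 - r2 * s" "g' = u3 - r3 * s"
    have g'0: "g' \<noteq> 0"
    proof
      assume "g' = 0"
      then have z: "u3 + (- r3) * s = 0" by (simp add: p)
      have q: "- r3 \<in> \<rat>" using rat(6) by simp
      have "u3 = 0" "r3 = 0" using irrational_indep[OF s(2) rat(3) q z] by simp_all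
      then show False using False w_def by simp
    qed
    \<comment> \<open>Each row becomes an identity in Q(s) after multiplication by \<open>w\<close>
      and cancellation of \<open>g\<close>. Comparing the coefficients of 1 and \<open>s\<close>
      allows the sign of \<open>s\<close> to be changed.\<close>
    have key: "- s * (x0 - y0 * s) = k1 * e' + k2 * f' + k3 * g'"
      if "s * x = k1 * e + k2 * f + k3 * g" "x * w = g * (x0 + y0 * s)" "x0 \<in> \<rat>" "y0 \<in> \<rat>"
        "k1 \<in> \<rat>" "k2 \<in> \<rat>" "k3 \<in> \<rat>" for x x0 y0 k1 k2 k3 :: real
    proof -
      have "s * (x * w) = k1 * (e * w) + k2 * (f * w) + k3 * (g * w)"
        unfolding mult.assoc[symmetric] that(1) by (simp add: algebra_simps)
      then have "g * (s * (x0 + y0 * s)) = g * (k1 * (u1 + r1 * s) + k2 * (u2 + r2 * s) + k3 * (u3 + r3 * s))"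
        unfolding e f mult.assoc that(2) by (simp add: w_def algebra_simps)
      then have "s * (x0 + y0 * s) = k1 * (u1 + r1 * s) + k2 * (u2 + r2 * s) + k3 * (u3 + r3 * s)"
        using pos by simp
      then have z: "(N * y0 - k1 * u1 - k2 * u2 - k3 * u3) + (x0 - k1 * r1 - k2 * r2 - k3 * r3) * s = 0"
        unfolding N by (simp add: algebra_simps)
      have q: "(N * y0 - k1 * u1 - k2 * u2 - k3 * u3) \<in> \<rat>" "(x0 - k1 * r1 - k2 * r2 - k3 * r3) \<in> \<rat>"
        using that rat by auto
      have e1: "N * y0 = k1 * u1 + k2 * u2 + k3 * u3" and e2: "x0 = k1 * r1 + k2 * r2 + k3 * r3"
        using irrational_indep[OF s(2) q z] by simp_all
      have "- s * (x0 - y0 * s) = N * y0 - s * x0" unfolding N by (simp add: algebra_simps)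
      also have "\<dots> = k1 * e' + k2 * f' + k3 * g'" unfolding e1 e2 p by (simp add: algebra_simps)
      finally show ?thesis .
    qed
    have "g * w = g * (u3 + r3 * s)" by (simp add: w_def)
    then have "- s * e' = a1 * e' + a2 * f' + a3 * g'" "- s * f' = b1 * e' + b2 * f' + b3 * g'"
      "- s * g' = c1 * e' + c2 * f' + c3 * g'"
      using key[OF rows(1) e] key[OF rows(2) f] key[OF rows(3), of u3 r3] rat by (auto simp: p)
    with g'0 show ?thesis by (intro that(2)) auto
  qed
qed

text \<open>Propositional core of \<open>matrix_types\<close>: \<open>ep\<close> and
  \<open>em\<close> say that the conjugate vector is extremal at \<open>e\<close> with sign plus or
  minus, \<open>A1\<close> that the entry \<open>a1\<close> is 0, and so on. An extremal row has its
  nonzero entries only at extremal indices of the opposite sign, so both signs occur. Two indices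
  against one give type I (\<open>X1\<close> to \<open>X3\<close>), one against one gives type II
  (\<open>Y1\<close> to \<open>Y3\<close>).\<close>

lemma types_cases:
  assumes "(ep \<longrightarrow> (A1 \<or> em) \<and> (A2 \<or> fm) \<and> (A3 \<or> gm)) \<and> (em \<longrightarrow> (A1 \<or> ep) \<and> (A2 \<or> fp) \<and> (A3 \<or> gp))"
    "(fp \<longrightarrow> (B1 \<or> em) \<and> (B2 \<or> fm) \<and> (B3 \<or> gm)) \<and> (fm \<longrightarrow> (B1 \<or> ep) \<and> (B2 \<or> fp) \<and> (B3 \<or> gp))"
    "(gp \<longrightarrow> (C1 \<or> em) \<and> (C2 \<or> fm) \<and> (C3 \<or> gm)) \<and> (gm \<longrightarrow> (C1 \<or> ep) \<and> (C2 \<or> fp) \<and> (C3 \<or> gp))"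
    "\<not> (ep \<and> em)" "\<not> (fp \<and> fm)" "\<not> (gp \<and> gm)"
    "\<not> A1 \<or> \<not> A2 \<or> \<not> A3" "\<not> B1 \<or> \<not> B2 \<or> \<not> B3" "\<not> C1 \<or> \<not> C2 \<or> \<not> C3"
    "ep \<or> em \<or> fp \<or> fm \<or> gp \<or> gm"
    "A1 \<Longrightarrow> A2 \<Longrightarrow> B1 \<Longrightarrow> B2 \<Longrightarrow> X1" "A1 \<Longrightarrow> A3 \<Longrightarrow> C1 \<Longrightarrow> C3 \<Longrightarrow> X2" "B2 \<Longrightarrow> B3 \<Longrightarrow> C2 \<Longrightarrow> C3 \<Longrightarrow> X3"
    "A1 \<Longrightarrow> A3 \<Longrightarrow> B2 \<Longrightarrow> B3 \<Longrightarrow> Y1" "A1 \<Longrightarrow> A2 \<Longrightarrow> C2 \<Longrightarrow> C3 \<Longrightarrow> Y2" "B1 \<Longrightarrow> B2 \<Longrightarrow> C1 \<Longrightarrow> C3 \<Longrightarrow> Y3"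
  shows "X1 \<or> X2 \<or> X3 \<or> Y1 \<or> Y2 \<or> Y3"
  using assms by argo

lemma matrix_types:
  fixes a1 a2 a3 b1 b2 b3 c1 c2 c3 N :: nat and e f g s :: real
  assumes s: "s^2 = real N" "s \<notin> \<rat>" and pos: "0 < e" "0 < f" "0 < g"
    and rows: "s * e = a1 * e + a2 * f + a3 * g" "s * f = b1 * e + b2 * f + b3 * g"
      "s * g = c1 * e + c2 * f + c3 * g"
  shows "typeI s e f g \<or> typeI s e g f \<or> typeI s f g e \<or> typeII s e f g \<or> typeII s e g f \<or> typeII s f g e"
proof -
  have s0: "s \<noteq> 0" using s(2) by auto
  show ?thesis
  proof (rule conjugate_eigenvector[OF assms])
    fix e' f' g' :: real
    assume 2: "e' \<noteq> 0 \<or> f' \<noteq> 0 \<or> g' \<noteq> 0"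
      "- s * e' = a1 * e' + a2 * f' + a3 * g'" "- s * f' = b1 * e' + b2 * f' + b3 * g'"
      "- s * g' = c1 * e' + c2 * f' + c3 * g'"
    \<comment> \<open>Extremal indices are those where the conjugate vector reaches
      \<open>rad\<close> times the positive eigenvector in absolute value.\<close>
    define rad where "rad = Max {\<bar>e'\<bar> / e, \<bar>f'\<bar> / f, \<bar>g'\<bar> / g}"
    have le: "\<bar>e'\<bar> / e \<le> rad" "\<bar>f'\<bar> / f \<le> rad" "\<bar>g'\<bar> / g \<le> rad" unfolding rad_def by auto
    have "rad \<in> {\<bar>e'\<bar> / e, \<bar>f'\<bar> / f, \<bar>g'\<bar> / g}" unfolding rad_def by (rule Max_in) auto
    then have ex: "\<bar>e'\<bar> = rad * e \<or> \<bar>f'\<bar> = rad * f \<or> \<bar>g'\<bar> = rad * g" using pos by (auto simp: field_simps)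
    have le': "\<bar>e'\<bar> \<le> rad * e" "\<bar>f'\<bar> \<le> rad * f" "\<bar>g'\<bar> \<le> rad * g" using le pos by (auto simp: field_simps)
    have "0 < \<bar>e'\<bar> / e \<or> 0 < \<bar>f'\<bar> / f \<or> 0 < \<bar>g'\<bar> / g" using 2(1) pos by auto
    then have rad0: "0 < rad" using le by linarith
    have lem: "\<bar>- e'\<bar> \<le> rad * e" "\<bar>- f'\<bar> \<le> rad * f" "\<bar>- g'\<bar> \<le> rad * g" using le' by auto
    have row: "(w = rad * v \<longrightarrow> (a = 0 \<or> e' = - rad * e) \<and> (b = 0 \<or> f' = - rad * f) \<and> (c = 0 \<or> g' = - rad * g)) \<and>
      (w = - rad * v \<longrightarrow> (a = 0 \<or> e' = rad * e) \<and> (b = 0 \<or> f' = rad * f) \<and> (c = 0 \<or> g' = rad * g))"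
      if "s * v = real a * e + real b * f + real c * g" "- s * w = real a * e' + real b * f' + real c * g'"
      for v w and a b c :: nat
    proof (intro conjI impI)
      assume "w = rad * v"
      from extremal_row[OF that le' _ _ _ this]
      show "(a = 0 \<or> e' = - rad * e)" "(b = 0 \<or> f' = - rad * f)" "(c = 0 \<or> g' = - rad * g)" by auto
    next
      assume "w = - rad * v"
      then have w: "- w = rad * v" by simp
      have "- s * (- w) = real a * (- e') + real b * (- f') + real c * (- g')" using that(2) by simp
      from extremal_row[OF that(1) this lem _ _ _ w]
      show "(a = 0 \<or> e' = rad * e)" "(b = 0 \<or> f' = rad * f)" "(c = 0 \<or> g' = rad * g)" by auto
    qed
    note R1 = row[OF rows(1) 2(2)] and R2 = row[OF rows(2) 2(3)] and R3 = row[OF rows(3) 2(4)]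
    have ne: "rad * e \<noteq> - rad * e" "rad * f \<noteq> - rad * f" "rad * g \<noteq> - rad * g" using rad0 pos by (auto simp: equal_neg_zero)
    have nz: "a1 \<noteq> 0 \<or> a2 \<noteq> 0 \<or> a3 \<noteq> 0" "b1 \<noteq> 0 \<or> b2 \<noteq> 0 \<or> b3 \<noteq> 0" "c1 \<noteq> 0 \<or> c2 \<noteq> 0 \<or> c3 \<noteq> 0"
    proof -
      have "s * e \<noteq> 0" "s * f \<noteq> 0" "s * g \<noteq> 0" using pos s0 by auto
      then show "a1 \<noteq> 0 \<or> a2 \<noteq> 0 \<or> a3 \<noteq> 0" "b1 \<noteq> 0 \<or> b2 \<noteq> 0 \<or> b3 \<noteq> 0" "c1 \<noteq> 0 \<or> c2 \<noteq> 0 \<or> c3 \<noteq> 0"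
        unfolding rows by auto
    qed
    have ex': "e' = rad * e \<or> e' = - rad * e \<or> f' = rad * f \<or> f' = - rad * f \<or> g' = rad * g \<or> g' = - rad * g"
      using ex by (auto simp: abs_if split: if_splits)
    have I1: "typeI s e f g" if "a1 = 0" "a2 = 0" "b1 = 0" "b2 = 0"
      using rows that unfolding typeI_def by auto
    have I2: "typeI s e g f" if "a1 = 0" "a3 = 0" "c1 = 0" "c3 = 0"
      using rows that unfolding typeI_def by auto
    have I3: "typeI s f g e" if "b2 = 0" "b3 = 0" "c2 = 0" "c3 = 0"
      using rows that unfolding typeI_def by auto
    have II1: "typeII s e f g" if "a1 = 0" "a3 = 0" "b2 = 0" "b3 = 0"
      using rows that unfolding typeII_def
      by (intro exI[of _ a2] exI[of _ b1] exI[of _ c3] exI[of _ c1] exI[of _ c2]) auto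
    have II2: "typeII s e g f" if "a1 = 0" "a2 = 0" "c2 = 0" "c3 = 0"
      using rows that unfolding typeII_def
      by (intro exI[of _ a3] exI[of _ c1] exI[of _ b2] exI[of _ b1] exI[of _ b3]) auto
    have II3: "typeII s f g e" if "b1 = 0" "b2 = 0" "c1 = 0" "c3 = 0"
      using rows that unfolding typeII_def
      by (intro exI[of _ b3] exI[of _ c2] exI[of _ a1] exI[of _ a2] exI[of _ a3]) auto
    have ne': "\<not> (e' = rad * e \<and> e' = - rad * e)" "\<not> (f' = rad * f \<and> f' = - rad * f)" "\<not> (g' = rad * g \<and> g' = - rad * g)"
      using ne by auto
    from types_cases[OF R1 R2 R3 ne' nz ex' I1 I2 I3 II1 II2 II3] show ?thesis .
  qed simp
qed

section \<open>Chebyshev polynomials and sign characters\<close>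

fun cheb :: "nat \<Rightarrow> real \<Rightarrow> real" where
  "cheb 0 x = 1"
| "cheb (Suc 0) x = x"
| "cheb (Suc (Suc n)) x = 2 * x * cheb (Suc n) x - cheb n x"

lemma cheb_cos: "cheb n (cos t) = cos (real n * t)"
proof (induction n "cos t" rule: cheb.induct)
  case (3 n)
  have "cos (real (Suc (Suc n)) * t) + cos (real n * t) = 2 * cos t * cos (real (Suc n) * t)"
    using cos_plus_cos[of "real (Suc (Suc n)) * t" "real n * t"]
    by (simp add: algebra_simps add_divide_distrib)
  then show ?case using 3 by simp
qed auto

lemma cheb_minus: "cheb n (- x) = (- 1) ^ n * cheb n x"
  by (induction n x rule: cheb.induct) (auto simp: algebra_simps)

lemma cheb_mono: "1 < x \<Longrightarrow> 1 \<le> cheb n x \<and> cheb n x < cheb (Suc n) x"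
proof (induction n)
  case (Suc n)
  then have a: "1 \<le> cheb n x" "cheb n x < cheb (Suc n) x" and x: "1 < x" by auto
  then have "cheb (Suc n) x < x * cheb (Suc n) x" by simp
  then have "cheb (Suc n) x < 2 * x * cheb (Suc n) x - cheb n x" using a by linarith
  then show ?case using a by simp
qed simp

text \<open>For \<open>n > 0\<close> the polynomial exceeds 1 in absolute value outside [-1, 1].
  This is what keeps the conjugate of \<open>cos (pi / n)\<close> in the range of the
  cosine.\<close>

lemma cheb_eq_minus_one_imp:
  assumes "cheb n y = - 1"
  shows "\<bar>y\<bar> \<le> 1"
proof (rule ccontr)
  assume "\<not> \<bar>y\<bar> \<le> 1"
  then have "1 < \<bar>y\<bar>" by simp
  moreover have "n \<noteq> 0" using assms by (cases n) auto
  ultimately have "1 < cheb n \<bar>y\<bar>" using cheb_mono[of "\<bar>y\<bar>" "n - 1"] by (cases n) auto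
  moreover have "cheb n \<bar>y\<bar> = cheb n y \<or> cheb n \<bar>y\<bar> = (- 1) ^ n * cheb n y"
    using cheb_minus[of n y] by (auto simp: abs_if)
  moreover have "(- 1 :: real) ^ n = 1 \<or> (- 1 :: real) ^ n = - 1"
    by (cases "even n") auto
  ultimately show False using assms by auto
qed

text \<open>A polynomial with rational coefficients commutes with the formal change of
  \<open>s\<close> into \<open>-s\<close>.\<close>

lemma cheb_conjugate:
  fixes u v s :: real
  assumes "u \<in> \<rat>" "v \<in> \<rat>" "s^2 \<in> \<rat>"
  shows "\<exists>U V. U \<in> \<rat> \<and> V \<in> \<rat> \<and> cheb n (u + v * s) = U + V * s \<and> cheb n (u - v * s) = U - V * s"
proof (induction n "u + v * s" rule: cheb.induct)
  case 1
  then show ?case by (intro exI[of _ 1] exI[of _ 0]) auto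
next
  case 2
  then show ?case using assms by (intro exI[of _ u] exI[of _ v]) auto
next
  case (3 n)
  obtain U V U' V' where r: "U \<in> \<rat>" "V \<in> \<rat>" "U' \<in> \<rat>" "V' \<in> \<rat>"
    and h: "cheb (Suc n) (u + v * s) = U + V * s" "cheb (Suc n) (u - v * s) = U - V * s"
    "cheb n (u + v * s) = U' + V' * s" "cheb n (u - v * s) = U' - V' * s"
    using 3 by blast
  have "cheb (Suc (Suc n)) (u + v * s) = (2 * (u * U + v * V * s^2) - U') + (2 * (u * V + v * U) - V') * s"
    "cheb (Suc (Suc n)) (u - v * s) = (2 * (u * U + v * V * s^2) - U') - (2 * (u * V + v * U) - V') * s"
    unfolding cheb.simps h by (simp_all add: algebra_simps power2_eq_square)
  moreover have "2 * (u * U + v * V * s^2) - U' \<in> \<rat>" "2 * (u * V + v * U) - V' \<in> \<rat>"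
    using r assms by auto
  ultimately show ?case by blast
qed

text \<open>Clearing denominators, \<open>2 b\<^sup>n cos (n t)\<close> is an integer congruent to \<open>a\<^sup>n\<close> modulo \<open>b\<close> when
  \<open>2 cos t = a / b\<close>.\<close>

lemma cheb_denominator:
  fixes a b :: int
  assumes "b \<noteq> 0"
  shows "\<exists>d::int. 2 * of_int b ^ Suc n * cheb (Suc n) (of_int a / (2 * of_int b)) = of_int (a ^ Suc n + b * d)"
proof -
  let ?x = "of_int a / (2 * of_int b) :: real"
  have "(\<exists>d::int. 2 * of_int b ^ Suc n * cheb (Suc n) ?x = of_int (a ^ Suc n + b * d)) \<and>
    (\<exists>d::int. 2 * of_int b ^ n * cheb n ?x = of_int d)"
  proof (induction n)
    case 0
    then show ?case using assms by (auto intro: exI[of _ 0] exI[of _ 2])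
  next
    case (Suc n)
    then obtain d d' :: int where d: "2 * of_int b ^ Suc n * cheb (Suc n) ?x = of_int (a ^ Suc n + b * d)"
      and d': "2 * of_int b ^ n * cheb n ?x = of_int d'" by blast
    have x: "2 * of_int b * ?x = of_int a" using assms by simp
    have "2 * of_int b ^ Suc (Suc n) * cheb (Suc (Suc n)) ?x =
      (2 * of_int b * ?x) * (2 * of_int b ^ Suc n * cheb (Suc n) ?x) - (of_int b)^2 * (2 * of_int b ^ n * cheb n ?x)"
      by (simp only: cheb.simps power2_eq_square power_Suc) (simp only: algebra_simps)
    also have "\<dots> = of_int (a ^ Suc (Suc n) + b * (a * d - b * d'))"
      unfolding d d' x by (simp add: algebra_simps power2_eq_square)
    finally show ?case using d by blast
  qed
  then show ?thesis by blast
qed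

text \<open>Write \<open>2 cos t = a / b\<close> in lowest terms and choose \<open>n\<close> so that
  \<open>n t\<close> is a multiple of \<open>2 pi\<close>. Then \<open>cheb n (cos t) = 1\<close>,
  and clearing denominators shows that \<open>b\<close> divides \<open>a ^ n\<close>, so
  \<open>b = 1\<close>.\<close>

lemma niven:
  assumes "t / pi \<in> \<rat>" "cos t \<in> \<rat>"
  shows "2 * cos t \<in> {-2, -1, 0, 1, 2}"
proof -
  obtain p q :: int where pq: "q > 0" "t / pi = of_int p / of_int q"
    using assms(1) by (auto elim: Rats_cases')
  have "2 * cos t \<in> \<rat>" using assms(2) by simp
  then obtain a b :: int where ab: "b > 0" "coprime a b" "2 * cos t = of_int a / of_int b"
    by (elim Rats_cases') auto
  define n where "n = nat (2 * q)"
  have n0: "n > 0" and n: "real n = 2 * of_int q" using pq by (auto simp: n_def)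
  have "real n * t = 2 * pi * of_int p" using pq n by (simp add: field_simps)
  then have "cos (real n * t) = 1" using cos_int_2pin[of p] by (simp add: mult.commute)
  then have c: "cheb n (cos t) = 1" by (simp add: cheb_cos)
  have ct: "cos t = of_int a / (2 * of_int b)" using ab(3) by simp
  obtain k where k: "n = Suc k" using n0 by (cases n) auto
  obtain d :: int where "2 * of_int b ^ n * cheb n (cos t) = of_int (a ^ n + b * d)"
    using cheb_denominator[of b k a] ab(1) unfolding k ct by auto
  then have "real_of_int (2 * b ^ n) = of_int (a ^ n + b * d)" using c by simp
  then have "2 * b ^ n = a ^ n + b * d" by (simp only: of_int_eq_iff)
  then have "a ^ n = b * (2 * b ^ k - d)" unfolding k by (simp add: algebra_simps)
  then have "b dvd a ^ n" by simp
  then have "is_unit b" using ab(2)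
    by (metis coprime_commute coprime_power_right_iff coprime_absorb_left n0)
  then have "b = 1" using ab(1) by simp
  then have eq: "2 * cos t = of_int a" using ab(3) by simp
  have "\<bar>2 * cos t\<bar> \<le> 2" using abs_cos_le_one[of t] by linarith
  then have "\<bar>a\<bar> \<le> 2" unfolding eq by linarith
  then have "a \<in> {-2, -1, 0, 1, 2}" by auto
  then show ?thesis unfolding eq by auto
qed

text \<open>Eliminating \<open>F\<close> with \<open>rel\<close> leaves a rational relation between
  \<open>E\<close> and \<open>pi\<close>, whose coefficients vanish because \<open>E / pi\<close> is
  irrational. So all integer relations are multiples of \<open>rel\<close>.\<close>

lemma single_relation:
  fixes E F :: real and m n :: nat and a b c :: int
  assumes rel: "real m * E + real n * F = pi" and irr: "E / pi \<notin> \<rat>" and n0: "n > 0"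
    and z: "of_int a * E + of_int b * F + of_int c * pi = 0"
  shows "a = - c * int m" "b = - c * int n"
proof -
  have "of_int (int n * a - b * int m) * E + of_int (b + c * int n) * pi
      = real n * (of_int a * E + of_int b * F + of_int c * pi) + of_int b * (pi - (real m * E + real n * F))"
    by (simp add: algebra_simps)
  then have eq: "of_int (int n * a - b * int m) * E + of_int (b + c * int n) * pi = 0" using z rel by simp
  have 1: "int n * a - b * int m = 0"
  proof (rule ccontr)
    assume "int n * a - b * int m \<noteq> 0"
    then have "E / pi = - of_int (b + c * int n) / of_int (int n * a - b * int m)"
      using eq by (simp add: field_simps add_eq_0_iff del: of_int_diff of_int_mult of_int_add)
    also have "\<dots> \<in> \<rat>" by (intro Rats_divide Rats_minus_iff[THEN iffD2] Rats_of_int)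
    finally show False using irr by simp
  qed
  then have "real_of_int (b + c * int n) * pi = 0" using eq by simp
  then show 2: "b = - c * int n" by (simp del: of_int_add of_int_mult)
  have "int n * (a + c * int m) = 0" using 1 unfolding 2 by (simp add: algebra_simps)
  then show "a = - c * int m" using n0 by simp
qed

text \<open>If the relation \<open>m E + n F = pi\<close> generates all rational relations between \<open>E\<close>, \<open>F\<close>, \<open>pi\<close> and one of
  \<open>m\<close>, \<open>n\<close> is odd, then \<open>pi\<close> is not twice an element of the group generated by \<open>E\<close>, \<open>F\<close>, \<open>pi\<close> and a sign
  character exists on it; choosing coset representatives extends it to all directions.\<close>

lemma exists_sign_character:
  fixes E F :: real and m n :: nat
  assumes rel: "real m * E + real n * F = pi" and irr: "E / pi \<notin> \<rat>" and n0: "n > 0"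
    and odd: "odd m \<or> odd n"
  obtains w :: "real \<Rightarrow> real" and eps del :: real where "eps \<in> {1, -1}" "del \<in> {1, -1}"
    "\<And>t. w t \<in> {1, -1}" "\<And>t. w (t + pi) = - w t" "\<And>t. w (t + E) = eps * w t" "\<And>t. w (t + F) = del * w t"
proof -
  \<comment> \<open>Parities for \<open>E\<close> and \<open>F\<close>, chosen so that
    \<open>m E + n F\<close> comes out odd, in agreement with parity 1 for
    \<open>pi\<close>.\<close>
  define \<alpha> \<beta> :: int where "\<alpha> = (if odd m then 1 else 0)" "\<beta> = (if odd m then 0 else 1)"
  have par: "odd (int m * \<alpha> + int n * \<beta>)" using odd by (auto simp: \<alpha>_\<beta>_def)
  define val :: "int \<Rightarrow> int \<Rightarrow> int \<Rightarrow> real" where "val a b c = of_int a * E + of_int b * F + of_int c * pi" for a b c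
  have ker: "even (a * \<alpha> + b * \<beta> + c)" if "val a b c = 0" for a b c
  proof -
    note ab = single_relation[OF rel irr n0 that[unfolded val_def]]
    have "a * \<alpha> + b * \<beta> + c = c * (1 - (int m * \<alpha> + int n * \<beta>))" unfolding ab by (simp add: algebra_simps)
    then show ?thesis using par by simp
  qed
  define H where "H = {val a b c | a b c. True}"
  define pos where "pos h \<longleftrightarrow> (\<exists>a b c. h = val a b c \<and> even (a * \<alpha> + b * \<beta> + c))" for h
  have pos_val: "pos (val a b c) \<longleftrightarrow> even (a * \<alpha> + b * \<beta> + c)" for a b c
  proof
    assume "pos (val a b c)"
    then obtain a' b' c' where e: "val a b c = val a' b' c'" and ev: "even (a' * \<alpha> + b' * \<beta> + c')" by (auto simp: pos_def)
    have "val (a - a') (b - b') (c - c') = 0" using e by (simp add: val_def algebra_simps)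
    from ker[OF this] ev show "even (a * \<alpha> + b * \<beta> + c)" by (auto simp: algebra_simps)
  qed (auto simp: pos_def)
  \<comment> \<open>The chosen representative depends only on the coset of \<open>t\<close> modulo
    \<open>H\<close>; this is the content of \<open>r_shift\<close>.\<close>
  define r where "r t = (SOME u. t - u \<in> H)" for t
  have H_val: "val a b c \<in> H" for a b c by (auto simp: H_def)
  have H0: "0 \<in> H" using H_val[of 0 0 0] by (simp add: val_def)
  have r_in: "t - r t \<in> H" for t
    unfolding r_def by (rule someI[where x=t]) (use H0 in simp)
  have H_shift: "x + val a b c \<in> H \<longleftrightarrow> x \<in> H" for x a b c
  proof
    assume "x + val a b c \<in> H"
    then obtain a' b' c' where "x + val a b c = val a' b' c'" by (auto simp: H_def)
    then have "x = val (a' - a) (b' - b) (c' - c)" by (simp add: val_def algebra_simps)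
    then show "x \<in> H" using H_val by simp
  next
    assume "x \<in> H"
    then obtain a' b' c' where "x = val a' b' c'" by (auto simp: H_def)
    then have "x + val a b c = val (a' + a) (b' + b) (c' + c)" by (simp add: val_def algebra_simps)
    then show "x + val a b c \<in> H" using H_val by simp
  qed
  have r_shift: "r (t + val a b c) = r t" for t a b c
  proof -
    have "t + val a b c - u \<in> H \<longleftrightarrow> t - u \<in> H" for u using H_shift[of "t - u" a b c] by (simp add: algebra_simps)
    then show ?thesis by (simp add: r_def)
  qed
  define w :: "real \<Rightarrow> real" where "w t = (if pos (t - r t) then 1 else - 1)" for t
  have w_shift: "w (t + val a b c) = (if even (a * \<alpha> + b * \<beta> + c) then 1 else - 1) * w t" for t a b c
  proof -
    obtain a' b' c' where h: "t - r t = val a' b' c'" using r_in[of t] by (auto simp: H_def)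
    then have "t + val a b c - r t = val (a' + a) (b' + b) (c' + c)" by (simp add: val_def algebra_simps)
    then show ?thesis unfolding w_def r_shift h using pos_val by (auto simp: algebra_simps)
  qed
  show ?thesis
  proof (rule that[of "if even \<alpha> then 1 else - 1" "if even \<beta> then 1 else - 1" w])
    show "w (t + pi) = - w t" for t using w_shift[of t 0 0 1] by (simp add: val_def)
    show "w (t + E) = (if even \<alpha> then 1 else - 1) * w t" for t using w_shift[of t 1 0 0] by (simp add: val_def)
    show "w (t + F) = (if even \<beta> then 1 else - 1) * w t" for t using w_shift[of t 0 1 0] by (simp add: val_def)
  qed (auto simp: w_def)
qed

section \<open>The two types of side matrices\<close>

text \<open>Necessary for a tile edge of length \<open>l\<close> to lie on a side of length
  \<open>L\<close>: the rest of the side is made up of tile edges.\<close>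

definition fits :: "real \<Rightarrow> real \<Rightarrow> real \<Rightarrow> real \<Rightarrow> real \<Rightarrow> bool" where
  "fits e f g L l \<longleftrightarrow> (\<exists>n1 n2 n3. L = l + real n1 * e + real n2 * f + real n3 * g)"

text \<open>The corner \<open>E\<close> of \<open>ABC\<close> is filled by \<open>j, k, l\<close> tile angles \<open>E, F, G\<close>. If there is only one tile, its two
  edges \<open>l1, l2\<close> at the corner lie along the sides \<open>s f, s g\<close>.\<close>

definition corner_ok :: "real \<Rightarrow> real \<Rightarrow> real \<Rightarrow> real \<Rightarrow> nat \<Rightarrow> nat \<Rightarrow> nat \<Rightarrow> bool" where
  "corner_ok s e f g j k l \<longleftrightarrow>
     j * ang e f g + k * ang f e g + l * ang g e f = ang e f g \<and>
     (j + k + l = 1 \<longrightarrow> (\<exists>l1 l2. (j = 1 \<and> {l1, l2} = {f, g} \<or> k = 1 \<and> {l1, l2} = {e, g} \<or> l = 1 \<and> {l1, l2} = {e, f}) \<and>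
        fits e f g (s * f) l1 \<and> fits e f g (s * g) l2))"

text \<open>The coefficients of 1 and of \<open>s\<close> can be compared separately, and the edges
  filling the rest of the side contribute nonnegatively to both.\<close>

lemma fits_indep:
  fixes s kap :: real
  assumes "s \<notin> \<rat>" "kap \<noteq> 0" "fits e f g L l"
    and eqs: "e = kap * (e0 + e1 * s)" "f = kap * (f0 + f1 * s)" "g = kap * (g0 + g1 * s)" "L = kap * (L0 + L1 * s)" "l = kap * (l0 + l1 * s)"
    and rat: "e0 \<in> \<rat>" "e1 \<in> \<rat>" "f0 \<in> \<rat>" "f1 \<in> \<rat>" "g0 \<in> \<rat>" "g1 \<in> \<rat>" "L0 \<in> \<rat>" "L1 \<in> \<rat>" "l0 \<in> \<rat>" "l1 \<in> \<rat>"
    and nonneg: "0 \<le> e0" "0 \<le> e1" "0 \<le> f0" "0 \<le> f1" "0 \<le> g0" "0 \<le> g1"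
  shows "l0 \<le> L0" "l1 \<le> L1"
proof -
  obtain n1 n2 n3 :: nat where "kap * (L0 + L1 * s) = kap * (l0 + l1 * s) + n1 * (kap * (e0 + e1 * s)) + n2 * (kap * (f0 + f1 * s)) + n3 * (kap * (g0 + g1 * s))"
    using assms(3) unfolding fits_def eqs by blast
  then have "kap * (L0 + L1 * s) = kap * (l0 + l1 * s + n1 * (e0 + e1 * s) + n2 * (f0 + f1 * s) + n3 * (g0 + g1 * s))"
    by (simp only: algebra_simps)
  then have "L0 + L1 * s = l0 + l1 * s + n1 * (e0 + e1 * s) + n2 * (f0 + f1 * s) + n3 * (g0 + g1 * s)"
    using assms(2) by simp
  then have z: "(L0 - l0 - n1 * e0 - n2 * f0 - n3 * g0) + (L1 - l1 - n1 * e1 - n2 * f1 - n3 * g1) * s = 0"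
    by (simp add: algebra_simps)
  have q: "L0 - l0 - n1 * e0 - n2 * f0 - n3 * g0 \<in> \<rat>" "L1 - l1 - n1 * e1 - n2 * f1 - n3 * g1 \<in> \<rat>"
    using rat by auto
  have p: "0 \<le> n1 * e0" "0 \<le> n2 * f0" "0 \<le> n3 * g0" "0 \<le> n1 * e1" "0 \<le> n2 * f1" "0 \<le> n3 * g1"
    using nonneg by auto
  show "l0 \<le> L0" "l1 \<le> L1" using irrational_indep[OF assms(1) q z] p by linarith+
qed

section \<open>Type II: split corners and conjugate angles\<close>

lemma angle_combination_cases:
  fixes E F G :: real and j k l :: nat
  assumes "0 < E" "0 < F" "0 < G" "j * E + k * F + l * G = E"
  shows "j + k + l = 1 \<or> (j = 0 \<and> 2 \<le> k + l)"
proof (cases j)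
  case 0
  have "k + l \<noteq> 0"
  proof
    assume "k + l = 0"
    then show False using assms 0 by simp
  qed
  then show ?thesis using 0 by auto
next
  case (Suc j')
  then have "j' * E + k * F + l * G = 0" using assms(4) by (simp add: algebra_simps)
  moreover have "0 \<le> j' * E" "0 \<le> k * F" "0 \<le> l * G" using assms by auto
  ultimately have "j' * E = 0" "k * F = 0" "l * G = 0" by linarith+
  then show ?thesis using assms Suc by auto
qed

text \<open>In \<open>cos G = u + v s\<close> the rational part \<open>u = - r0 r1 / p\<close> is
  negative. As \<open>cheb n (cos G) = - 1\<close>, the conjugate \<open>y = u - v s\<close>
  satisfies the same equation, so \<open>- y\<close> is a cosine, and it is larger than
  \<open>cos G\<close>. Its angle lies below \<open>pi / n\<close>, while \<open>n\<close> times
  this angle has cosine 1 or -1; hence the angle is 0 and \<open>y = - 1\<close>. Then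
  \<open>v = 0\<close> and \<open>u = - 1\<close>, which would mean \<open>G = pi\<close>.\<close>

lemma conjugate_angle_contradiction:
  fixes p r0 r1 s :: real and n N :: nat
  assumes s: "s^2 = real N" "0 < s" "s \<notin> \<rat>" and p: "0 < p" "p \<in> \<rat>" and r: "0 < r0" "0 < r1" "r0 \<in> \<rat>" "r1 \<in> \<rat>"
    and tri: "tri_sides p s (r0 + r1 * s)" and n: "real n * ang (r0 + r1 * s) p s = pi"
  shows False
proof -
  let ?G = "ang (r0 + r1 * s) p s"
  have tri': "tri_sides (r0 + r1 * s) p s" using tri by (auto simp: tri_sides_def)
  have N: "real N = s * s" using s(1) by (simp add: power2_eq_square)
  define u v where "u = - (r0 * r1 / p)" and "v = (p^2 + N - r0^2 - r1^2 * N) / (2 * p * N)"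
  have rat: "u \<in> \<rat>" "v \<in> \<rat>" using p r by (auto simp: u_def v_def)
  have cG: "cos ?G = u + v * s"
    unfolding cos_ang[OF tri'] u_def v_def N using p s(2)
    by (simp add: field_simps power2_eq_square)
  have "cheb n (cos ?G) = - 1" by (simp add: cheb_cos n)
  moreover obtain U V where UV: "U \<in> \<rat>" "V \<in> \<rat>" "cheb n (u + v * s) = U + V * s" "cheb n (u - v * s) = U - V * s"
    using cheb_conjugate[OF rat, of s n] s(1) by auto
  ultimately have z: "(U + 1) + V * s = 0" by (simp add: cG)
  have U1: "U + 1 \<in> \<rat>" using UV(1) by simp
  have "U + 1 = 0" "V = 0" using irrational_indep[OF s(3) U1 UV(2) z] by simp_all
  then have ch: "cheb n (u - v * s) = - 1" using UV(4) by simp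
  define y where "y = u - v * s"
  have y1: "\<bar>y\<bar> \<le> 1" using cheb_eq_minus_one_imp[OF ch] by (simp add: y_def)
  define \<phi> where "\<phi> = arccos (- y)"
  have \<phi>: "0 \<le> \<phi>" "\<phi> \<le> pi" "cos \<phi> = - y" using y1 by (auto simp: \<phi>_def arccos_lbound arccos_ubound cos_arccos)
  have y: "- y = cos ?G + 2 * (r0 * r1 / p)" using cG by (simp add: y_def u_def)
  then have lt: "cos ?G < cos \<phi>" using \<phi>(3) p r by simp
  have Gb: "0 < ?G" "?G < pi" using ang_bounds[OF tri'] by auto
  have "\<phi> < ?G"
  proof (rule ccontr)
    assume "\<not> \<phi> < ?G"
    then have "cos \<phi> \<le> cos ?G" using Gb \<phi> by (intro cos_monotone_0_pi_le) auto
    then show False using lt by simp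
  qed
  have "cheb n (cos (pi - \<phi>)) = - 1" using ch by (simp add: \<phi>(3) y_def)
  then have c: "cos (n * (pi - \<phi>)) = - 1" by (simp only: cheb_cos)
  have n0: "n > 0" using n by (cases n) auto
  have "n * \<phi> < pi" using \<open>\<phi> < ?G\<close> n n0 by (metis mult_strict_left_mono of_nat_0_less_iff)
  moreover have "cos (n * \<phi>) = 1 \<or> cos (n * \<phi>) = - 1"
  proof -
    have "cos (n * (pi - \<phi>)) = cos (n * pi) * cos (n * \<phi>)"
      by (simp add: right_diff_distrib cos_diff)
    moreover have "cos (real n * pi) = 1 \<or> cos (real n * pi) = - 1"
      by (cases "even n") (auto simp: cos_npi)
    ultimately show ?thesis using c by auto
  qed
  moreover have "0 \<le> n * \<phi>" using \<phi> by simp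
  ultimately have "n * \<phi> = 0"
  proof -
    assume a: "n * \<phi> < pi" "cos (n * \<phi>) = 1 \<or> cos (n * \<phi>) = - 1" "0 \<le> n * \<phi>"
    have "cos (n * \<phi>) \<noteq> - 1"
    proof
      assume "cos (n * \<phi>) = - 1"
      then have e: "cos (n * \<phi>) = cos pi" by simp
      have "n * \<phi> = pi" by (rule cos_inj_pi[OF _ _ _ _ e]) (use a in auto)
      then show False using a by simp
    qed
    then have e: "cos (n * \<phi>) = cos 0" using a by simp
    show ?thesis by (rule cos_inj_pi[OF _ _ _ _ e]) (use a in auto)
  qed
  then have "\<phi> = 0" using n0 by simp
  then have "- y = 1" using \<phi>(3) by simp
  then have z: "(1 + u) + (- v) * s = 0" by (simp add: y_def)
  have rat': "1 + u \<in> \<rat>" "- v \<in> \<rat>" using rat by auto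
  have "1 + u = 0" "v = 0" using irrational_indep[OF s(3) rat' z] by simp_all
  then have "cos ?G = cos pi" using cG by simp
  then have "?G = pi" by (rule cos_inj_pi[rotated 4]) (use Gb in auto)
  then show False using Gb by simp
qed

lemma typeII_reduces_to_typeI:
  fixes e f g s :: real and N :: nat
  assumes tri: "tri_sides e f g" and s: "s^2 = real N" "0 < s" "s \<notin> \<rat>" and II: "typeII s e f g"
    and ce: "\<exists>j k l. corner_ok s e f g j k l" and cf: "\<exists>j k l. corner_ok s f e g j k l"
  shows "typeI s e g f \<or> typeI s f g e"
proof (rule ccontr)
  assume notI: "\<not> (typeI s e g f \<or> typeI s f g e)"
  have pos: "0 < e" "0 < f" "0 < g" using tri by (auto simp: tri_sides_def)
  obtain p q t x y :: nat where h: "s * e = p * f" "s * f = q * e" "s * g = t * g + x * e + y * f"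
    using II unfolding typeII_def by blast
  have N: "real N = s * s" using s(1) by (simp add: power2_eq_square)
  have N0: "0 < real N" using s by (simp add: N)
  have "0 < real p * f" using h(1)[symmetric] pos s by simp
  then have p0: "0 < real p" using pos by (simp add: zero_less_mult_iff)
  \<comment> \<open>Unit of length in which \<open>e = p\<close> and \<open>f = s\<close>; the third
    side then becomes \<open>r0 + r1 s\<close> with rational coefficients.\<close>
  define kap where "kap = e / p"
  have kap0: "0 < kap" using pos p0 by (simp add: kap_def)
  have e: "e = kap * (p + 0 * s)" using p0 by (simp add: kap_def)
  have f: "f = kap * (0 + 1 * s)" using h(1) p0 by (simp add: kap_def field_simps)
  have gt: "(s - t) * g = x * e + y * f" using h(3) by (simp add: algebra_simps)
  have "s \<noteq> real t" using s(3) by auto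
  moreover have "0 \<le> (s - t) * g" unfolding gt using pos by simp
  ultimately have st: "real t < s" using pos by (auto simp: zero_le_mult_iff)
  \<comment> \<open>Multiplying \<open>(s - t) g = x e + y f\<close> by \<open>s + t\<close> turns
    the factor of \<open>g\<close> into the positive rational number \<open>D\<close>.\<close>
  define D where "D = real N - (real t)^2"
  have D: "D = (s - t) * (s + t)" by (simp add: D_def N algebra_simps power2_eq_square)
  have D0: "0 < D" unfolding D using st by (intro mult_pos_pos) auto
  define r0 r1 where "r0 = (real x * p * t + y * N) / D" and "r1 = (real x * p + y * t) / D"
  have r: "r0 \<in> \<rat>" "r1 \<in> \<rat>" "0 \<le> r0" "0 \<le> r1" using D0 by (auto simp: r0_def r1_def D_def)
  have g: "g = kap * (r0 + r1 * s)"
  proof -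
    have "D * g = (s + t) * ((s - t) * g)" by (simp add: D mult.commute mult.left_commute)
    also have "\<dots> = (s + t) * (x * (kap * p) + y * (kap * s))" unfolding gt by (subst e, subst f) simp
    also have "\<dots> = kap * ((real x * p * t + y * N) + (real x * p + y * t) * s)" by (simp add: N algebra_simps)
    also have "\<dots> = D * (kap * (r0 + r1 * s))" using D0 by (simp add: r0_def r1_def field_simps)
    finally show ?thesis using D0 by simp
  qed
  \<comment> \<open>If \<open>r1\<close> or \<open>r0\<close> vanishes, the third row shrinks to
    \<open>s g = y f\<close> or to \<open>s g = x e\<close>, which is type I after
    relabelling.\<close>
  have r1: "0 < r1"
  proof (rule ccontr)
    assume "\<not> 0 < r1"
    then have "r1 = 0" using r by simp
    then have "real x * p + y * t = 0" using D0 by (simp add: r1_def)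
    then have "real x * p = 0" "real y * t = 0" by (metis add_nonneg_eq_0_iff of_nat_0_le_iff of_nat_mult)+
    then have "x = 0" "y = 0 \<or> t = 0" using p0 by auto
    then have "s * g = real y * f" using h(3) pos s by auto
    then show False using notI h(1) by (auto simp: typeI_def)
  qed
  have r0: "0 < r0"
  proof (rule ccontr)
    assume "\<not> 0 < r0"
    then have "r0 = 0" using r by simp
    then have "real x * p * t + y * N = 0" using D0 by (simp add: r0_def)
    then have "real x * p * t = 0" "real y * N = 0" by (metis add_nonneg_eq_0_iff of_nat_0_le_iff of_nat_mult)+
    then have "y = 0" "x = 0 \<or> t = 0" using p0 N0 by auto
    then have "s * g = real x * e" using h(3) pos s by auto
    then show False using notI h(2) by (auto simp: typeI_def)
  qed
  define E F G where "E = ang e f g" "F = ang f e g" "G = ang g e f"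
  have t2: "tri_sides f e g" "tri_sides g e f" "tri_sides e g f" using tri by (auto simp: tri_sides_def)
  have ang0: "0 < E" "0 < F" "0 < G" using ang_bounds[OF tri] ang_bounds[OF t2(1)] ang_bounds[OF t2(2)] by (auto simp: E_F_G_def)
  have ef: "e \<noteq> f"
  proof
    assume "e = f"
    then have "s = real p" using e f kap0 by simp
    then show False using s(3) by auto
  qed
  have ge: "g \<noteq> e"
  proof
    assume "g = e"
    then have "(r0 - p) + r1 * s = 0" using e g kap0 by simp
    moreover have "r0 - p \<in> \<rat>" using r by auto
    ultimately show False using irrational_indep(2)[OF s(3) _ r(2)] r1 by fastforce
  qed
  have gf: "g \<noteq> f"
  proof
    assume "g = f"
    then have "kap * (r0 + r1 * s) = kap * s" using f g by simp
    then have "r0 + r1 * s = s" using kap0 by simp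
    then have z: "r0 + (r1 - 1) * s = 0" by (simp add: algebra_simps)
    have "r1 - 1 \<in> \<rat>" using r by auto
    then show False using irrational_indep(1)[OF s(3) r(1) _ z] r0 by simp
  qed
  have EF: "E \<noteq> F" using ang_eq_imp_sides_eq[OF tri] ef by (auto simp: E_F_G_def)
  have EG: "E \<noteq> G" using ang_eq_imp_sides_eq[OF t2(3)] ge by (auto simp: E_F_G_def ang_commute[of e g f])
  have FG: "F \<noteq> G"
  proof
    assume "F = G"
    moreover have "tri_sides f g e" using tri by (auto simp: tri_sides_def)
    ultimately show False using ang_eq_imp_sides_eq[of f g e] gf by (auto simp: E_F_G_def ang_commute)
  qed
  have sf: "s * f = kap * (N + 0 * s)" by (subst f) (simp add: N)
  have se: "s * e = kap * (0 + p * s)" by (subst e) simp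
  \<comment> \<open>In the unit \<open>kap\<close>, \<open>s f\<close> is the rational number
    \<open>N\<close>, whereas \<open>f\<close> and \<open>g\<close> have positive
    \<open>s\<close>-coefficients. Dually, \<open>s e\<close> is a multiple of \<open>s\<close>,
    whereas \<open>e\<close> and \<open>g\<close> have positive rational parts.\<close>
  have nofit1: "\<not> fits e f g (s * f) l" if "l = f \<or> l = g" for l
    using that fits_indep(2)[OF s(3) _ _ e f g sf f] fits_indep(2)[OF s(3) _ _ e f g sf g] r r1 kap0 by auto
  have nofit2: "\<not> fits f e g (s * e) l" if "l = e \<or> l = g" for l
    using that fits_indep(1)[OF s(3) _ _ f e g se e] fits_indep(1)[OF s(3) _ _ f e g se g] r r0 kap0 p0 by auto
  obtain j k l where c1: "corner_ok s e f g j k l" using ce by blast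
  obtain j' k' l' where c2: "corner_ok s f e g j' k' l'" using cf by blast
  have a1: "j * E + k * F + l * G = E" using c1 by (simp add: corner_ok_def E_F_G_def)
  have a2: "j' * F + k' * E + l' * G = F" using c2 by (simp add: corner_ok_def E_F_G_def ang_commute[of g f e])
  have n1: "j + k + l \<noteq> 1"
  proof
    assume one: "j + k + l = 1"
    then consider "j = 1" "k = 0" "l = 0" | "j = 0" "k = 1" "l = 0" | "j = 0" "k = 0" "l = 1" by linarith
    then show False
    proof cases
      case 1
      then obtain l1 l2 where "{l1, l2} = {f, g}" "fits e f g (s * f) l1"
        using c1 unfolding corner_ok_def by auto
      then show False using nofit1[of l1] by (auto simp: doubleton_eq_iff)
    qed (use a1 EF EG in auto)
  qed
  have n2: "j' + k' + l' \<noteq> 1"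
  proof
    assume one: "j' + k' + l' = 1"
    then consider "j' = 1" "k' = 0" "l' = 0" | "j' = 0" "k' = 1" "l' = 0" | "j' = 0" "k' = 0" "l' = 1" by linarith
    then show False
    proof cases
      case 1
      then obtain l1 l2 where "{l1, l2} = {e, g}" "fits f e g (s * e) l1"
        using c2 unfolding corner_ok_def by auto
      then show False using nofit2[of l1] by (auto simp: doubleton_eq_iff)
    qed (use a2 EF FG in auto)
  qed
  have j0: "j = 0" "2 \<le> k + l" using angle_combination_cases[OF ang0 a1] n1 by auto
  have j'0: "j' = 0" "2 \<le> k' + l'" using angle_combination_cases[OF ang0(2,1,3) a2] n2 by auto
  have b1: "E = k * F + l * G" using a1 j0 by simp
  have b2: "F = k' * E + l' * G" using a2 j'0 by simp
  \<comment> \<open>If \<open>F\<close> occurs in \<open>E\<close>, then \<open>F \<le> E\<close>,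
    and as the two differ, \<open>E\<close> cannot occur in \<open>F\<close>. So one of them is a
    multiple of \<open>G\<close>, hence both are.\<close>
  have "\<exists>a b. E = real a * G \<and> F = real b * G"
  proof (cases "k = 0")
    case True
    then have "E = l * G" "F = (k' * l + l') * G" using b1 b2 by (auto simp: algebra_simps)
    then show ?thesis by blast
  next
    case False
    then have "F \<le> k * F" using ang0 by (cases k) (auto simp: algebra_simps)
    then have FE: "F \<le> E" using b1 ang0 by (smt (verit) mult_nonneg_nonneg of_nat_0_le_iff)
    have "k' = 0"
    proof (rule ccontr)
      assume "k' \<noteq> 0"
      then have "E \<le> k' * E" using ang0 by (cases k') (auto simp: algebra_simps)
      then have "E \<le> F" using b2 ang0 by (smt (verit) mult_nonneg_nonneg of_nat_0_le_iff)
      then show False using FE EF by simp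
    qed
    then have F: "F = l' * G" using b2 by simp
    have "E = (k * l' + l) * G" using b1 unfolding F by (simp add: algebra_simps)
    then show ?thesis using F by blast
  qed
  then obtain a b :: nat where ab: "E = a * G" "F = b * G" by blast
  have "E + F + G = pi" using ang_sum[OF tri] by (simp add: E_F_G_def)
  then have nG: "real (a + b + 1) * G = pi" using ab by (simp add: algebra_simps)
  have tri': "tri_sides p s (r0 + r1 * s)"
  proof -
    have "tri_sides (kap * p) (kap * s) (kap * (r0 + r1 * s))" using tri e f g by simp
    then have "0 < kap * p" "0 < kap * s" "0 < kap * (r0 + r1 * s)" "kap * p < kap * (s + (r0 + r1 * s))"
      "kap * s < kap * ((r0 + r1 * s) + p)" "kap * (r0 + r1 * s) < kap * (p + s)"
      by (auto simp: tri_sides_def distrib_left)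
    then show ?thesis using kap0 by (simp add: tri_sides_def zero_less_mult_iff)
  qed
  have "G = ang (kap * (r0 + r1 * s)) (kap * p) (kap * s)" using e f g by (simp add: E_F_G_def)
  then have "G = ang (r0 + r1 * s) p s" by (simp only: ang_scale[OF kap0])
  then have "real (a + b + 1) * ang (r0 + r1 * s) p s = pi" using nG by metis
  from conjugate_angle_contradiction[OF s p0 _ r0 r1 r(1,2) tri' this] show False by simp
qed

section \<open>Type I: rational and irrational angles\<close>

text \<open>Niven's theorem for the angle opposite \<open>s\<close> gives
  \<open>N = x^2 + y^2 - k x y\<close> with \<open>k\<close> in {-1, 0, 1}. For \<open>k = 0\<close>
  this is a sum of two squares; otherwise Niven's theorem for the doubles of the other two angles
  leaves three times a square.\<close>

lemma typeI_torsion: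
  fixes x y N :: nat and s :: real
  assumes s: "s^2 = real N" "0 < s" "s \<notin> \<rat>" and tri: "tri_sides x y s"
    and E: "ang x y s / pi \<in> \<rat>" and F: "ang y x s / pi \<in> \<rat>"
  shows "(\<exists>a b::int. int N = a^2 + b^2) \<or> (\<exists>k::int. int N = 3 * k^2)"
proof -
  have t2: "tri_sides y x s" "tri_sides s x y" using tri by (auto simp: tri_sides_def)
  have xy: "0 < real x" "0 < real y" using tri by (auto simp: tri_sides_def)
  have N: "real N = s * s" using s(1) by (simp add: power2_eq_square)
  have nosq: "int N \<noteq> a^2" for a
  proof
    assume "int N = a^2"
    then have "real_of_int (int N) = (of_int a)^2" by simp
    then have "s^2 = (of_int a)^2" using s by simp
    then have "s = of_int a \<or> s = - of_int a" by (simp add: power2_eq_iff)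
    then show False using s(3) by auto
  qed
  let ?X = "int x" and ?Y = "int y" and ?N = "int N"
  have g: "ang s x y / pi = 1 - ang x y s / pi - ang y x s / pi"
    using ang_sum[OF tri, THEN arg_cong[where f="\<lambda>x. x / pi"]] by (simp add: add_divide_distrib)
  have Gt: "ang s x y / pi \<in> \<rat>" unfolding g using E F by auto
  have cG: "2 * cos (ang s x y) = of_int (?X^2 + ?Y^2 - ?N) / of_int (?X * ?Y)"
    unfolding cos_ang[OF t2(2)] using s(1) xy by (simp add: field_simps)
  then have "cos (ang s x y) \<in> \<rat>"
    by (metis Rats_divide Rats_number_of Rats_of_int nonzero_mult_div_cancel_left zero_neq_numeral)
  from niven[OF Gt this] have "2 * cos (ang s x y) \<in> {- 2, - 1, 0, 1, 2}" .
  moreover have "cos (ang s x y) \<noteq> 1" "cos (ang s x y) \<noteq> - 1"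
    unfolding cos_ang[OF t2(2)] using ang_arg_bounds[OF t2(2)] by (metis less_irrefl)+
  ultimately have "\<exists>k::int. k \<in> {-1, 0, 1} \<and> 2 * cos (ang s x y) = of_int k"
    by (auto intro: exI[of _ "-1"] exI[of _ 0] exI[of _ 1])
  then obtain k :: int where k: "k \<in> {-1, 0, 1}" "2 * cos (ang s x y) = of_int k" by blast
  then have "real_of_int (?X^2 + ?Y^2 - ?N) = of_int (k * (?X * ?Y))" using cG xy by (simp add: field_simps)
  then have "?X^2 + ?Y^2 - ?N = k * (?X * ?Y)" by (simp only: of_int_eq_iff)
  then have Neq: "?N = ?X^2 + ?Y^2 - k * (?X * ?Y)" by simp
  \<comment> \<open>The cosine of this angle is a rational multiple of \<open>1 / s\<close>, so its
    square, and with it the cosine of the doubled angle, is rational. The value \<open>j = 1\<close>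
    would make \<open>N\<close> a square.\<close>
  have double: "\<exists>j::int. j \<in> {0, 2, 3} \<and> (2 * b - k * a)^2 = j * int N"
    if ab: "0 < a" "0 < b" and tri: "tri_sides (of_int a) (of_int b) s" and rat: "ang (of_int a) (of_int b) s / pi \<in> \<rat>"
      and Neq: "int N = a^2 + b^2 - k * (a * b)" for a b :: int
  proof -
    let ?E = "ang (of_int a) (of_int b) s"
    have c: "(cos ?E)^2 = of_int ((2 * b - k * a)^2) / (4 * of_int (int N))"
    proof -
      have "(of_int b)^2 + s^2 - (of_int a)^2 = of_int b * real_of_int (2 * b - k * a)"
      proof -
        have "real_of_int (int N) = of_int (a^2 + b^2 - k * (a * b))" using Neq by simp
        then show ?thesis using s(1) by (simp add: algebra_simps power2_eq_square)
      qed
      then have "cos ?E = of_int (2 * b - k * a) / (2 * s)" unfolding cos_ang[OF tri] using ab s(2) by simp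
      then show ?thesis using s(1) by (simp add: power_divide)
    qed
    have c2: "cos (2 * ?E) = 2 * (cos ?E)^2 - 1" by (rule cos_double_cos)
    have "cos (2 * ?E) \<in> \<rat>" unfolding c2 c by auto
    moreover have "2 * ?E / pi \<in> \<rat>" using rat by (metis Rats_mult Rats_number_of times_divide_eq_right)
    ultimately have "2 * cos (2 * ?E) \<in> {-2, -1, 0, 1, 2}" using niven by blast
    moreover have "cos (2 * ?E) \<noteq> 1"
    proof
      assume "cos (2 * ?E) = 1"
      then have "sin ?E = 0" using cos_double_sin[of ?E] by simp
      then show False using sin_ang_pos[OF tri] by simp
    qed
    ultimately have "4 * (cos ?E)^2 = 0 \<or> 4 * (cos ?E)^2 = 1 \<or> 4 * (cos ?E)^2 = 2 \<or> 4 * (cos ?E)^2 = 3"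
      unfolding c2 insert_iff empty_iff by argo
    then have "4 * (cos ?E)^2 \<in> real_of_int ` {0, 1, 2, 3}" by simp
    then obtain j :: int where j: "j \<in> {0, 1, 2, 3}" "4 * (cos ?E)^2 = of_int j" by (elim imageE)
    have "0 < real N" using s N by simp
    then have "real_of_int ((2 * b - k * a)^2) = of_int (j * int N)" using j(2) unfolding c by (simp add: field_simps)
    then have eq: "(2 * b - k * a)^2 = j * int N" by (simp only: of_int_eq_iff)
    then have "j \<noteq> 1" using nosq[of "2 * b - k * a"] by auto
    then show ?thesis using eq j(1) by auto
  qed
  obtain j where j: "j \<in> {0, 2, 3}" "(2 * ?Y - k * ?X)^2 = j * ?N"
    using double[of ?X ?Y] xy tri E Neq by auto
  obtain j' where j': "j' \<in> {0, 2, 3}" "(2 * ?X - k * ?Y)^2 = j' * ?N"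
    using double[of ?Y ?X] xy t2(1) F Neq by (auto simp: algebra_simps)
  have XY: "?X > 0" "?Y > 0" using xy by auto
  \<comment> \<open>For \<open>j = 0\<close> and for \<open>j = 3\<close> the quadratic relation
    splits into linear ones between \<open>a\<close> and \<open>b\<close>.\<close>
  have fin: "?N = 3 * b^2 \<or> ?N = 3 * a^2"
    if k: "k = 1 \<or> k = - 1" and N: "?N = a^2 + b^2 - k * (a * b)" and eq: "(2 * b - k * a)^2 = j * ?N" and j: "j = 0 \<or> j = 3" for a b j :: int
    using j
  proof
    assume "j = 0"
    then have "2 * b = k * a" using eq by simp
    then have "a = 2 * k * b" using k by auto
    then have "?N = 3 * b^2" using N k by (auto simp: power2_eq_square)
    then show ?thesis by simp
  next
    assume "j = 3"
    have "(b - 2 * k * a) * (b + k * a) = (2 * b - k * a)^2 - 3 * (a^2 + b^2 - k * (a * b))"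
      using k by (auto simp: algebra_simps power2_eq_square)
    also have "\<dots> = 0" using eq N \<open>j = 3\<close> by simp
    finally have "b = 2 * k * a \<or> b = - k * a" by (auto simp: add_eq_0_iff)
    then have "?N = 3 * a^2" using N k by (auto simp: power2_eq_square)
    then show ?thesis by simp
  qed
  show ?thesis
  proof (cases "k = 0")
    case True
    then show ?thesis using Neq by auto
  next
    case False
    then have k1: "k = 1 \<or> k = - 1" using k(1) by auto
    consider "j = 0 \<or> j = 3" | "j' = 0 \<or> j' = 3" | "j = 2" "j' = 2" using j j' by auto
    then show ?thesis
    proof cases
      case 1
      then show ?thesis using fin[OF k1 Neq j(2)] by blast
    next
      case 2
      have "?N = ?Y^2 + ?X^2 - k * (?Y * ?X)" using Neq by (simp add: algebra_simps)
      then show ?thesis using fin[OF k1 _ j'(2)] 2 by blast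
    next
      case 3
      \<comment> \<open>Equality of the two squares gives \<open>x = y\<close>. Then
        \<open>N = (2 - k) x^2\<close>, and \<open>k = 1\<close> is impossible because
        \<open>N\<close> is not a square.\<close>
      have "(2 * ?Y - k * ?X)^2 = (2 * ?X - k * ?Y)^2" using j j' 3 by simp
      then have "3 * (?X^2 - ?Y^2) = 0" using k1 by (auto simp: power2_eq_square algebra_simps)
      then have "?X = ?Y" using XY by (simp add: power2_eq_iff)
      then have "?N = (2 - k) * ?X^2" "(2 - k)^2 * ?X^2 = 2 * ?N" using Neq j 3 by (auto simp: algebra_simps power2_eq_square)
      then have "?N = ?X^2 \<or> ?N = 3 * ?X^2" using k1 by auto
      then show ?thesis using nosq by blast
    qed
  qed
qed


text \<open>The geometry enters through hypotheses: \<open>corner\<close> for the corner G,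
  \<open>count\<close> for the counting of angles at vertices, \<open>char\<close> for the weighted
  edge lengths. In \<open>corner_ok s g e f j k l\<close> the angles come in the order G, E, F, so
  there \<open>j\<close> counts G.\<close>

lemma typeI_conclusion:
  fixes e f g s :: real and N :: nat
  defines "E \<equiv> ang e f g" and "F \<equiv> ang f e g" and "G \<equiv> ang g e f"
  assumes tri: "tri_sides e f g" and s: "s^2 = real N" "0 < s" "s \<notin> \<rat>" and I: "typeI s e f g"
    and corner: "\<exists>j k l. corner_ok s g e f j k l"
    and count: "\<lbrakk>\<And>p q r h. h \<in> {1, 2} \<Longrightarrow> real p * E + real q * F + real r * G = real h * pi \<Longrightarrow> r \<le> h;
      \<And>j k l. corner_ok s e f g j k l \<Longrightarrow> l = 0; \<And>j k l. corner_ok s f e g j k l \<Longrightarrow> l = 0;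
      \<And>j k l. corner_ok s g e f j k l \<Longrightarrow> j = 0\<rbrakk> \<Longrightarrow> False"
    and char: "\<And>w eps del. \<lbrakk>eps \<in> {1, -1}; del \<in> {1, -1}; \<And>t. w t \<in> {1, -1}; \<And>t. w (t + pi) = - w t;
      \<And>t. w (t + E) = eps * w t; \<And>t. w (t + F) = del * w t\<rbrakk>
      \<Longrightarrow> \<exists>k::int. s * (g - eps * f - del * e) = k * (g - eps * f - del * e)"
  shows "(\<exists>a b::int. int N = a^2 + b^2) \<or> (\<exists>k::int. int N = 3 * k^2)"
proof -
  have pos: "0 < e" "0 < f" "0 < g" using tri by (auto simp: tri_sides_def)
  obtain x y :: nat where h: "s * e = x * g" "s * f = y * g" using I unfolding typeI_def by blast
  define kap where "kap = g / s"
  have kap0: "0 < kap" using pos s by (simp add: kap_def)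
  have e: "e = kap * (x + 0 * s)" and f: "f = kap * (y + 0 * s)" and g: "g = kap * (0 + 1 * s)"
    using h s(2) by (auto simp: kap_def field_simps)
  have xy: "0 < real x" "0 < real y" using e f pos kap0 by (auto simp: zero_less_mult_iff)
  have t2: "tri_sides f e g" "tri_sides g e f" using tri by (auto simp: tri_sides_def)
  have ang0: "0 < E" "0 < F" "0 < G" using ang_bounds[OF tri] ang_bounds[OF t2(1)] ang_bounds[OF t2(2)]
    by (auto simp: E_def F_def G_def)
  have sum: "E + F + G = pi" using ang_sum[OF tri] by (simp add: E_def F_def G_def)
  have se: "s * e = kap * (0 + x * s)" "s * f = kap * (0 + y * s)" using e f by simp_all
  \<comment> \<open>In the unit \<open>kap\<close> the sides \<open>s e\<close> and
    \<open>s f\<close> have no rational part, whereas \<open>e\<close> and \<open>f\<close> are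
    rational and positive, so neither fits on these sides.\<close>
  have nofit: "\<not> fits g e f (kap * (0 + real z * s)) l" if "l = e \<or> l = f" for l z
    using that fits_indep(1)[OF s(3) _ _ g e f refl[of "kap * (0 + real z * s)"] e]
      fits_indep(1)[OF s(3) _ _ g e f refl[of "kap * (0 + real z * s)"] f] xy kap0 by auto
  have cornerG: "j = 0 \<and> 2 \<le> k + l \<and> k * E + l * F = G" if c: "corner_ok s g e f j k l" for j k l
  proof -
    have a: "j * G + k * E + l * F = G"
      using c by (simp add: corner_ok_def E_def F_def G_def ang_commute[of e g f] ang_commute[of f g e])
    have "j + k + l \<noteq> 1"
    proof
      assume one: "j + k + l = 1"
      then obtain l1 l2 where l: "{l1, l2} = {e, f} \<or> {l1, l2} = {g, f} \<or> {l1, l2} = {g, e}"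
        and "fits g e f (s * e) l1" "fits g e f (s * f) l2" using c unfolding corner_ok_def by auto
      then have "\<not> (l1 = e \<or> l1 = f)" "\<not> (l2 = e \<or> l2 = f)" using nofit unfolding se by blast+
      then show False using l by (auto simp: doubleton_eq_iff)
    qed
    then have "j = 0 \<and> 2 \<le> k + l" using angle_combination_cases[OF ang0(3,1,2) a] by auto
    then show ?thesis using a by auto
  qed
  obtain k l :: nat where kl: "2 \<le> k + l" "k * E + l * F = G" using corner cornerG by blast
  \<comment> \<open>Adding one \<open>E\<close> and one \<open>F\<close> to
    \<open>k E + l F = G\<close> yields \<open>pi\<close>, whence the shift by one.\<close>
  define m n where "m = Suc k" and "n = Suc l"
  have mn: "0 < m" "0 < n" "4 \<le> m + n" using kl by (auto simp: m_def n_def)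
  have rel: "m * E + n * F = pi" using kl(2) sum by (simp add: m_def n_def algebra_simps)
  have G: "G = (real m - 1) * E + (real n - 1) * F" using kl(2) by (simp add: m_def n_def)
  have tri': "tri_sides x y s"
  proof -
    have "0 < kap * x" "0 < kap * y" "0 < kap * s" "kap * x < kap * (y + s)" "kap * y < kap * (s + x)" "kap * s < kap * (x + y)"
      using tri e f g by (auto simp: tri_sides_def distrib_left)
    then show ?thesis using kap0 by (simp add: tri_sides_def zero_less_mult_iff)
  qed
  have "E = ang (kap * x) (kap * y) (kap * s)" "F = ang (kap * y) (kap * x) (kap * s)" using e f g by (simp_all add: E_def F_def)
  then have Exy: "E = ang x y s" "F = ang y x s" by (simp_all only: ang_scale[OF kap0])
  show ?thesis
  proof (cases "E / pi \<in> \<rat>")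
    case True
    have "F / pi = (1 - m * (E / pi)) / n" using rel mn by (simp add: field_simps)
    also have "\<dots> \<in> \<rat>" using True by (metis Rats_1 Rats_diff Rats_divide Rats_mult Rats_of_nat)
    finally show ?thesis using typeI_torsion[OF s tri'] True Exy by simp
  next
    case False
    show ?thesis
    proof (cases "odd m \<or> odd n")
      case True
      show ?thesis
      proof (rule exists_sign_character[OF rel False mn(2) True])
        fix w :: "real \<Rightarrow> real" and eps del :: real
        assume w: "eps \<in> {1, -1}" "del \<in> {1, -1}" "\<And>t. w t \<in> {1, -1}" "\<And>t. w (t + pi) = - w t"
          "\<And>t. w (t + E) = eps * w t" "\<And>t. w (t + F) = del * w t"
      obtain k :: int where k: "s * (g - eps * f - del * e) = k * (g - eps * f - del * e)" using char[OF w] by blast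
      have "g - eps * f - del * e \<noteq> 0" using w(1,2) tri by (auto simp: tri_sides_def)
      then have "s = of_int k" using k by simp
      then show ?thesis using s(3) by auto
      qed
    next
      case ev: False
      show ?thesis
      proof (cases "m = 2 \<and> n = 2")
        case True
        then have "G = pi / 2" using G rel sum by simp
        then have "cos G = 0" by (metis cos_pi_half)
        then have "e^2 + f^2 - g^2 = 0" using cos_ang[OF t2(2)] pos by (simp add: G_def)
        then have "kap^2 * (real x ^ 2 + real y ^ 2) = kap^2 * s^2" using e f g
          by (simp add: power_mult_distrib algebra_simps)
        then have "real (x^2 + y^2) = real N" using kap0 s(1) by simp
        then have "x^2 + y^2 = N" by (simp only: of_nat_eq_iff)
        then have "int N = (int x)^2 + (int y)^2" by auto
        then show ?thesis by blast
      next
        case nottwo: False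
        have indep: "a = 0 \<and> b = 0" if z: "of_int a * E + of_int b * F = 0" for a b :: int
          using single_relation[OF rel False mn(2), of a b 0] z by simp
        have False
        proof (rule count)
          fix p q r h :: nat
          assume h: "h \<in> {1, 2}" and eq: "p * E + q * F + r * G = h * pi"
          \<comment> \<open>With \<open>G\<close> expressed by \<open>E\<close> and
            \<open>F\<close>, coefficients can be compared: \<open>p + r (m - 1) = h m\<close> and
            \<open>q + r (n - 1) = h n\<close>. For \<open>r > h\<close> this bounds
            \<open>m\<close> and \<open>n\<close> by \<open>h + 1 \<le> 3\<close>, and being even
            they are both 2.\<close>
          have "of_int (int p + int r * (int m - 1) - int h * int m) * E + of_int (int q + int r * (int n - 1) - int h * int n) * F
            = (p * E + q * F + r * G) - h * (m * E + n * F)" unfolding G by (simp add: algebra_simps)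
          also have "\<dots> = 0" using eq rel by simp
          finally have z: "int r * (int m - 1) \<le> int h * int m" "int r * (int n - 1) \<le> int h * int n"
            using indep by fastforce+
          show "r \<le> h"
          proof (rule ccontr)
            assume "\<not> r \<le> h"
            then have r: "int h + 1 \<le> int r" by simp
            have "(int h + 1) * (int m - 1) \<le> int h * int m" "(int h + 1) * (int n - 1) \<le> int h * int n"
              using z mult_right_mono[OF r, of "int m - 1"] mult_right_mono[OF r, of "int n - 1"] mn by linarith+
            then have "int m \<le> int h + 1" "int n \<le> int h + 1" by (simp_all add: algebra_simps)
            then have "m \<le> 3" "n \<le> 3" using h by auto
            then have "m = 2" "n = 2" using ev mn by presburger+
            then show False using nottwo by simp
          qed
        next
          fix j k l assume "corner_ok s e f g j k l"
          then have a: "j * E + k * F + l * G = E" by (simp add: corner_ok_def E_def F_def G_def)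
          have "of_int (int j - 1 + int l * (int m - 1)) * E + of_int (int k + int l * (int n - 1)) * F = 0"
            using a unfolding G by (simp add: algebra_simps)
          then have "int k + int l * (int n - 1) = 0" using indep by blast
          moreover have "0 \<le> int l * (int n - 1)" "n \<noteq> 1" using mn ev by auto
          ultimately have "int l * (int n - 1) = 0" "n \<noteq> 1" by linarith+
          then show "l = 0" by simp
        next
          fix j k l assume "corner_ok s f e g j k l"
          then have a: "j * F + k * E + l * G = F" by (simp add: corner_ok_def E_def F_def G_def ang_commute[of g f e])
          have "of_int (int k + int l * (int m - 1)) * E + of_int (int j - 1 + int l * (int n - 1)) * F = 0"
            using a unfolding G by (simp add: algebra_simps)
          then have "int k + int l * (int m - 1) = 0" using indep by blast
          moreover have "0 \<le> int l * (int m - 1)" "m \<noteq> 1" using mn ev by auto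
          ultimately have "int l * (int m - 1) = 0" "m \<noteq> 1" by linarith+
          then show "l = 0" by simp
        next
          fix j k l assume "corner_ok s g e f j k l"
          then show "j = 0" using cornerG by blast
        qed
        then show ?thesis ..
      qed
    qed
  qed
qed

section \<open>Area of strips\<close>

abbreviation area :: "(real^2) set \<Rightarrow> real" where "area \<equiv> measure lebesgue"

definition dir :: "real \<Rightarrow> real^2" where "dir t = vector [cos t, sin t]"

lemma dir_nth [simp]: "dir t $ 1 = cos t" "dir t $ 2 = sin t"
  by (simp_all add: dir_def)

lemma inner_real2: "(x::real^2) \<bullet> y = x $ 1 * y $ 1 + x $ 2 * y $ 2"
  by (simp add: inner_vec_def sum_2)

lemma norm_real2: "norm (x::real^2) = sqrt ((x $ 1)^2 + (x $ 2)^2)"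
  by (simp add: norm_eq_sqrt_inner inner_real2 power2_eq_square)

lemma vec2_eq_iff: "(x::real^2) = y \<longleftrightarrow> x $ 1 = y $ 1 \<and> x $ 2 = y $ 2"
  by (simp add: vec_eq_iff forall_2)

lemma norm_dir [simp]: "norm (dir t) = 1"
  by (simp add: norm_real2)

lemma dir_nonzero [simp]: "dir t \<noteq> 0"
  using norm_dir[of t] by force

lemma dir_plus_pi: "dir (t + pi) = - dir t"
  by (simp add: vec2_eq_iff)

lemma inner_dir: "dir t \<bullet> dir u = cos (t - u)"
  by (simp add: inner_real2 cos_diff)

lemma area_hyperplane_Int: "a \<noteq> 0 \<Longrightarrow> negligible (S \<inter> {z. z \<bullet> a = b})"
  by (rule negligible_subset[OF negligible_hyperplane[of a b]]) (auto simp: inner_commute)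

abbreviation level :: "real \<Rightarrow> real^2 \<Rightarrow> real" where "level t z \<equiv> z \<bullet> dir t"

text \<open>The length of \<open>S \<inter> {z. z \<bullet> dir t = c}\<close> as a function of \<open>c\<close> jumps by the length of an edge exactly at the
  lines through the edges of \<open>S\<close>. Expressing the jump by areas of strips makes it additive under tilings
  without any discussion of how tiles meet along a line.\<close>

definition strip :: "(real^2) set \<Rightarrow> real \<Rightarrow> real \<Rightarrow> real \<Rightarrow> real" where
  "strip S t c eps = (area (S \<inter> {z. c - eps \<le> level t z \<and> level t z \<le> c}) -
     area (S \<inter> {z. c \<le> level t z \<and> level t z \<le> c + eps})) / eps"

definition has_jump :: "(real^2) set \<Rightarrow> real \<Rightarrow> real \<Rightarrow> real \<Rightarrow> bool" where
  "has_jump S t c v \<longleftrightarrow> (strip S t c \<longlongrightarrow> v) (at_right 0)"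

lemma has_jump_unique: "has_jump S t c v \<Longrightarrow> has_jump S t c v' \<Longrightarrow> v = v'"
  unfolding has_jump_def by (rule tendsto_unique[OF trivial_limit_at_right_real])

lemma has_jump_flip:
  assumes "has_jump S t c v"
  shows "has_jump S (t + pi) (- c) (- v)"
proof -
  have "strip S (t + pi) (- c) eps = - strip S t c eps" for eps
  proof -
    have "{z. - c - eps \<le> z \<bullet> dir (t + pi) \<and> z \<bullet> dir (t + pi) \<le> - c} = {z. c \<le> level t z \<and> level t z \<le> c + eps}"
      "{z. - c \<le> z \<bullet> dir (t + pi) \<and> z \<bullet> dir (t + pi) \<le> - c + eps} = {z. c - eps \<le> level t z \<and> level t z \<le> c}"
      by (auto simp: dir_plus_pi)
    then show ?thesis by (simp add: strip_def minus_divide_left)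
  qed
  then have "strip S (t + pi) (- c) = (\<lambda>eps. - strip S t c eps)" by auto
  then show ?thesis using assms tendsto_minus unfolding has_jump_def by metis
qed

text \<open>The form in which a tiling enters the limits below. The closed test sets are strips for
  edge lengths and discs for angles.\<close>

definition additive_over :: "(real^2) set \<Rightarrow> (real^2) set set \<Rightarrow> bool" where
  "additive_over R \<T> \<longleftrightarrow> finite \<T> \<and> (\<forall>X. closed X \<longrightarrow> area (R \<inter> X) = (\<Sum>S\<in>\<T>. area (S \<inter> X)))"

lemma closed_strip: "closed {z::real^2. a \<le> z \<bullet> d \<and> z \<bullet> d \<le> b}"
  by (intro closed_Collect_conj closed_Collect_le continuous_intros)

lemma has_jump_sum:
  assumes "additive_over R \<T>" and "\<And>S. S \<in> \<T> \<Longrightarrow> has_jump S t c (v S)"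
  shows "has_jump R t c (\<Sum>S\<in>\<T>. v S)"
proof -
  have "strip R t c eps = (\<Sum>S\<in>\<T>. strip S t c eps)" for eps
    using assms(1) closed_strip unfolding strip_def additive_over_def
    by (simp add: sum_subtractf diff_divide_distrib sum_divide_distrib)
  then have "strip R t c = (\<lambda>eps. \<Sum>S\<in>\<T>. strip S t c eps)" by auto
  moreover have "((\<lambda>eps. \<Sum>S\<in>\<T>. strip S t c eps) \<longlongrightarrow> (\<Sum>S\<in>\<T>. v S)) (at_right 0)"
    using assms(2) unfolding has_jump_def by (intro tendsto_sum) auto
  ultimately show ?thesis unfolding has_jump_def by simp
qed

text \<open>Two tiles meet in a convex set without interior, which is negligible.\<close>

lemma tiling_additive:
  assumes "finite \<T>" and conv: "\<And>S. S \<in> \<T> \<Longrightarrow> convex S \<and> compact S"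
    and disj: "pairwise (\<lambda>S S'. interior S \<inter> interior S' = {}) \<T>"
  shows "additive_over (\<Union>\<T>) \<T>"
  unfolding additive_over_def
proof (intro conjI allI impI)
  fix X :: "(real^2) set" assume X: "closed X"
  have "area (\<Union>((\<lambda>S. S \<inter> X) ` \<T>)) = (\<Sum>S\<in>\<T>. area (S \<inter> X))"
  proof (rule measure_negligible_finite_Union_image)
    show "finite \<T>" by fact
    show "S \<inter> X \<in> lmeasurable" if "S \<in> \<T>" for S
      using conv[OF that] X by (intro lmeasurable_compact compact_Int_closed) auto
    show "pairwise (\<lambda>S S'. negligible (S \<inter> X \<inter> (S' \<inter> X))) \<T>"
    proof (rule pairwiseI)
      fix S S' assume S: "S \<in> \<T>" "S' \<in> \<T>" "S \<noteq> S'"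
      then have "interior (S \<inter> S') = {}" using disj by (auto simp: pairwise_def)
      then have "negligible (S \<inter> S')"
        using conv S by (simp add: negligible_convex_interior convex_Int)
      then show "negligible (S \<inter> X \<inter> (S' \<inter> X))" by (rule negligible_subset) auto
    qed
  qed
  then show "area (\<Union>\<T> \<inter> X) = (\<Sum>S\<in>\<T>. area (S \<inter> X))" by simp
qed fact

section \<open>Areas and jumps of a single triangle\<close>

abbreviation tri :: "real^2 \<Rightarrow> real^2 \<Rightarrow> real^2 \<Rightarrow> (real^2) set" where
  "tri P Q R \<equiv> convex hull {P, Q, R}"

lemma compact_triangle: "compact (convex hull {P, Q, R :: real^2})"
  by (simp add: finite_imp_compact_convex_hull)

lemma in_triangle_iff:
  "z \<in> convex hull {P, Q, R :: real^2} \<longleftrightarrow>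
     (\<exists>u v w. 0 \<le> u \<and> 0 \<le> v \<and> 0 \<le> w \<and> u + v + w = 1 \<and> z = u *\<^sub>R P + v *\<^sub>R Q + w *\<^sub>R R)"
  unfolding convex_hull_3 by auto

lemma triangle_inner_le:
  assumes "z \<in> tri P Q R" "P \<bullet> d \<le> c" "Q \<bullet> d \<le> c" "R \<bullet> d \<le> c"
  shows "z \<bullet> d \<le> c"
proof -
  have "tri P Q R \<subseteq> {z. d \<bullet> z \<le> c}"
    using assms(2-4) by (intro hull_minimal convex_halfspace_le) (auto simp: inner_commute)
  then show ?thesis using assms(1) by (auto simp: inner_commute)
qed

lemma triangle_inner_ge:
  assumes "z \<in> tri P Q R" "c \<le> P \<bullet> d" "c \<le> Q \<bullet> d" "c \<le> R \<bullet> d"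
  shows "c \<le> z \<bullet> d"
  using triangle_inner_le[of z P Q R "- d" "- c"] assms by simp

text \<open>The cut runs along the segment from \<open>Q\<close> to the point \<open>W\<close> of
  \<open>PR\<close>. The parts lie on different sides of the line \<open>QW\<close>, so their
  overlap is negligible.\<close>

lemma split_triangle_additive:
  assumes nc: "\<not> collinear {P, Q, R :: real^2}" and l: "0 < l" "l < 1" and W: "W = (1 - l) *\<^sub>R P + l *\<^sub>R R"
    and X: "closed X"
  shows "area ((tri P Q R) \<inter> X) = area ((tri P Q W) \<inter> X) + area ((tri R Q W) \<inter> X)"
proof -
  let ?A = "tri P Q W" and ?B = "tri R Q W" and ?T = "tri P Q R"
  have WT: "W \<in> ?T" unfolding in_triangle_iff
    by (rule exI[of _ "1 - l"], rule exI[of _ 0], rule exI[of _ l]) (use l W in auto)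
  have un: "?T = ?A \<union> ?B"
  proof
    have "P \<in> ?T" "Q \<in> ?T" "R \<in> ?T" by (auto intro: hull_inc)
    then show "?A \<union> ?B \<subseteq> ?T" using WT by (intro Un_least hull_minimal) auto
    show "?T \<subseteq> ?A \<union> ?B"
    proof
      fix z assume "z \<in> ?T"
      then obtain u v w where h: "0 \<le> u" "0 \<le> v" "0 \<le> w" "u + v + w = 1" "z = u *\<^sub>R P + v *\<^sub>R Q + w *\<^sub>R R"
        unfolding in_triangle_iff by blast
      show "z \<in> ?A \<union> ?B"
      \<comment> \<open>Comparing the coordinates at \<open>P\<close> and \<open>R\<close> decides
        on which side of the line \<open>QW\<close> the point lies.\<close>
      proof (cases "w * (1 - l) \<le> u * l")
        case True
        have "z \<in> ?A" unfolding in_triangle_iff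
        proof (intro exI conjI)
          show "0 \<le> u - w * (1 - l) / l" using True l by (simp add: field_simps)
          show "0 \<le> v" "0 \<le> w / l" using h l by auto
          have u: "u = 1 - v - w" using h by simp
          show "u - w * (1 - l) / l + v + w / l = 1" unfolding u using l by (simp add: field_simps)
          show "z = (u - w * (1 - l) / l) *\<^sub>R P + v *\<^sub>R Q + (w / l) *\<^sub>R W"
            unfolding W h using l by (simp add: vec2_eq_iff field_simps)
        qed
        then show ?thesis by simp
      next
        case False
        have "z \<in> ?B" unfolding in_triangle_iff
        proof (intro exI conjI)
          show "0 \<le> w - u * l / (1 - l)" using False l by (simp add: field_simps)
          show "0 \<le> v" "0 \<le> u / (1 - l)" using h l by auto
          have w: "w = 1 - v - u" using h by simp
          show "w - u * l / (1 - l) + v + u / (1 - l) = 1"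
          proof -
            have "u / (1 - l) - u * l / (1 - l) = u * (1 - l) / (1 - l)" by (simp add: diff_divide_distrib right_diff_distrib)
            then have "u / (1 - l) - u * l / (1 - l) = u" using l by simp
            then show ?thesis using w by linarith
          qed
          show "z = (w - u * l / (1 - l)) *\<^sub>R R + v *\<^sub>R Q + (u / (1 - l)) *\<^sub>R W"
          proof -
            have "(u / (1 - l)) *\<^sub>R W = u *\<^sub>R P + (u * l / (1 - l)) *\<^sub>R R"
              unfolding W using l by (simp add: scaleR_add_right)
            then show ?thesis unfolding h by (simp add: algebra_simps)
          qed
        qed
        then show ?thesis by simp
      qed
    qed
  qed
  have WQ: "W \<noteq> Q"
  proof
    assume "W = Q"
    then have Q: "Q = P + l *\<^sub>R (R - P)" using W by (simp add: algebra_simps)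
    have "\<forall>x\<in>{P, Q, R}. \<exists>c. x = P + c *\<^sub>R (R - P)"
      using Q by (auto intro: exI[of _ 0] exI[of _ 1])
    then have "collinear {P, Q, R}" unfolding collinear_alt by blast
    then show False using nc by simp
  qed
  \<comment> \<open>Normal of the line \<open>QW\<close>: the vector \<open>W - Q\<close> turned by
    a right angle.\<close>
  define a :: "real^2" where "a = vector [- (W - Q) $ 2, (W - Q) $ 1]"
  have a0: "a \<noteq> 0" using WQ by (auto simp: a_def vec2_eq_iff)
  have aW: "W \<bullet> a = Q \<bullet> a" by (simp add: a_def inner_real2 algebra_simps)
  define k where "k = P \<bullet> a - Q \<bullet> a"
  have kR: "l * (R \<bullet> a - Q \<bullet> a) = - (1 - l) * k"
    using aW unfolding W k_def by (simp add: inner_add_left algebra_simps)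
  have neg: "negligible (?A \<inter> ?B)"
  proof -
    have half: "?A \<inter> ?B \<subseteq> {z. z \<bullet> b = Q \<bullet> b}" if b: "W \<bullet> b = Q \<bullet> b" "Q \<bullet> b \<le> P \<bullet> b" "R \<bullet> b \<le> Q \<bullet> b" for b
    proof -
      have "z \<bullet> b = Q \<bullet> b" if "z \<in> ?A" "z \<in> ?B" for z
        using triangle_inner_ge[OF that(1), of "Q \<bullet> b" b] triangle_inner_le[OF that(2), of b "Q \<bullet> b"] b by simp
      then show ?thesis by blast
    qed
    show ?thesis
    proof (cases "0 \<le> k")
      case True
      then have "0 \<le> (1 - l) * k" using l by simp
      then have "l * (R \<bullet> a - Q \<bullet> a) \<le> 0" using kR by (simp add: left_diff_distrib)
      then have "R \<bullet> a \<le> Q \<bullet> a" using l by (simp add: mult_le_0_iff)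
      then show ?thesis using half[of a] True aW k_def a0
        by (intro negligible_subset[OF negligible_hyperplane[of a "Q \<bullet> a"]]) (auto simp: inner_commute)
    next
      case False
      then have "(1 - l) * k \<le> 0" using l by (simp add: mult_nonneg_nonpos)
      then have "0 \<le> l * (R \<bullet> a - Q \<bullet> a)" using kR by (simp add: left_diff_distrib)
      then have "Q \<bullet> a \<le> R \<bullet> a" using l by (simp add: zero_le_mult_iff)
      then have "?A \<inter> ?B \<subseteq> {z. z \<bullet> - a = Q \<bullet> - a}" using False aW k_def by (intro half) auto
      then show ?thesis using a0
        by (intro negligible_subset[OF negligible_hyperplane[of a "Q \<bullet> a"]]) (auto simp: inner_commute)
    qed
  qed
  have m: "?A \<inter> X \<in> lmeasurable" "?B \<inter> X \<in> lmeasurable"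
    using X by (auto intro!: lmeasurable_compact compact_Int_closed compact_triangle)
  have "area ((?A \<inter> X) \<union> (?B \<inter> X)) = area (?A \<inter> X) + area (?B \<inter> X)"
  proof -
    have "negligible ((?A \<inter> X) \<inter> (?B \<inter> X))" by (rule negligible_subset[OF neg]) auto
    then show ?thesis using measure_Un3[OF m] negligible_imp_measure0 by simp
  qed
  then show ?thesis unfolding un by (simp add: Int_Un_distrib2)
qed

lemma perp_dir:
  assumes "v \<bullet> dir t = 0"
  obtains k where "v $ 1 = - k * sin t" "v $ 2 = k * cos t" "norm v = \<bar>k\<bar>"
proof -
  define k where "k = v $ 2 * cos t - v $ 1 * sin t"
  have e: "v $ 1 * cos t = - v $ 2 * sin t" using assms by (simp add: inner_real2)
  have one: "x = x * (sin t * sin t) + (x * cos t) * cos t" for x :: real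
  proof -
    have "x = x * ((sin t)^2 + (cos t)^2)" by simp
    also have "\<dots> = x * (sin t * sin t) + (x * cos t) * cos t" by (simp only: power2_eq_square algebra_simps)
    finally show ?thesis .
  qed
  have 1: "v $ 1 = - k * sin t" using one[of "v $ 1"] unfolding e by (simp add: k_def algebra_simps)
  have "v $ 2 = - (- v $ 2 * sin t) * sin t + v $ 2 * cos t * cos t" using one[of "v $ 2"] by (simp add: algebra_simps)
  then have 2: "v $ 2 = k * cos t" unfolding e[symmetric] by (simp add: k_def algebra_simps)
  have "norm v = sqrt (k^2 * ((sin t)^2 + (cos t)^2))"
    unfolding norm_real2 1 2 by (simp only: power_mult_distrib power2_minus algebra_simps)
  then show ?thesis using that[OF 1 2] by simp
qed

lemma area_level_triangle:
  assumes "level t Q = b" "level t R = b" "level t P < b"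
  shows "2 * area (tri P Q R) = (b - level t P) * dist Q R"
proof -
  define u d where "u = R - Q" and "d = Q - P"
  have "u \<bullet> dir t = 0" using assms by (simp add: u_def inner_diff_left)
  then obtain k where u: "u $ 1 = - k * sin t" "u $ 2 = k * cos t" "norm u = \<bar>k\<bar>" by (rule perp_dir)
  have H: "b - level t P = d $ 1 * cos t + d $ 2 * sin t" using assms by (simp add: d_def inner_real2 algebra_simps)
  have "area (tri P Q R) = measure lborel (tri P Q R)"
    using compact_triangle by (simp add: measure_completion borel_compact)
  also have "\<dots> = \<bar>(R $ 1 - P $ 1) * (Q $ 2 - P $ 2) - (Q $ 1 - P $ 1) * (R $ 2 - P $ 2)\<bar> / 2"
    by (rule content_triangle)
  also have "(R $ 1 - P $ 1) * (Q $ 2 - P $ 2) - (Q $ 1 - P $ 1) * (R $ 2 - P $ 2) = u $ 1 * d $ 2 - d $ 1 * u $ 2"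
    by (simp add: u_def d_def algebra_simps)
  also have "\<dots> = - k * (b - level t P)" unfolding u H by (simp add: algebra_simps)
  finally show ?thesis using assms u(3) by (simp add: abs_mult u_def dist_norm norm_minus_commute mult.commute)
qed

text \<open>The part below level \<open>c\<close> is the image of the triangle under the homothety
  with centre \<open>P\<close> and factor \<open>(c - level t P) / (b - level t P)\<close>.\<close>

lemma area_below_level_triangle:
  assumes lev: "level t Q = b" "level t R = b" "level t P < b" and c: "level t P \<le> c" "c \<le> b"
  shows "area ((tri P Q R) \<inter> {z. level t z \<le> c}) = ((c - level t P) / (b - level t P))^2 * area (tri P Q R)"
proof -
  let ?p = "level t P" let ?k = "(c - ?p) / (b - ?p)"
  let ?T = "tri P Q R"
  have k: "0 \<le> ?k" "?k \<le> 1" using lev c by (auto simp: field_simps)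
  have "?T \<inter> {z. level t z \<le> c} = (\<lambda>x. ?k *\<^sub>R x + (1 - ?k) *\<^sub>R P) ` ?T"
  proof (intro equalityI subsetI)
    fix z assume "z \<in> ?T \<inter> {z. level t z \<le> c}"
    then have "z \<in> ?T" and zc: "level t z \<le> c" by auto
    then obtain u v w where "0 \<le> u" "0 \<le> v" "0 \<le> w" "u + v + w = 1" "z = u *\<^sub>R P + v *\<^sub>R Q + w *\<^sub>R R"
      unfolding in_triangle_iff by blast
    note h = this zc
    have "level t z = u * ?p + (v + w) * b" unfolding h(5) using lev by (simp add: inner_add_left algebra_simps)
    also have "\<dots> = ?p + (v + w) * (b - ?p)"
    proof -
      have u: "u = 1 - (v + w)" using h by simp
      show ?thesis unfolding u by (simp add: algebra_simps)
    qed
    finally have vw: "(v + w) * (b - ?p) \<le> c - ?p" using h(6) by simp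
    then have vw: "v + w \<le> ?k" using lev by (simp add: field_simps)
    show "z \<in> (\<lambda>x. ?k *\<^sub>R x + (1 - ?k) *\<^sub>R P) ` ?T"
    \<comment> \<open>Factor 0 is treated separately because the preimage is found by
      division.\<close>
    proof (cases "?k = 0")
      case True
      then have "v = 0" "w = 0" using vw h by auto
      then have "z = P" using h by simp
      moreover have "P \<in> ?T" by (auto intro: hull_inc)
      ultimately show ?thesis unfolding True by auto
    next
      case False
      then have k0: "0 < ?k" using k by linarith
      define k where "k = ?k"
      have "z = k *\<^sub>R ((1 - v / k - w / k) *\<^sub>R P + (v / k) *\<^sub>R Q + (w / k) *\<^sub>R R) + (1 - k) *\<^sub>R P"
      proof -
        have u: "u = 1 - v - w" using h by simp
        show ?thesis unfolding h(5) u using k0 by (simp add: vec2_eq_iff field_simps flip: k_def)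
      qed
      moreover have "(1 - v / k - w / k) *\<^sub>R P + (v / k) *\<^sub>R Q + (w / k) *\<^sub>R R \<in> ?T"
        unfolding in_triangle_iff
      proof (intro exI conjI)
        have "v / k + w / k = (v + w) / k" by (simp add: add_divide_distrib)
        also have "\<dots> \<le> 1" using vw k0 by (simp flip: k_def)
        finally show "0 \<le> 1 - v / k - w / k" by simp
        show "0 \<le> v / k" "0 \<le> w / k" using h k0 by (simp_all flip: k_def)
      qed simp_all
      ultimately show ?thesis unfolding k_def by blast
    qed
  next
    fix z assume "z \<in> (\<lambda>x. ?k *\<^sub>R x + (1 - ?k) *\<^sub>R P) ` ?T"
    then obtain x where x: "x \<in> ?T" "z = ?k *\<^sub>R x + (1 - ?k) *\<^sub>R P" by auto
    have "P \<in> ?T" by (auto intro: hull_inc)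
    then have zT: "z \<in> ?T" unfolding x(2) using k x(1) convexD[OF convex_convex_hull, of x "{P,Q,R}" P ?k "1 - ?k"] by auto
    have xb: "level t x \<le> b" using triangle_inner_le[OF x(1), of "dir t" b] lev by simp
    have "level t z = ?p + ?k * (level t x - ?p)"
    proof -
      have "(k *\<^sub>R x + (1 - k) *\<^sub>R P) \<bullet> dir t = ?p + k * (level t x - ?p)" for k
        by (simp add: inner_add_left algebra_simps)
      then show ?thesis unfolding x(2) by metis
    qed
    also have "\<dots> \<le> ?p + ?k * (b - ?p)" using xb k by (intro add_left_mono mult_left_mono) auto
    also have "\<dots> = c" using lev by simp
    finally show "z \<in> ?T \<inter> {z. level t z \<le> c}" using zT by simp
  qed
  note img = this
  have "area ((\<lambda>x. k *\<^sub>R x + v) ` T) = k^2 * area T" if "0 \<le> k" for k v and T :: "(real^2) set"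
    using measure_lebesgue_affine[of k v T] that by simp
  then show ?thesis unfolding img using k(1) by metis
qed

text \<open>The area below level \<open>c\<close> is piecewise quadratic in \<open>c\<close>, and
  \<open>strip\<close> is, up to sign, its second difference divided by \<open>eps\<close>; the
  limit is the left minus the right derivative. The derivative is continuous except at the level of
  \<open>QR\<close>, where it drops from \<open>dist Q R\<close> to 0.\<close>

lemma has_jump_level_up:
  assumes lev: "level t Q = b" "level t R = b" "level t P < b"
  shows "has_jump (tri P Q R) t c (if c = b then dist Q R else 0)"
proof -
  let ?T = "tri P Q R" let ?p = "level t P"
  define D where "D = area ?T"
  define H where "H = b - ?p"
  have H: "0 < H" using lev by (simp add: H_def)
  have HD: "2 * D = H * dist Q R" using area_level_triangle[OF lev] by (simp add: D_def H_def)
  define a where "a c = area (?T \<inter> {z. level t z \<le> c})" for c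
  have bnd: "?p \<le> level t z" "level t z \<le> b" if "z \<in> ?T" for z
    using triangle_inner_ge[OF that, of ?p "dir t"] triangle_inner_le[OF that, of "dir t" b] lev by simp_all
  have a_low: "a c = 0" if "c \<le> ?p" for c
  proof -
    have "?T \<inter> {z. level t z \<le> c} \<subseteq> UNIV \<inter> {z. level t z = ?p}" using bnd(1) that by fastforce
    then show ?thesis unfolding a_def
      using negligible_subset[OF area_hyperplane_Int[OF dir_nonzero]] negligible_imp_measure0 by blast
  qed
  have a_mid: "a c = ((c - ?p) / H)^2 * D" if "?p \<le> c" "c \<le> b" for c
    unfolding a_def D_def H_def using area_below_level_triangle[OF lev that] .
  have a_high: "a c = D" if "b \<le> c" for c
  proof -
    have "?T \<inter> {z. level t z \<le> c} = ?T" using bnd(2) that by fastforce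
    then show ?thesis by (simp add: a_def D_def)
  qed
  have piece: "area (?T \<inter> {z. lo \<le> level t z \<and> level t z \<le> hi}) = a hi - a lo" if "lo \<le> hi" for lo hi
  proof -
    let ?L = "?T \<inter> {z. level t z \<le> lo}" and ?M = "?T \<inter> {z. lo \<le> level t z \<and> level t z \<le> hi}"
    have "?L \<in> lmeasurable" "?M \<in> lmeasurable"
      using closed_strip[of lo "dir t" hi]
      by (auto intro!: lmeasurable_compact compact_Int_closed compact_triangle closed_Collect_le continuous_intros)
    moreover have "negligible (?L \<inter> ?M)"
      by (rule negligible_subset[OF area_hyperplane_Int[OF dir_nonzero, of UNIV t lo]]) auto
    ultimately have "area (?L \<union> ?M) = area ?L + area ?M"
      using measure_Un3[of ?L lebesgue ?M] negligible_imp_measure0 by simp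
    moreover have "?L \<union> ?M = ?T \<inter> {z. level t z \<le> hi}" using that by auto
    ultimately show ?thesis by (simp add: a_def)
  qed
  have strip: "strip ?T t c eps = ((a c - a (c - eps)) - (a (c + eps) - a c)) / eps" if "0 < eps" for eps
    unfolding strip_def using that by (simp add: piece)
  have ev: "\<forall>\<^sub>F eps in at_right 0. 0 < eps \<and> eps < d" if "0 < d" for d :: real
    using eventually_at_right_real[OF that] by simp
  \<comment> \<open>For small \<open>eps\<close> the quotient is exactly affine in
    \<open>eps\<close>, with the jump as its constant term.\<close>
  have tend: "has_jump ?T t c v" if "0 < d" "\<And>eps. 0 < eps \<Longrightarrow> eps < d \<Longrightarrow> ((a c - a (c - eps)) - (a (c + eps) - a c)) / eps = v + eps * K" for d v K
  proof -
    have "((\<lambda>eps. v + eps * K) \<longlongrightarrow> v + 0 * K) (at_right 0)" by (intro tendsto_intros)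
    moreover have "\<forall>\<^sub>F eps in at_right 0. v + eps * K = strip ?T t c eps"
      using ev[OF that(1)] by eventually_elim (elim conjE, simp only: strip that(2))
    ultimately show ?thesis unfolding has_jump_def by (auto elim: Lim_transform_eventually)
  qed
  consider "c < ?p" | "c = ?p" | "?p < c" "c < b" | "c = b" | "b < c" by linarith
  then show ?thesis
  proof cases
    case 1
    have "has_jump ?T t c 0"
      by (rule tend[of "?p - c" 0 0]) (use 1 in \<open>auto simp: a_low\<close>)
    then show ?thesis using 1 lev by simp
  next
    case 2
    have "has_jump ?T t c 0"
    proof (rule tend[of H 0 "- D / H^2"])
      fix eps :: real assume e: "0 < eps" "eps < H"
      then have "a (c + eps) = (eps / H)^2 * D" using 2 by (subst a_mid) (auto simp: H_def)
      moreover have "a (c - eps) = 0" "a c = 0" using 2 e by (auto simp: a_low)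
      ultimately show "((a c - a (c - eps)) - (a (c + eps) - a c)) / eps = 0 + eps * (- D / H^2)"
        using e by (simp add: power_divide power2_eq_square)
    qed (rule H)
    then show ?thesis using 2 lev by simp
  next
    case 3
    have "has_jump ?T t c 0"
    proof (rule tend[of "min (c - ?p) (b - c)" 0 "- 2 * D / H^2"])
      fix eps :: real assume e: "0 < eps" "eps < min (c - ?p) (b - c)"
      then have m: "a (c + eps) = ((c + eps - ?p) / H)^2 * D" "a (c - eps) = ((c - eps - ?p) / H)^2 * D" "a c = ((c - ?p) / H)^2 * D"
        using 3 by (auto intro!: a_mid)
      have "(a c - a (c - eps)) - (a (c + eps) - a c) = (2 * (c - ?p)^2 - (c - eps - ?p)^2 - (c + eps - ?p)^2) * (D / H^2)"
        unfolding m power_divide by (simp add: left_diff_distrib diff_divide_distrib)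
      also have "2 * (c - ?p)^2 - (c - eps - ?p)^2 - (c + eps - ?p)^2 = - 2 * eps^2"
        by (simp add: power2_eq_square algebra_simps)
      finally show "((a c - a (c - eps)) - (a (c + eps) - a c)) / eps = 0 + eps * (- 2 * D / H^2)"
        using e by (simp add: power2_eq_square)
    qed (use 3 in simp)
    then show ?thesis using 3 by simp
  next
    case 4
    have "has_jump ?T t c (dist Q R)"
    proof (rule tend[of H "dist Q R" "- D / H^2"])
      fix eps :: real assume e: "0 < eps" "eps < H"
      then have m: "a (c + eps) = D" "a (c - eps) = ((H - eps) / H)^2 * D" "a c = D"
        using 4 a_mid[of "c - eps"] by (auto intro!: a_high simp: H_def algebra_simps)
      have d: "dist Q R = 2 * D / H" using HD H by (simp add: field_simps)
      have "(a c - a (c - eps)) - (a (c + eps) - a c) = (H^2 - (H - eps)^2) * (D / H^2)"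
        unfolding m power_divide using H by (simp add: left_diff_distrib diff_divide_distrib)
      also have "H^2 - (H - eps)^2 = eps * (2 * H - eps)" by (simp add: power2_eq_square algebra_simps)
      finally show "((a c - a (c - eps)) - (a (c + eps) - a c)) / eps = dist Q R + eps * (- D / H^2)"
        unfolding d using e H by (simp add: left_diff_distrib power2_eq_square diff_divide_distrib)
    qed (rule H)
    then show ?thesis using 4 by simp
  next
    case 5
    have "has_jump ?T t c 0"
      by (rule tend[of "c - b" 0 0]) (use 5 in \<open>auto simp: a_high\<close>)
    then show ?thesis using 5 by simp
  qed
qed

lemma has_jump_level:
  assumes "level t Q = b" "level t R = b" "level t P \<noteq> b"
  shows "has_jump (tri P Q R) t c (if c = b then if level t P < b then dist Q R else - dist Q R else 0)"
proof (cases "level t P < b")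
  case True
  then show ?thesis using has_jump_level_up[OF assms(1,2) True, of c] by (cases "c = b") simp_all
next
  case False
  have d: "dir (t + pi + pi) = dir t" by (simp only: dir_plus_pi minus_minus)
  then have eq: "has_jump S (t + pi + pi) x y \<longleftrightarrow> has_jump S t x y" for S x y
    unfolding has_jump_def strip_def[abs_def] by (simp only:)
  have "has_jump (tri P Q R) (t + pi) (- c) (if - c = - b then dist Q R else 0)"
    using False assms by (intro has_jump_level_up) (auto simp: dir_plus_pi)
  from has_jump_flip[OF this] show ?thesis using False unfolding eq by (auto split: if_splits)
qed

lemma not_all_level:
  assumes "\<not> collinear {P, Q, R}"
  shows "\<not> (level t P = b \<and> level t Q = b \<and> level t R = b)"
proof
  assume h: "level t P = b \<and> level t Q = b \<and> level t R = b"
  have "\<exists>k. x = P + k *\<^sub>R dir (t + pi / 2)" if "x \<in> {P, Q, R}" for x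
  proof -
    have "(x - P) \<bullet> dir t = 0" using that h by (auto simp: inner_diff_left)
    then obtain k where "(x - P) $ 1 = - k * sin t" "(x - P) $ 2 = k * cos t" by (rule perp_dir)
    then show ?thesis by (intro exI[of _ k]) (simp add: vec2_eq_iff cos_add sin_add algebra_simps)
  qed
  then have "collinear {P, Q, R}" unfolding collinear_alt by blast
  then show False using assms by simp
qed

text \<open>If two vertices share a level, \<open>has_jump_level\<close> applies. Otherwise the
  triangle is cut at the level of the middle vertex, and the jumps of the two parts along the cut
  cancel.\<close>

lemma has_jump_no_edge:
  assumes nc: "\<not> collinear {P, Q, R}"
    and ne: "\<not> (level t P = c \<and> level t Q = c)" "\<not> (level t P = c \<and> level t R = c)" "\<not> (level t Q = c \<and> level t R = c)"
  shows "has_jump (tri P Q R) t c 0"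
proof -
  note three = not_all_level
  have ord: "has_jump (tri P' Q' R') t c 0"
    if lt: "level t P' < level t Q'" "level t Q' < level t R'" and nc': "\<not> collinear {P', Q', R'}" for P' Q' R'
  proof -
    let ?p = "level t P'" let ?q = "level t Q'" let ?r = "level t R'"
    define l where "l = (?q - ?p) / (?r - ?p)"
    have l: "0 < l" "l < 1" using lt by (auto simp: l_def field_simps)
    define W where "W = (1 - l) *\<^sub>R P' + l *\<^sub>R R'"
    have "level t W = ?p + l * (?r - ?p)" by (simp add: W_def inner_add_left algebra_simps)
    also have "\<dots> = ?q" using lt by (simp add: l_def)
    finally have W: "level t W = ?q" .
    let ?A = "tri P' Q' W" and ?B = "tri R' Q' W"
    define x where "x = (if c = ?q then dist Q' W else 0)"
    have A: "has_jump ?A t c x" using has_jump_level[of Q' t ?q W P' c] W lt by (cases "c = ?q") (simp_all add: x_def)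
    have B: "has_jump ?B t c (- x)" using has_jump_level[of Q' t ?q W R' c] W lt by (cases "c = ?q") (simp_all add: x_def)
    have "strip (tri P' Q' R') t c eps = strip ?A t c eps + strip ?B t c eps" for eps
      unfolding strip_def split_triangle_additive[OF nc' l W_def closed_strip] by (simp add: diff_divide_distrib add_divide_distrib)
    then have "strip (tri P' Q' R') t c = (\<lambda>eps. strip ?A t c eps + strip ?B t c eps)" by auto
    moreover have "((\<lambda>eps. strip ?A t c eps + strip ?B t c eps) \<longlongrightarrow> x + - x) (at_right 0)"
      using A B unfolding has_jump_def by (rule tendsto_add)
    ultimately show ?thesis by (simp add: has_jump_def)
  qed
  have lev: "has_jump (tri P' Q' R') t c 0"
    if "level t Q' = level t R'" "\<not> (level t Q' = c \<and> level t R' = c)" "\<not> collinear {P', Q', R'}" for P' Q' R'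
    using has_jump_level[of Q' t "level t R'" R' P' c] three[OF that(3), of t "level t R'"] that by auto
  have perm: "{P, R, Q} = {P, Q, R}" "{Q, P, R} = {P, Q, R}" "{Q, R, P} = {P, Q, R}" "{R, P, Q} = {P, Q, R}" "{R, Q, P} = {P, Q, R}" by auto
  consider "level t Q = level t R" | "level t P = level t R" | "level t P = level t Q"
    | "level t P < level t Q" "level t Q < level t R" | "level t P < level t R" "level t R < level t Q"
    | "level t Q < level t P" "level t P < level t R" | "level t Q < level t R" "level t R < level t P"
    | "level t R < level t P" "level t P < level t Q" | "level t R < level t Q" "level t Q < level t P"
    by linarith
  then show ?thesis
  proof cases
    case 1 then show ?thesis using lev[of Q R P] ne nc by simp
  next
    case 2 then show ?thesis using lev[of P R Q] ne nc by (simp add: perm)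
  next
    case 3 then show ?thesis using lev[of P Q R] ne nc by (simp add: perm)
  next
    case 4 then show ?thesis using ord[of P Q R] nc by simp
  next
    case 5 then show ?thesis using ord[of P R Q] nc by (simp add: perm)
  next
    case 6 then show ?thesis using ord[of Q P R] nc by (simp add: perm)
  next
    case 7 then show ?thesis using ord[of Q R P] nc by (simp add: perm)
  next
    case 8 then show ?thesis using ord[of R P Q] nc by (simp add: perm)
  next
    case 9 then show ?thesis using ord[of R Q P] nc by (simp add: perm)
  qed
qed

section \<open>Edge directions\<close>

definition is_tri :: "real \<Rightarrow> real \<Rightarrow> real \<Rightarrow> real^2 \<Rightarrow> real^2 \<Rightarrow> real^2 \<Rightarrow> bool" where
  "is_tri e f g P Q R \<longleftrightarrow> \<not> collinear {P, Q, R} \<and> dist Q R = e \<and> dist P R = f \<and> dist P Q = g"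

lemma is_tri_permute:
  assumes "is_tri e f g P Q R"
  shows "is_tri f e g Q P R" "is_tri e g f P R Q" "is_tri g e f R P Q"
  using assms by (auto simp: is_tri_def dist_commute insert_commute)

lemma triangle_permute:
  "tri Q P R = tri P Q R" "tri P R Q = tri P Q R"
  "tri R Q P = tri P Q R" "tri Q R P = tri P Q R"
  "tri R P Q = tri P Q R"
  by (simp_all add: insert_commute)

lemma noncollinear_dist_less:
  assumes "\<not> collinear {P, Q, R :: real^2}"
  shows "dist Q R < dist P R + dist P Q"
proof (rule ccontr)
  assume "\<not> dist Q R < dist P R + dist P Q"
  then have "dist Q R = dist Q P + dist P R" using dist_triangle[of Q R P] by (simp add: dist_commute)
  then have "collinear {Q, P, R}" by (intro between_imp_collinear) (simp add: between)
  then show False using assms by (simp add: insert_commute)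
qed

lemma is_tri_sides:
  assumes "is_tri e f g P Q R"
  shows "tri_sides e f g"
proof -
  have nc: "\<not> collinear {P, Q, R}" "\<not> collinear {Q, R, P}" "\<not> collinear {R, P, Q}"
    using assms by (auto simp: is_tri_def insert_commute)
  have "P \<noteq> Q" "P \<noteq> R" "Q \<noteq> R" using nc by auto
  then show ?thesis
    using noncollinear_dist_less[OF nc(1)] noncollinear_dist_less[OF nc(2)] noncollinear_dist_less[OF nc(3)] assms
    by (auto simp: is_tri_def tri_sides_def dist_commute)
qed

lemma polar_form: "\<exists>t. v = norm v *\<^sub>R dir t"
proof (cases "v = 0")
  case False
  then have "(v $ 1 / norm v)^2 + (v $ 2 / norm v)^2 = 1"
    by (simp add: norm_real2 power_divide flip: add_divide_distrib) (simp add: vec2_eq_iff sum_power2_eq_zero_iff)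
  then obtain t where t: "cos t = v $ 1 / norm v" "sin t = v $ 2 / norm v" by (metis sincos_total_2pi)
  have "v = norm v *\<^sub>R dir t" unfolding vec2_eq_iff using False by (simp add: t)
  then show ?thesis ..
qed simp

lemma antiperiodic_int:
  fixes h :: "real \<Rightarrow> 'a::real_vector"
  assumes "\<And>t. h (t + pi) = - h t"
  shows "h (t + of_int k * pi) = (if even k then 1 else - 1 :: real) *\<^sub>R h t"
proof -
  have step: "h (t + of_int (k + 1) * pi) = - h (t + of_int k * pi)" for k
    using assms[of "t + of_int k * pi"] by (simp add: algebra_simps)
  show ?thesis
  proof (induction k rule: int_induct[where k=0])
    case (step1 i)
    then show ?case using step[of i] by simp
  next
    case (step2 i)
    then show ?case using step[of "i - 1"] by (auto split: if_splits)
  qed simp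
qed

lemma dir_plus_int_pi: "dir (t + of_int k * pi) = (if even k then 1 else - 1 :: real) *\<^sub>R dir t"
  by (rule antiperiodic_int) (rule dir_plus_pi)

text \<open>\<open>sg\<close> is the orientation. The law of cosines determines the cosine of the
  angle between the two sides at \<open>P\<close>, hence the angle up to sign and full
  turns.\<close>

lemma canonical_form:
  assumes "is_tri e f g P Q R"
  shows "\<exists>a sg. (sg = 1 \<or> sg = - 1) \<and> Q = P + g *\<^sub>R dir a \<and> R = P + f *\<^sub>R dir (a + sg * ang e f g)"
proof -
  let ?E = "ang e f g"
  have tri: "tri_sides e f g" by (rule is_tri_sides[OF assms])
  then have pos: "0 < e" "0 < f" "0 < g" by (auto simp: tri_sides_def)
  have d: "norm (Q - P) = g" "norm (R - P) = f" "norm (Q - R) = e"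
    using assms by (auto simp: is_tri_def dist_norm norm_minus_commute)
  obtain a where a: "Q - P = g *\<^sub>R dir a" using polar_form[of "Q - P"] d by auto
  obtain b where b: "R - P = f *\<^sub>R dir b" using polar_form[of "R - P"] d by auto
  have "Q - R = (Q - P) - (R - P)" by simp
  then have "e^2 = (norm ((Q - P) - (R - P)))^2" using d by simp
  also have "\<dots> = g^2 + f^2 - 2 * ((Q - P) \<bullet> (R - P))"
    using d by (simp add: power2_norm_eq_inner inner_diff inner_commute flip: d)
  also have "(Q - P) \<bullet> (R - P) = g * f * cos (b - a)" unfolding a b by (simp add: inner_dir) (metis cos_minus minus_diff_eq)
  finally have "cos (b - a) = cos ?E" unfolding cos_ang[OF tri] using pos by (simp add: field_simps)
  then have "sin ((b - a + ?E) / 2) * sin ((?E - (b - a)) / 2) = 0" using cos_diff_cos[of "b - a" ?E] by simp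
  then obtain i :: int where i: "(b - a + ?E) / 2 = of_int i * pi \<or> (?E - (b - a)) / 2 = of_int i * pi"
    by (auto simp: sin_zero_iff_int2)
  have "\<exists>sg. (sg = 1 \<or> sg = - 1) \<and> dir b = dir (a + sg * ?E)"
  proof -
    have per: "dir (t + of_int (2 * k) * pi) = dir t" for t k using dir_plus_int_pi[of t "2 * k"] by simp
    from i show ?thesis
    proof
      assume "(b - a + ?E) / 2 = of_int i * pi"
      then have "b = a + (- 1) * ?E + of_int (2 * i) * pi" by simp
      then show ?thesis using per[of "a + (- 1) * ?E" i] by metis
    next
      assume "(?E - (b - a)) / 2 = of_int i * pi"
      then have "b = a + 1 * ?E + of_int (2 * (- i)) * pi" by simp
      then show ?thesis using per[of "a + 1 * ?E" "- i"] by metis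
    qed
  qed
  then obtain sg where sg: "sg = 1 \<or> sg = - 1" "dir b = dir (a + sg * ?E)" by blast
  have "Q = P + g *\<^sub>R dir a" "R = P + f *\<^sub>R dir (a + sg * ?E)" using a b sg(2) by (simp_all add: algebra_simps)
  then show ?thesis using sg(1) by blast
qed

section \<open>Jumps along all lines\<close>

definition jump :: "(real^2) set \<Rightarrow> real \<Rightarrow> real \<Rightarrow> real" where
  "jump S t c = (THE v. has_jump S t c v)"

lemma jumpI: "has_jump S t c v \<Longrightarrow> jump S t c = v"
  unfolding jump_def using has_jump_unique by blast

text \<open>Guarantees that \<open>THE\<close> in \<open>jump\<close> denotes the limit when the set
  is a triangle.\<close>

lemma has_jump_triangle:
  assumes "\<not> collinear {P, Q, R}"
  shows "has_jump (tri P Q R) t c (jump (tri P Q R) t c)"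
proof -
  have "\<exists>v. has_jump (tri P Q R) t c v"
  proof (cases "(level t P = c \<and> level t Q = c) \<or> (level t P = c \<and> level t R = c) \<or> (level t Q = c \<and> level t R = c)")
    case False
    then show ?thesis using has_jump_no_edge[OF assms, of t c] by blast
  next
    case True
    note three = not_all_level[OF assms, of t c]
    then show ?thesis
      using True has_jump_level[of P t c Q R c] has_jump_level[of P t c R Q c]
        has_jump_level[of Q t c R P c] unfolding triangle_permute by blast
  qed
  then show ?thesis using jumpI by metis
qed

lemma jump_edge:
  assumes nc: "\<not> collinear {X, Y, Z}" and "level t X = c" "level t Y = c"
  shows "jump (tri X Y Z) t c = (if level t Z < c then dist X Y else - dist X Y)"
proof -
  have "level t Z \<noteq> c" using not_all_level[OF nc, of t c] assms by auto
  then have "has_jump (tri Z X Y) t c (if c = c then if level t Z < c then dist X Y else - dist X Y else 0)"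
    using assms by (intro has_jump_level) auto
  from jumpI[OF this] have "jump (tri Z X Y) t c = (if level t Z < c then dist X Y else - dist X Y)" by simp
  moreover have "tri Z X Y = tri X Y Z" by (simp add: insert_commute)
  ultimately show ?thesis by simp
qed

lemma jump_nonzero_edge:
  assumes "\<not> collinear {P, Q, R}" "jump (tri P Q R) t c \<noteq> 0"
  shows "(level t P = c \<and> level t Q = c) \<or> (level t P = c \<and> level t R = c) \<or> (level t Q = c \<and> level t R = c)"
proof (rule ccontr)
  assume neg: "\<not> ?thesis"
  have "has_jump (tri P Q R) t c 0"
    by (rule has_jump_no_edge[OF assms(1)]) (use neg in simp_all)
  then show False using jumpI assms(2) by simp
qed

text \<open>Every line is \<open>level t z = c\<close> for exactly one \<open>(t, c)\<close> with \<open>0 \<le> t < pi\<close>.\<close>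

definition line_of :: "real \<Rightarrow> real \<Rightarrow> real \<times> real" where
  "line_of \<tau> c = (\<tau> - of_int \<lfloor>\<tau> / pi\<rfloor> * pi, if even \<lfloor>\<tau> / pi\<rfloor> then c else - c)"

lemma line_of_range: "0 \<le> fst (line_of \<tau> c)" "fst (line_of \<tau> c) < pi"
proof -
  have "of_int \<lfloor>\<tau> / pi\<rfloor> * pi \<le> \<tau> / pi * pi" "\<tau> / pi * pi < (of_int \<lfloor>\<tau> / pi\<rfloor> + 1) * pi"
    by (intro mult_right_mono mult_strict_right_mono; linarith?; simp)+
  then have "of_int \<lfloor>\<tau> / pi\<rfloor> * pi \<le> \<tau>" "\<tau> < of_int \<lfloor>\<tau> / pi\<rfloor> * pi + pi" by (simp_all add: distrib_right)
  then show "0 \<le> fst (line_of \<tau> c)" "fst (line_of \<tau> c) < pi" by (simp_all add: line_of_def)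
qed

text \<open>Both \<open>\<tau>\<close> and \<open>t\<close> are normal directions of the line
  \<open>XY\<close>, so they differ by a multiple of \<open>pi\<close>, which the floor in
  \<open>line_of\<close> recovers.\<close>

lemma line_of_unique:
  assumes "X \<noteq> Y" "level \<tau> X = c" "level \<tau> Y = c" "0 \<le> t" "t < pi" "level t X = c'" "level t Y = c'"
  shows "line_of \<tau> c = (t, c')"
proof -
  obtain b where b: "X - Y = norm (X - Y) *\<^sub>R dir b" using polar_form by blast
  have "cos (b - u) = 0" if "X \<bullet> dir u = Y \<bullet> dir u" for u
  proof -
    have "(X - Y) \<bullet> dir u = 0" using that by (simp add: inner_diff_left)
    then have "norm (X - Y) * cos (b - u) = 0" by (metis b inner_dir inner_scaleR_left)
    then show ?thesis using assms(1) by simp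
  qed
  then have "cos (b - \<tau>) = 0" "cos (b - t) = 0" using assms by auto
  then have "sin ((b - t) - (b - \<tau>)) = 0" by (simp only: sin_diff)
  then obtain i :: int where i: "\<tau> = t + of_int i * pi" by (auto simp: sin_zero_iff_int2 algebra_simps)
  then have "\<tau> / pi = t / pi + of_int i" by (simp add: field_simps)
  moreover have "0 \<le> t / pi" "t / pi < 1" using assms by auto
  ultimately have fl: "\<lfloor>\<tau> / pi\<rfloor> = i" by (intro floor_unique) auto
  have "c = (if even i then 1 else - 1) * c'" using assms unfolding i dir_plus_int_pi by auto
  then show ?thesis unfolding line_of_def fl using i by auto
qed

text \<open>Reversing the normal changes the sign of both the weight and the jump, so their product
  can be evaluated at the outward normal \<open>\<tau>\<close>.\<close>

lemma edge_weight:
  assumes w: "\<And>t. w (t + pi) = - w t" and nc: "\<not> collinear {X, Y, Z}"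
    and X: "level \<tau> X = c" and Y: "level \<tau> Y = c" and Z: "level \<tau> Z < c"
  shows "w (fst (line_of \<tau> c)) * jump (tri X Y Z) (fst (line_of \<tau> c)) (snd (line_of \<tau> c)) = w \<tau> * dist X Y"
    and "X \<bullet> dir (fst (line_of \<tau> c)) = snd (line_of \<tau> c)"
proof -
  define k where "k = \<lfloor>\<tau> / pi\<rfloor>"
  define t where "t = \<tau> - of_int k * pi"
  have \<tau>: "\<tau> = t + of_int k * pi" by (simp add: t_def)
  have l: "line_of \<tau> c = (t, if even k then c else - c)" by (simp add: line_of_def t_def k_def)
  have wt: "w \<tau> = (if even k then 1 else - 1) * w t" unfolding \<tau> using antiperiodic_int[of w t k] w by simp
  have d: "dir \<tau> = (if even k then 1 else - 1 :: real) *\<^sub>R dir t" unfolding \<tau> by (rule dir_plus_int_pi)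
  have Xt: "level t X = (if even k then c else - c)" and Yt: "level t Y = (if even k then c else - c)"
    using X Y unfolding d by (auto split: if_splits)
  then show "X \<bullet> dir (fst (line_of \<tau> c)) = snd (line_of \<tau> c)" by (simp add: l)
  have "jump (tri X Y Z) t (if even k then c else - c) = (if even k then 1 else - 1) * dist X Y"
    using Z unfolding jump_edge[OF nc Xt Yt] d by (auto split: if_splits)
  then show "w (fst (line_of \<tau> c)) * jump (tri X Y Z) (fst (line_of \<tau> c)) (snd (line_of \<tau> c)) = w \<tau> * dist X Y"
    by (simp add: l wt)
qed

definition edge_lines :: "(real^2) set \<Rightarrow> (real \<times> real) set" where
  "edge_lines S = {(t, c). 0 \<le> t \<and> t < pi \<and> jump S t c \<noteq> 0}"

text \<open>The outward normals of two edges differ by \<open>pi\<close> plus or minus the angle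
  between the edges, so the weights on \<open>f\<close> and \<open>e\<close> are that on
  \<open>g\<close> times \<open>- eps\<close> and \<open>- del\<close>. \<open>Z\<close> may be any
  finite set of lines containing \<open>edge_lines S\<close>, so that all tiles and the big triangle
  can later share one.\<close>

lemma weighted_jump_sum:
  assumes tri: "is_tri e f g P Q R" and S: "S = tri P Q R"
    and w: "\<And>t. w (t + pi) = - w t" "\<And>t. w (t + ang e f g) = eps * w t" "\<And>t. w (t + ang f e g) = del * w t"
    and eps: "eps \<in> {1, -1}" and del: "del \<in> {1, -1}"
  shows "finite (edge_lines S) \<and> (\<exists>\<tau>. \<forall>Z. finite Z \<longrightarrow> edge_lines S \<subseteq> Z \<longrightarrow> Z \<subseteq> {0..<pi} \<times> UNIV \<longrightarrow>
    (\<Sum>(t, c)\<in>Z. w t * jump S t c) = w \<tau> * (g - eps * f - del * e))"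
proof -
  let ?E = "ang e f g" and ?F = "ang f e g" and ?G = "ang g e f"
  have ts: "tri_sides e f g" by (rule is_tri_sides[OF tri])
  then have pos: "0 < e" "0 < f" "0 < g" by (auto simp: tri_sides_def)
  have sum: "?E + ?F + ?G = pi" by (rule ang_sum[OF ts])
  obtain a sg where sg: "sg = 1 \<or> sg = - 1" and Q: "Q = P + g *\<^sub>R dir a" and R: "R = P + f *\<^sub>R dir (a + sg * ?E)"
    using canonical_form[OF tri] by blast
  have nc: "\<not> collinear {P, Q, R}" and d: "dist P Q = g" "dist P R = f" "dist Q R = e"
    using tri by (auto simp: is_tri_def)
  have nc': "\<not> collinear {P, R, Q}" "\<not> collinear {Q, R, P}" using nc by (simp_all add: insert_commute)
  have sinE: "0 < sin ?E" and sinF: "0 < sin ?F"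
    using sin_ang_pos ts tri_sides_swap by blast+
  \<comment> \<open>Outward normals of the edges of lengths \<open>g\<close>, \<open>f\<close>,
    \<open>e\<close>.\<close>
  define tg tf te where t: "tg = a - sg * (pi / 2)" "tf = a + sg * (?E + pi / 2)" "te = a + sg * (pi / 2 - ?F)"
  have inner: "dir u \<bullet> dir v = cos x" if "u - v = sg * x" for u v x using sg that by (auto simp: inner_dir)
  define cg cf ce where c: "cg = level tg P" "cf = level tf P" "ce = level te Q"
  have g1: "level tg Q = cg"
    using inner[of a tg "pi / 2"] by (simp add: Q c t inner_add_left)
  have "dir (a + sg * ?E) \<bullet> dir tg = - sin ?E"
    using inner[of "a + sg * ?E" tg "?E + pi / 2"] by (simp add: t cos_add algebra_simps)
  then have g2: "level tg R < cg" using sinE pos by (simp add: R c inner_add_left)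
  have f1: "level tf R = cf"
    using inner[of "a + sg * ?E" tf "- (pi / 2)"] by (simp add: R c t inner_add_left algebra_simps)
  have "dir a \<bullet> dir tf = - sin ?E" using inner[of a tf "- (?E + pi / 2)"] by (simp add: t cos_add cos_diff algebra_simps)
  then have f2: "level tf Q < cf" using sinE pos by (simp add: Q c inner_add_left)
  have "dir a \<bullet> dir te = sin ?F" using inner[of a te "?F - pi / 2"] by (simp add: t cos_diff algebra_simps)
  then have eQ: "ce = level te P + g * sin ?F" by (simp add: Q c inner_add_left)
  have e1: "level te R = ce"
  proof -
    have G: "?G = pi - ?E - ?F" using sum by simp
    have "a + sg * ?E - te = sg * (pi / 2 - ?G)" unfolding G by (simp add: t field_simps)
    then have "dir (a + sg * ?E) \<bullet> dir te = sin ?G" by (simp only: inner) (simp add: cos_diff)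
    moreover have "g * sin ?F = f * sin ?G"
      using projection_formula(2)[of f g e] ts by (simp add: tri_sides_def ang_commute)
    ultimately show ?thesis by (simp add: R eQ inner_add_left)
  qed
  have e2: "level te P < ce" using eQ sinF pos by simp
  have wf: "w tf = - eps * w tg" and we: "w te = - del * w tg"
  proof -
    have m: "w (t - x) = y * w t" if "\<And>t. w (t + x) = y * w t" "y \<in> {1, -1}" for x y t
      using that(1)[of "t - x"] that(2) by auto
    have "w tf = - w (tg + sg * ?E)"
    proof (cases "sg = 1")
      case True
      have "tf = (tg + ?E) + pi" by (simp add: t True)
      then show ?thesis using w(1)[of "tg + ?E"] True by simp
    next
      case False
      then have "tg - ?E = tf + pi" using sg by (simp add: t)
      then show ?thesis using w(1)[of tf] False sg by simp
    qed
    moreover have "w (tg + sg * ?E) = eps * w tg" using sg w(2) m[of ?E eps tg] eps by auto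
    ultimately show "w tf = - eps * w tg" by simp
    have "w te = - w (tg - sg * ?F)"
    proof (cases "sg = 1")
      case True
      have "te = (tg - ?F) + pi" by (simp add: t True)
      then show ?thesis using w(1)[of "tg - ?F"] True by simp
    next
      case False
      then have "tg + ?F = te + pi" using sg by (simp add: t)
      then show ?thesis using w(1)[of te] False sg by simp
    qed
    moreover have "w (tg - sg * ?F) = del * w tg" using sg w(3) m[of ?F del tg] del by auto
    ultimately show "w te = - del * w tg" by simp
  qed
  define lg lf le where l: "lg = line_of tg cg" "lf = line_of tf cf" "le = line_of te ce"
  have PQ: "level tg P = cg" and PR: "level tf P = cf" and QR: "level te Q = ce" by (simp_all add: c)
  have Sp: "S = tri P R Q" "S = tri Q R P" unfolding S by (simp_all add: insert_commute)
  have wg: "w (fst lg) * jump S (fst lg) (snd lg) = w tg * g"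
    using edge_weight(1)[of w, OF w(1) nc PQ g1 g2] d S l by simp
  have wfj: "w (fst lf) * jump S (fst lf) (snd lf) = w tf * f"
    using edge_weight(1)[of w, OF w(1) nc'(1) PR f1 f2] d Sp(1) l by simp
  have wej: "w (fst le) * jump S (fst le) (snd le) = w te * e"
    using edge_weight(1)[of w, OF w(1) nc'(2) QR e1 e2] d Sp(2) l by simp
  have mem: "P \<bullet> dir (fst lg) = snd lg" "Q \<bullet> dir (fst lg) = snd lg" "P \<bullet> dir (fst lf) = snd lf" "R \<bullet> dir (fst lf) = snd lf"
    "Q \<bullet> dir (fst le) = snd le" "R \<bullet> dir (fst le) = snd le"
    using edge_weight(2)[of w, OF w(1) nc PQ g1 g2] edge_weight(2)[of w Q P R, OF w(1) _ g1 PQ g2]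
      edge_weight(2)[of w, OF w(1) nc'(1) PR f1 f2] edge_weight(2)[of w R P Q, OF w(1) _ f1 PR f2]
      edge_weight(2)[of w, OF w(1) nc'(2) QR e1 e2] edge_weight(2)[of w R Q P, OF w(1) _ e1 QR e2] nc
    by (simp_all add: l insert_commute)
  have dist3: "lg \<noteq> lf" "lg \<noteq> le" "lf \<noteq> le"
    using mem not_all_level[OF nc] by metis+
  have neq: "P \<noteq> Q" "P \<noteq> R" "Q \<noteq> R" using nc nc' by auto
  have sub: "edge_lines S \<subseteq> {lg, lf, le}"
  proof
    fix x assume "x \<in> edge_lines S"
    then obtain t c where x: "x = (t, c)" "0 \<le> t" "t < pi" "jump S t c \<noteq> 0" by (auto simp: edge_lines_def)
    from jump_nonzero_edge[OF nc x(4)[unfolded S]] show "x \<in> {lg, lf, le}"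
      using line_of_unique[OF neq(1) PQ g1 x(2,3)] line_of_unique[OF neq(2) PR f1 x(2,3)] line_of_unique[OF neq(3) QR e1 x(2,3)]
      unfolding x(1) l by auto
  qed
  show ?thesis
  proof (intro conjI exI[of _ tg] allI impI)
    show "finite (edge_lines S)" using sub finite_subset by blast
    fix Z assume Z: "finite Z" "edge_lines S \<subseteq> Z" "Z \<subseteq> {0..<pi} \<times> UNIV"
    have in_edge: "x \<in> edge_lines S \<longleftrightarrow> jump S (fst x) (snd x) \<noteq> 0" if "x \<in> {lg, lf, le} \<union> Z" for x
      using that Z(3) line_of_range unfolding edge_lines_def l by (auto simp: case_prod_beta)
    have zero: "(case x of (t, c) \<Rightarrow> w t * jump S t c) = 0" if "x \<in> {lg, lf, le} \<union> Z" "x \<notin> edge_lines S" for x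
      using in_edge[OF that(1)] that(2) by (simp add: case_prod_beta)
    have "(\<Sum>(t, c)\<in>Z. w t * jump S t c) = (\<Sum>(t, c)\<in>Z \<union> {lg, lf, le}. w t * jump S t c)"
      by (rule sum.mono_neutral_left) (use Z zero in blast)+
    also have "\<dots> = (\<Sum>(t, c)\<in>{lg, lf, le}. w t * jump S t c)"
      by (rule sum.mono_neutral_right) (use Z sub zero in blast)+
    also have "\<dots> = w tg * g + w tf * f + w te * e"
      using dist3 wg wfj wej by (simp add: case_prod_beta)
    also have "\<dots> = w tg * (g - eps * f - del * e)" unfolding wf we by (simp add: algebra_simps)
    finally show "(\<Sum>(t, c)\<in>Z. w t * jump S t c) = w tg * (g - eps * f - del * e)" .
  qed
qed

section \<open>Edge sums over a tiling\<close>

text \<open>Over a common finite set of lines the weighted jumps of the tiles add up to those of the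
  big triangle. Each tile contributes \<open>g - eps * f - del * e\<close> up to sign, and the big
  triangle \<open>s\<close> times this up to sign.\<close>

lemma weighted_length_additive:
  assumes add: "additive_over U \<T>" and s: "0 < s"
    and tiles: "\<And>S. S \<in> \<T> \<Longrightarrow> \<exists>P Q R. is_tri e f g P Q R \<and> S = tri P Q R"
    and big: "is_tri (s * e) (s * f) (s * g) A B C" "U = tri A B C"
    and epsdel: "eps \<in> {1, -1}" "del \<in> {1, -1}" and w1: "\<And>t. w t \<in> {1, -1}"
    and w: "\<And>t. w (t + pi) = - w t" "\<And>t. w (t + ang e f g) = eps * w t" "\<And>t. w (t + ang f e g) = del * w t"
  shows "\<exists>k::int. s * (g - eps * f - del * e) = of_int k * (g - eps * f - del * e)"
proof -
  let ?D = "g - eps * f - del * e"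
  have fin: "finite \<T>" using add by (simp add: additive_over_def)
  have w': "\<And>t. w (t + ang (s * e) (s * f) (s * g)) = eps * w t" "\<And>t. w (t + ang (s * f) (s * e) (s * g)) = del * w t"
    using w(2,3) ang_scale[OF s] by auto
  have U: "finite (edge_lines U)" and Ut: "\<exists>\<tau>. \<forall>Z. finite Z \<longrightarrow> edge_lines U \<subseteq> Z \<longrightarrow> Z \<subseteq> {0..<pi} \<times> UNIV \<longrightarrow>
    (\<Sum>(t, c)\<in>Z. w t * jump U t c) = w \<tau> * (s * g - eps * (s * f) - del * (s * e))"
    using weighted_jump_sum[of _ _ _ A B C U w, OF big w(1) w' epsdel] by auto
  have T: "finite (edge_lines S) \<and> (\<exists>\<tau>. \<forall>Z. finite Z \<longrightarrow> edge_lines S \<subseteq> Z \<longrightarrow> Z \<subseteq> {0..<pi} \<times> UNIV \<longrightarrow>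
    (\<Sum>(t, c)\<in>Z. w t * jump S t c) = w \<tau> * ?D)" if "S \<in> \<T>" for S
    using tiles[OF that] weighted_jump_sum[of _ _ _ _ _ _ S w, OF _ _ w epsdel] by blast
  define Z where "Z = edge_lines U \<union> (\<Union>S\<in>\<T>. edge_lines S)"
  have Z: "finite Z" "edge_lines U \<subseteq> Z" "\<And>S. S \<in> \<T> \<Longrightarrow> edge_lines S \<subseteq> Z" "Z \<subseteq> {0..<pi} \<times> UNIV"
    using U T fin by (auto simp: Z_def edge_lines_def)
  obtain \<tau> where \<tau>: "(\<Sum>(t, c)\<in>Z. w t * jump U t c) = w \<tau> * (s * g - eps * (s * f) - del * (s * e))"
    using Ut Z by blast
  have "\<exists>\<tau>. (\<Sum>(t, c)\<in>Z. w t * jump S t c) = w \<tau> * ?D" if "S \<in> \<T>" for S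
    using T[OF that] Z(1,4) Z(3)[OF that] by blast
  then obtain h where h: "\<And>S. S \<in> \<T> \<Longrightarrow> (\<Sum>(t, c)\<in>Z. w t * jump S t c) = w (h S) * ?D" by metis
  have jU: "jump U t c = (\<Sum>S\<in>\<T>. jump S t c)" for t c
  proof (rule jumpI, rule has_jump_sum[OF add])
    fix S assume "S \<in> \<T>"
    then obtain P Q R where "is_tri e f g P Q R" "S = tri P Q R" using tiles by blast
    then show "has_jump S t c (jump S t c)" using has_jump_triangle by (simp add: is_tri_def)
  qed
  have "w \<tau> * (s * ?D) = (\<Sum>(t, c)\<in>Z. w t * jump U t c)" unfolding \<tau> by (simp add: algebra_simps)
  also have "\<dots> = (\<Sum>S\<in>\<T>. \<Sum>(t, c)\<in>Z. w t * jump S t c)"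
    unfolding jU case_prod_beta sum_distrib_left by (rule sum.swap)
  also have "\<dots> = (\<Sum>S\<in>\<T>. w (h S)) * ?D" using h by (simp add: sum_distrib_right)
  finally have eq: "w \<tau> * (s * ?D) = (\<Sum>S\<in>\<T>. w (h S)) * ?D" .
  have wi: "w t \<in> \<int>" for t using w1[of t] by auto
  have "w \<tau> * w \<tau> = 1" using w1[of \<tau>] by auto
  then have "s * ?D = w \<tau> * (w \<tau> * (s * ?D))" by (simp flip: mult.assoc)
  also have "\<dots> = (w \<tau> * (\<Sum>S\<in>\<T>. w (h S))) * ?D" unfolding eq by simp
  finally have "s * ?D = (w \<tau> * (\<Sum>S\<in>\<T>. w (h S))) * ?D" .
  moreover have "w \<tau> * (\<Sum>S\<in>\<T>. w (h S)) \<in> \<int>" using wi by (intro Ints_mult Ints_sum)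
  ultimately show ?thesis by (metis Ints_cases)
qed

lemma outward_normal:
  assumes "\<not> collinear {A, B, C}"
  shows "\<exists>t. level t B = level t C \<and> level t A < level t C"
proof -
  obtain b where b: "C - B = norm (C - B) *\<^sub>R dir b" using polar_form by blast
  have "(C - B) \<bullet> dir (b - pi / 2) = 0" by (subst b) (simp add: inner_dir)
  then have eq: "B \<bullet> dir (b - pi / 2) = C \<bullet> dir (b - pi / 2)" by (simp add: inner_diff_left)
  show ?thesis
  proof (cases "A \<bullet> dir (b - pi / 2) < C \<bullet> dir (b - pi / 2)")
    case True
    then show ?thesis using eq by blast
  next
    case False
    moreover have "A \<bullet> dir (b - pi / 2) \<noteq> C \<bullet> dir (b - pi / 2)"
      using not_all_level[OF assms, of "b - pi / 2"] eq by auto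
    ultimately have "A \<bullet> dir (b - pi / 2 + pi) < C \<bullet> dir (b - pi / 2 + pi)"
      "B \<bullet> dir (b - pi / 2 + pi) = C \<bullet> dir (b - pi / 2 + pi)"
      using eq unfolding dir_plus_pi by auto
    then show ?thesis by blast
  qed
qed

lemma sum_of_sides:
  assumes "finite I" "\<And>i. i \<in> I \<Longrightarrow> v i \<in> {0, e, f, g}"
  shows "\<exists>n1 n2 n3. (\<Sum>i\<in>I. v i) = real n1 * e + real n2 * f + real n3 * g"
  using assms
proof (induction I rule: finite_induct)
  case empty
  then show ?case by (intro exI[of _ 0]) simp
next
  case (insert x F)
  then obtain n1 n2 n3 where n: "(\<Sum>i\<in>F. v i) = real n1 * e + real n2 * f + real n3 * g" by auto
  have "v x \<in> {0, e, f, g}" using insert by simp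
  then consider "v x = 0" | "v x = e" | "v x = f" | "v x = g" by auto
  then show ?case
  proof cases
    case 1 then show ?thesis using n insert by auto
  next
    case 2 then show ?thesis using n insert
      by (intro exI[of _ "Suc n1"] exI[of _ n2] exI[of _ n3]) (simp add: algebra_simps)
  next
    case 3 then show ?thesis using n insert
      by (intro exI[of _ n1] exI[of _ "Suc n2"] exI[of _ n3]) (simp add: algebra_simps)
  next
    case 4 then show ?thesis using n insert
      by (intro exI[of _ n1] exI[of _ n2] exI[of _ "Suc n3"]) (simp add: algebra_simps)
  qed
qed

text \<open>\<open>U\<close> lies on one side of its supporting line \<open>BC\<close>, so every
  tile edge on this line has its tile below it and counts positively; nothing cancels. Splitting off
  one tile gives the second claim.\<close>

lemma side_decomposition:
  assumes add: "additive_over U \<T>" and sub: "\<And>S. S \<in> \<T> \<Longrightarrow> S \<subseteq> U"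
    and tiles: "\<And>S. S \<in> \<T> \<Longrightarrow> \<exists>P Q R. is_tri e f g P Q R \<and> S = tri P Q R"
    and nc: "\<not> collinear {A, B, C}" and U: "U = tri A B C"
    and t: "level t B = level t C" "level t A < level t C"
  shows "\<exists>n1 n2 n3. dist B C = real n1 * e + real n2 * f + real n3 * g"
    and "S \<in> \<T> \<Longrightarrow> S = tri X Y Z \<Longrightarrow> \<not> collinear {X, Y, Z} \<Longrightarrow> level t X = level t C \<Longrightarrow> level t Y = level t C
      \<Longrightarrow> fits e f g (dist B C) (dist X Y)"
proof -
  let ?c = "level t C"
  have fin: "finite \<T>" using add by (simp add: additive_over_def)
  have le: "level t z \<le> ?c" if "z \<in> U" for z
    using triangle_inner_le[OF that[unfolded U], of "dir t" ?c] t by simp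
  have below: "jump S t ?c = dist X Y"
    if "S \<in> \<T>" "S = tri X Y Z" "\<not> collinear {X, Y, Z}" "level t X = ?c" "level t Y = ?c" for S X Y Z
  proof -
    have "Z \<in> S" using that(2) by (auto intro: hull_inc)
    then have "level t Z \<le> ?c" using le sub[OF that(1)] by blast
    then have "level t Z < ?c" using not_all_level[OF that(3), of t ?c] that(4,5) by fastforce
    then show ?thesis unfolding that(2) jump_edge[OF that(3-5)] by simp
  qed
  have val: "jump S t ?c \<in> {0, e, f, g}" if S: "S \<in> \<T>" for S
  proof (cases "jump S t ?c = 0")
    case False
    obtain P Q R where h: "is_tri e f g P Q R" "S = tri P Q R" using tiles[OF S] by blast
    have n: "\<not> collinear {P, Q, R}" "\<not> collinear {P, R, Q}" "\<not> collinear {Q, R, P}"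
      and d: "dist Q R = e" "dist P R = f" "dist P Q = g" using h by (auto simp: is_tri_def insert_commute)
    have S': "S = tri P R Q" "S = tri Q R P" using h(2) by (simp_all add: insert_commute)
    from jump_nonzero_edge[OF n(1) False[unfolded h(2)]] show ?thesis
      using below[OF S h(2) n(1)] below[OF S S'(1) n(2)] below[OF S S'(2) n(3)] d by auto
  qed simp
  have "has_jump U t ?c (\<Sum>S\<in>\<T>. jump S t ?c)"
  proof (rule has_jump_sum[OF add])
    fix S assume "S \<in> \<T>"
    then obtain P Q R where "is_tri e f g P Q R" "S = tri P Q R" using tiles by blast
    then show "has_jump S t ?c (jump S t ?c)" using has_jump_triangle by (simp add: is_tri_def)
  qed
  moreover have "jump U t ?c = dist B C"
  proof -
    have "U = tri B C A" "\<not> collinear {B, C, A}" using U nc by (simp_all add: insert_commute)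
    then show ?thesis using jump_edge[of B C A t ?c] t by simp
  qed
  ultimately have sum: "dist B C = (\<Sum>S\<in>\<T>. jump S t ?c)" using jumpI by metis
  then show "\<exists>n1 n2 n3. dist B C = real n1 * e + real n2 * f + real n3 * g"
    using sum_of_sides[OF fin val] by auto
  show "fits e f g (dist B C) (dist X Y)"
    if h: "S \<in> \<T>" "S = tri X Y Z" "\<not> collinear {X, Y, Z}" "level t X = ?c" "level t Y = ?c"
  proof -
    have "dist B C = dist X Y + (\<Sum>S\<in>\<T> - {S}. jump S t ?c)"
      unfolding sum using below[OF h] fin h(1) by (simp add: sum.remove)
    moreover obtain n1 n2 n3 where "(\<Sum>S\<in>\<T> - {S}. jump S t ?c) = real n1 * e + real n2 * f + real n3 * g"
      using sum_of_sides[of "\<T> - {S}" "\<lambda>S. jump S t ?c" e f g] val fin by auto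
    ultimately show ?thesis unfolding fits_def by (metis add.assoc)
  qed
qed

section \<open>Local angles\<close>

text \<open>Cauchy's functional equation on an interval: nonnegativity gives monotonicity, which
  squeezes \<open>s x\<close> between the values at neighbouring multiples of
  \<open>L / n\<close>.\<close>

lemma additive_nonneg_linear:
  fixes s :: "real \<Rightarrow> real"
  assumes L: "0 < L" and nonneg: "\<And>x. 0 \<le> x \<Longrightarrow> x \<le> L \<Longrightarrow> 0 \<le> s x"
    and add: "\<And>x y. 0 \<le> x \<Longrightarrow> 0 \<le> y \<Longrightarrow> x + y \<le> L \<Longrightarrow> s (x + y) = s x + s y"
    and x: "0 \<le> x" "x \<le> L"
  shows "s x = x / L * s L"
proof -
  have mono: "s a \<le> s b" if "0 \<le> a" "a \<le> b" "b \<le> L" for a b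
    using add[of a "b - a"] nonneg[of "b - a"] that by simp
  have mult: "s (real n * a) = real n * s a" if "0 \<le> a" "real n * a \<le> L" for n a
    using that(2)
  proof (induction n)
    case 0
    have "s (0 + 0) = s 0 + s 0" using L by (intro add) auto
    then show ?case by simp
  next
    case (Suc n)
    have "real n * a \<le> L" using Suc.prems that(1) by (simp add: algebra_simps)
    moreover have "s (real n * a + a) = s (real n * a) + s a"
      using that(1) Suc.prems by (intro add) (auto simp: algebra_simps)
    ultimately show ?case using Suc.IH by (simp add: algebra_simps)
  qed
  have frac: "s (real k * (L / real n)) = real k / real n * s L" if "0 < n" "k \<le> n" for k n
  proof -
    have "s (real n * (L / real n)) = real n * s (L / real n)" using L that by (intro mult) auto
    then have "s (L / real n) = s L / real n" using that by (simp add: field_simps)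
    moreover have "s (real k * (L / real n)) = real k * s (L / real n)"
      using L that by (intro mult) (auto simp: field_simps)
    ultimately show ?thesis by simp
  qed
  have close: "\<bar>s x - x / L * s L\<bar> \<le> s L / real n" if n: "0 < n" for n
  proof (cases "x = L")
    case True
    then show ?thesis using L nonneg[of L] by simp
  next
    case False
    define k where "k = nat \<lfloor>real n * x / L\<rfloor>"
    have "0 \<le> real n * x / L" using x L by simp
    then have k: "real k \<le> real n * x / L" "real n * x / L < real k + 1" by (simp_all add: k_def)
    have "real n * x / L < real n" using False x L n by (simp add: field_simps)
    then have kn: "k < n" using k by linarith
    have b: "real k * (L / n) \<le> x" "x \<le> real (Suc k) * (L / n)" using k L n by (auto simp: field_simps)
    have "real (Suc k) * (L / n) \<le> real n * (L / n)" using kn L by (intro mult_right_mono) auto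
    then have "real (Suc k) * (L / n) \<le> L" using n by simp
    then have "s (real k * (L / n)) \<le> s x" "s x \<le> s (real (Suc k) * (L / n))"
      using b x L by (auto intro!: mono)
    then have s: "real k / n * s L \<le> s x" "s x \<le> real (Suc k) / n * s L"
      using frac[OF n, of k] frac[OF n, of "Suc k"] kn by auto
    have sL: "0 \<le> s L" using nonneg L by simp
    have c: "real k / n \<le> x / L" "x / L \<le> real (Suc k) / n" using k L n by (auto simp: field_simps)
    have "real k / n * s L \<le> x / L * s L" "x / L * s L \<le> real (Suc k) / n * s L"
      by (rule mult_right_mono[OF c(1) sL], rule mult_right_mono[OF c(2) sL])
    moreover have "real (Suc k) / n * s L = real k / n * s L + s L / n" by (simp add: add_divide_distrib distrib_right)
    ultimately show ?thesis using s by linarith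
  qed
  show ?thesis
  proof (rule ccontr)
    assume "s x \<noteq> x / L * s L"
    then have d: "0 < \<bar>s x - x / L * s L\<bar>" by simp
    then obtain n where n: "s L / \<bar>s x - x / L * s L\<bar> < real n" using reals_Archimedean2 by blast
    have "0 \<le> s L" using nonneg L by simp
    then have "0 \<le> s L / \<bar>s x - x / L * s L\<bar>" using d by simp
    then have "0 < real n" using n by linarith
    then have n0: "0 < n" by simp
    have "s L / real n < \<bar>s x - x / L * s L\<bar>" using n d n0 by (simp add: field_simps)
    then show False using close[OF n0] by simp
  qed
qed

section \<open>Disc sectors and their area\<close>

definition sector :: "real \<Rightarrow> real \<Rightarrow> real \<Rightarrow> (real^2) set" where
  "sector r a b = (\<lambda>(rad, \<psi>). rad *\<^sub>R dir \<psi>) ` ({0..r} \<times> {a..b})"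

lemma in_sector_iff: "z \<in> sector r a b \<longleftrightarrow> (\<exists>rad \<psi>. 0 \<le> rad \<and> rad \<le> r \<and> a \<le> \<psi> \<and> \<psi> \<le> b \<and> z = rad *\<^sub>R dir \<psi>)"
  unfolding sector_def image_iff Bex_def split_paired_Ex mem_Times_iff fst_conv snd_conv prod.case atLeastAtMost_iff
  by blast

lemma sector_mono:
  assumes "a' \<le> a" "b \<le> b'"
  shows "sector r a b \<subseteq> sector r a' b'"
proof
  fix z assume "z \<in> sector r a b"
  then obtain rad \<psi> where h: "0 \<le> rad" "rad \<le> r" "a \<le> \<psi>" "\<psi> \<le> b" "z = rad *\<^sub>R dir \<psi>"
    unfolding in_sector_iff by blast
  then show "z \<in> sector r a' b'" unfolding in_sector_iff using assms
    by (intro exI[of _ rad] exI[of _ \<psi>]) auto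
qed

lemma dir_axis: "dir t = cos t *\<^sub>R axis 1 1 + sin t *\<^sub>R axis 2 1"
  by (simp add: vec2_eq_iff axis_def)

lemma compact_sector: "compact (sector r a b)"
  unfolding sector_def case_prod_beta dir_axis
  by (intro compact_continuous_image compact_Times compact_Icc continuous_intros)

definition rot :: "real \<Rightarrow> real^2 \<Rightarrow> real^2" where
  "rot a v = v $ 1 *\<^sub>R dir a + v $ 2 *\<^sub>R dir (a + pi / 2)"

lemma rot_dir: "rot a (rad *\<^sub>R dir t) = rad *\<^sub>R dir (a + t)"
  by (simp add: rot_def vec2_eq_iff cos_add sin_add algebra_simps)

lemma orthogonal_rot: "orthogonal_transformation (rot a)"
proof -
  have "linear (rot a)" by (rule linearI) (simp_all add: rot_def algebra_simps)
  moreover have "norm (rot a v) = norm v" for v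
  proof -
    obtain t where t: "v = norm v *\<^sub>R dir t" using polar_form by blast
    have "norm (rot a v) = norm (norm v *\<^sub>R dir (a + t))" by (subst t) (simp only: rot_dir)
    then show ?thesis by simp
  qed
  ultimately show ?thesis by (simp add: orthogonal_transformation)
qed

lemma rot_sector: "rot a ` sector r 0 b = sector r a (a + b)"
proof (intro equalityI subsetI)
  fix z assume "z \<in> rot a ` sector r 0 b"
  then obtain rad \<psi> where "0 \<le> rad" "rad \<le> r" "0 \<le> \<psi>" "\<psi> \<le> b" "z = rad *\<^sub>R dir (a + \<psi>)"
    by (auto simp: in_sector_iff rot_dir)
  then show "z \<in> sector r a (a + b)" unfolding in_sector_iff by (intro exI[of _ rad] exI[of _ "a + \<psi>"]) auto
next
  fix z assume "z \<in> sector r a (a + b)"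
  then obtain rad \<psi> where h: "0 \<le> rad" "rad \<le> r" "a \<le> \<psi>" "\<psi> \<le> a + b" "z = rad *\<^sub>R dir \<psi>"
    by (auto simp: in_sector_iff)
  then have "z = rot a (rad *\<^sub>R dir (\<psi> - a))" by (simp add: rot_dir)
  moreover have "rad *\<^sub>R dir (\<psi> - a) \<in> sector r 0 b" unfolding in_sector_iff
    using h by (intro exI[of _ rad] exI[of _ "\<psi> - a"]) auto
  ultimately show "z \<in> rot a ` sector r 0 b" by blast
qed

lemma area_sector_rot: "area (sector r a (a + b)) = area (sector r 0 b)"
  using measure_orthogonal_image[OF orthogonal_rot lmeasurable_compact[OF compact_sector]] rot_sector by metis

lemma sector_full: "sector r 0 (2 * pi) = cball 0 r"
proof (intro equalityI subsetI)
  fix z assume "z \<in> cball (0::real^2) r"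
  then have r: "norm z \<le> r" by simp
  show "z \<in> sector r 0 (2 * pi)"
  proof (cases "z = 0")
    case True
    then show ?thesis using r unfolding in_sector_iff by (intro exI[of _ 0]) auto
  next
    case False
    then have "(z $ 1 / norm z)^2 + (z $ 2 / norm z)^2 = 1"
      by (simp add: norm_real2 power_divide flip: add_divide_distrib) (simp add: vec2_eq_iff sum_power2_eq_zero_iff)
    then obtain t where t: "0 \<le> t" "t < 2 * pi" "z $ 1 / norm z = cos t" "z $ 2 / norm z = sin t" by (rule sincos_total_2pi)
    have "z = norm z *\<^sub>R dir t" unfolding vec2_eq_iff using False by (simp flip: t(3,4))
    then show ?thesis using r t(1,2) unfolding in_sector_iff by (intro exI[of _ "norm z"] exI[of _ t]) auto
  qed
qed (auto simp: in_sector_iff)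

lemma dir_eq_iff: "dir t = dir u \<longleftrightarrow> (\<exists>i::int. t = u + of_int i * (2 * pi))"
proof
  assume "dir t = dir u"
  then have "cos t = cos u \<and> sin t = sin u" by (metis dir_nth)
  then show "\<exists>i::int. t = u + of_int i * (2 * pi)"
    using sin_cos_eq_iff[of t u] by (auto simp: Ints_def algebra_simps)
next
  assume "\<exists>i::int. t = u + of_int i * (2 * pi)"
  then obtain i :: int where "t = u + of_int (2 * i) * pi" by (auto simp: algebra_simps)
  then show "dir t = dir u" by (simp only: dir_plus_int_pi) simp
qed

text \<open>For a fixed radius the area is additive in the angle up to a full turn, hence linear,
  and the full disc fixes the constant.\<close>

lemma area_sector:
  assumes r: "0 < r" and ab: "0 \<le> b - a" "b - a \<le> 2 * pi"
  shows "area (sector r a b) = (b - a) * r^2 / 2"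
proof -
  let ?s = "\<lambda>x. area (sector r 0 x)"
  have line: "negligible {rad *\<^sub>R dir t | rad. True}" for t
    by (rule negligible_subset[OF area_hyperplane_Int[OF dir_nonzero, of UNIV "t + pi / 2" 0]]) (auto simp: inner_dir)
  have add: "?s (x + y) = ?s x + ?s y" if xy: "0 \<le> x" "0 \<le> y" "x + y \<le> 2 * pi" for x y
  proof -
    have un: "sector r 0 (x + y) = sector r 0 x \<union> sector r x (x + y)"
    proof (intro equalityI subsetI)
      fix z assume "z \<in> sector r 0 (x + y)"
      then obtain rad \<psi> where h: "0 \<le> rad" "rad \<le> r" "0 \<le> \<psi>" "\<psi> \<le> x + y" "z = rad *\<^sub>R dir \<psi>" by (auto simp: in_sector_iff)
      then show "z \<in> sector r 0 x \<union> sector r x (x + y)"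
      proof (cases "\<psi> \<le> x")
        case True
        then have "z \<in> sector r 0 x" unfolding in_sector_iff using h by blast
        then show ?thesis by simp
      next
        case False
        then have "z \<in> sector r x (x + y)" unfolding in_sector_iff using h
          by (intro exI[of _ rad] exI[of _ \<psi>]) auto
        then show ?thesis by simp
      qed
    next
      fix z assume "z \<in> sector r 0 x \<union> sector r x (x + y)"
      then show "z \<in> sector r 0 (x + y)"
        using sector_mono[of 0 0 x "x + y" r] sector_mono[of 0 x "x + y" "x + y" r] xy by auto
    qed
    \<comment> \<open>Besides the ray at angle \<open>x\<close>, the sectors share the ray at angle
      0 when \<open>x + y\<close> is a full turn.\<close>
    have "sector r 0 x \<inter> sector r x (x + y) \<subseteq> {rad *\<^sub>R dir x | rad. True} \<union> {rad *\<^sub>R dir 0 | rad. True}"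
    proof
      fix z assume "z \<in> sector r 0 x \<inter> sector r x (x + y)"
      then obtain rad \<psi> rad' \<psi>' where h: "0 \<le> rad" "0 \<le> \<psi>" "\<psi> \<le> x" "z = rad *\<^sub>R dir \<psi>" "0 \<le> rad'" "x \<le> \<psi>'" "\<psi>' \<le> x + y" "z = rad' *\<^sub>R dir \<psi>'"
        unfolding Int_iff in_sector_iff by blast
      have "norm z = rad" unfolding h(4) using h(1) by simp
      moreover have "norm z = rad'" unfolding h(8) using h(5) by simp
      ultimately have e: "rad = rad'" by simp
      show "z \<in> {rad *\<^sub>R dir x | rad. True} \<union> {rad *\<^sub>R dir 0 | rad. True}"
      proof (cases "rad = 0")
        case False
        then have "dir \<psi>' = dir \<psi>" using h e by simp
        then obtain i :: int where i: "\<psi>' = \<psi> + of_int i * (2 * pi)" unfolding dir_eq_iff by blast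
        show ?thesis
        proof (cases "\<psi> = x")
          case False
          then have "0 < of_int i * (2 * pi)" using i h(3,6) by linarith
          then have "1 \<le> i" by (simp add: zero_less_mult_iff)
          then have "2 * pi \<le> of_int i * (2 * pi)" by simp
          then have "\<psi> = 0" using i h xy by linarith
          then show ?thesis using h by auto
        qed (use h in auto)
      qed (use h in auto)
    qed
    then have "negligible (sector r 0 x \<inter> sector r x (x + y))"
      by (rule negligible_subset[rotated]) (intro negligible_Un line)
    then show ?thesis unfolding un
      using measure_Un3[OF lmeasurable_compact[OF compact_sector] lmeasurable_compact[OF compact_sector], of r 0 x r x "x + y"]
        negligible_imp_measure0 area_sector_rot[of r x y] by simp
  qed
  have "area (sector r 0 (b - a)) = (b - a) / (2 * pi) * area (sector r 0 (2 * pi))"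
  proof (rule additive_nonneg_linear[where s = ?s])
    show "?s (x + y) = ?s x + ?s y" if "0 \<le> x" "0 \<le> y" "x + y \<le> 2 * pi" for x y
      by (rule add[OF that])
  qed (use ab in simp_all)
  also have "area (sector r 0 (2 * pi)) = pi * r^2"
    unfolding sector_full using r by (simp add: measure_completion content_cball unit_ball_vol_2)
  finally have "area (sector r 0 (b - a)) = (b - a) * r^2 / 2" by simp
  then show ?thesis using area_sector_rot[of r a "b - a"] by simp
qed

section \<open>Angles measured by small discs\<close>

text \<open>Measuring angles by areas makes them additive under tilings. The area is required to be
  exact for all small radii, not only in the limit.\<close>

definition has_angle :: "(real^2) set \<Rightarrow> real^2 \<Rightarrow> real \<Rightarrow> bool" where
  "has_angle S V \<theta> \<longleftrightarrow> (\<forall>\<^sub>F r in at_right 0. area (S \<inter> cball V r) = \<theta> * r^2 / 2)"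

lemma has_angleI:
  assumes "0 < r0" "\<And>r. 0 < r \<Longrightarrow> r < r0 \<Longrightarrow> area (S \<inter> cball V r) = \<theta> * r^2 / 2"
  shows "has_angle S V \<theta>"
  unfolding has_angle_def using eventually_at_right_real[OF assms(1)]
  by eventually_elim (use assms(2) in auto)

lemma has_angle_unique:
  assumes "has_angle S V \<theta>" "has_angle S V \<theta>'"
  shows "\<theta> = \<theta>'"
proof -
  have "\<forall>\<^sub>F r in at_right (0::real). \<theta> = \<theta>'"
    using assms[unfolded has_angle_def] eventually_at_right_less[of 0]
    by eventually_elim simp
  then show ?thesis by (simp add: eventually_const trivial_limit_at_right_real)
qed

lemma has_angle_sum:
  assumes "additive_over U \<T>" "\<And>S. S \<in> \<T> \<Longrightarrow> has_angle S V (\<theta> S)"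
  shows "has_angle U V (\<Sum>S\<in>\<T>. \<theta> S)"
proof -
  have fin: "finite \<T>" using assms(1) by (simp add: additive_over_def)
  have "\<forall>\<^sub>F r in at_right 0. \<forall>S\<in>\<T>. area (S \<inter> cball V r) = \<theta> S * r^2 / 2"
    using assms(2) fin unfolding has_angle_def by (simp add: eventually_ball_finite_distrib)
  moreover have "area (U \<inter> cball V r) = (\<Sum>S\<in>\<T>. \<theta> S) * r^2 / 2"
    if "\<forall>S\<in>\<T>. area (S \<inter> cball V r) = \<theta> S * r^2 / 2" for r
  proof -
    have "area (U \<inter> cball V r) = (\<Sum>S\<in>\<T>. area (S \<inter> cball V r))"
      using assms(1) by (simp add: additive_over_def)
    also have "\<dots> = (\<Sum>S\<in>\<T>. \<theta> S * r^2 / 2)" using that by (intro sum.cong) auto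
    finally show ?thesis by (simp add: sum_distrib_right sum_divide_distrib)
  qed
  ultimately show ?thesis unfolding has_angle_def by (auto elim: eventually_mono)
qed

lemma has_angle_outside:
  assumes "closed S" "V \<notin> S"
  shows "has_angle S V 0"
proof -
  have "open (- S)" "V \<in> - S" using assms by auto
  then obtain r0 where r0: "0 < r0" "ball V r0 \<subseteq> - S" by (meson open_contains_ball)
  show ?thesis
  proof (rule has_angleI[OF r0(1)])
    fix r assume "0 < r" "r < r0"
    then have "cball V r \<subseteq> ball V r0" by auto
    then have "S \<inter> cball V r = {}" using r0(2) by blast
    then show "area (S \<inter> cball V r) = 0 * r^2 / 2" by simp
  qed
qed

lemma has_angle_interior:
  assumes "V \<in> interior S"
  shows "has_angle S V (2 * pi)"
proof -
  obtain r0 where r0: "0 < r0" "ball V r0 \<subseteq> S" using assms by (meson mem_interior)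
  show ?thesis
  proof (rule has_angleI[OF r0(1)])
    fix r assume r: "0 < r" "r < r0"
    then have "cball V r \<subseteq> ball V r0" by auto
    then have "S \<inter> cball V r = cball V r" using r0(2) by blast
    then show "area (S \<inter> cball V r) = 2 * pi * r^2 / 2"
      using r by (simp add: measure_completion content_cball unit_ball_vol_2)
  qed
qed

lemma has_angle_cone:
  assumes x: "0 < x" and y: "0 < y" and ab: "0 < b - a" "b - a < pi"
  shows "has_angle (convex hull {P, P + x *\<^sub>R dir a, P + y *\<^sub>R dir b}) P (b - a)"
proof (rule has_angleI)
  let ?S = "convex hull {P, P + x *\<^sub>R dir a, P + y *\<^sub>R dir b}"
  define del where "del = b - a"
  have sd: "0 < sin del" using ab by (auto simp: del_def intro: sin_gt_zero)
  \<comment> \<open>This bound is \<open>x y sin del / (x + y)\<close>, at most the distance from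
    \<open>P\<close> to the opposite edge, as that edge is shorter than
    \<open>x + y\<close>.\<close>
  show "0 < sin del / (1 / x + 1 / y)" using sd x y by (intro divide_pos_pos add_pos_pos) auto
  fix r assume r: "0 < r" "r < sin del / (1 / x + 1 / y)"
  have "?S \<inter> cball P r = (\<lambda>z. P + z) ` sector r a b"
  proof (intro equalityI subsetI)
    fix z assume "z \<in> ?S \<inter> cball P r"
    then have zS: "z \<in> ?S" and zr: "norm (z - P) \<le> r" by (auto simp: dist_norm norm_minus_commute)
    obtain u v w where h: "0 \<le> u" "0 \<le> v" "0 \<le> w" "u + v + w = 1"
      "z = u *\<^sub>R P + v *\<^sub>R (P + x *\<^sub>R dir a) + w *\<^sub>R (P + y *\<^sub>R dir b)"
      using zS unfolding in_triangle_iff by blast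
    define p q where "p = v * x" and "q = w * y"
    have n: "0 \<le> p" "0 \<le> q" using h x y by (auto simp: p_def q_def)
    have "z = (u + v + w) *\<^sub>R P + p *\<^sub>R dir a + q *\<^sub>R dir b"
      unfolding h(5) p_def q_def by (simp add: algebra_simps)
    then have z: "z - P = p *\<^sub>R dir a + q *\<^sub>R dir b" using h(4) by simp
    define rad where "rad = norm (z - P)"
    show "z \<in> (\<lambda>z. P + z) ` sector r a b"
    proof (cases "z = P")
      case True
      have "0 \<in> sector r a b" unfolding in_sector_iff using r ab by (intro exI[of _ 0] exI[of _ a]) auto
      then show ?thesis using True by force
    next
      case False
      then have rad0: "0 < rad" by (simp add: rad_def)
      obtain t where t: "z - P = rad *\<^sub>R dir t" unfolding rad_def using polar_form by blast
      define k where "k = \<lfloor>(t - a) / (2 * pi)\<rfloor>"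
      \<comment> \<open>Polar angle relative to \<open>a\<close>, reduced to one turn. Inner
        products with the normals of the two edges show that \<open>sin \<theta>\<close> and
        \<open>sin (del - \<theta>)\<close> are nonnegative, which confines it between 0 and
        \<open>del\<close>.\<close>
      define \<theta> where "\<theta> = t - a - of_int k * (2 * pi)"
      have "of_int k \<le> (t - a) / (2 * pi)" "(t - a) / (2 * pi) < of_int k + 1" unfolding k_def by linarith+
      then have \<theta>b: "0 \<le> \<theta>" "\<theta> < 2 * pi" by (simp_all add: \<theta>_def field_simps)
      have "dir t = dir (a + \<theta>)" unfolding dir_eq_iff by (intro exI[of _ k]) (simp add: \<theta>_def)
      then have zt: "z - P = rad *\<^sub>R dir (a + \<theta>)" using t by simp
      have "(z - P) \<bullet> dir (a + pi / 2) = rad * sin \<theta>" unfolding zt by (simp add: inner_dir cos_diff)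
      moreover have "(z - P) \<bullet> dir (a + pi / 2) = q * sin del"
      proof -
        have "b - (a + pi / 2) = del - pi / 2" by (simp add: del_def)
        then have "dir b \<bullet> dir (a + pi / 2) = sin del" by (simp only: inner_dir) (simp add: cos_diff)
        moreover have "dir a \<bullet> dir (a + pi / 2) = 0" by (simp add: inner_dir)
        ultimately show ?thesis unfolding z inner_add_left inner_scaleR_left by simp
      qed
      ultimately have s1: "rad * sin \<theta> = q * sin del" by simp
      have "(z - P) \<bullet> dir (b - pi / 2) = rad * sin (del - \<theta>)"
      proof -
        have "a + \<theta> - (b - pi / 2) = pi / 2 - (del - \<theta>)" by (simp add: del_def)
        then show ?thesis unfolding zt inner_scaleR_left by (simp only: inner_dir) (simp add: cos_diff[of "pi / 2"])
      qed
      moreover have "(z - P) \<bullet> dir (b - pi / 2) = p * sin del"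
      proof -
        have "a - (b - pi / 2) = pi / 2 - del" by (simp add: del_def)
        then have "dir a \<bullet> dir (b - pi / 2) = sin del" by (simp only: inner_dir) (simp add: cos_diff)
        moreover have "dir b \<bullet> dir (b - pi / 2) = 0" by (simp add: inner_dir)
        ultimately show ?thesis unfolding z inner_add_left inner_scaleR_left by simp
      qed
      ultimately have s2: "rad * sin (del - \<theta>) = p * sin del" by simp
      have "0 \<le> rad * sin \<theta>" "0 \<le> rad * sin (del - \<theta>)" unfolding s1 s2 using n sd by simp_all
      then have pos: "0 \<le> sin \<theta>" "0 \<le> sin (del - \<theta>)" using rad0 by (simp_all add: zero_le_mult_iff)
      have "\<theta> \<le> pi"
      proof (rule ccontr)
        assume "\<not> \<theta> \<le> pi"
        then have "sin \<theta> < 0" using \<theta>b by (intro sin_lt_zero) auto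
        then show False using pos by simp
      qed
      have "\<theta> \<le> del"
      proof (rule ccontr)
        assume "\<not> \<theta> \<le> del"
        then have "0 < sin (\<theta> - del)" using \<open>\<theta> \<le> pi\<close> ab by (intro sin_gt_zero) (auto simp: del_def)
        moreover have "sin (del - \<theta>) = - sin (\<theta> - del)" by (simp flip: sin_minus)
        ultimately show False using pos by simp
      qed
      then have "z - P \<in> sector r a b" unfolding in_sector_iff
        using zt zr rad0 \<theta>b by (intro exI[of _ rad] exI[of _ "a + \<theta>"]) (auto simp: rad_def del_def)
      then show ?thesis by (intro image_eqI[of _ _ "z - P"]) auto
    qed
  next
    fix z assume "z \<in> (\<lambda>z. P + z) ` sector r a b"
    then obtain rad \<psi> where h: "0 \<le> rad" "rad \<le> r" "a \<le> \<psi>" "\<psi> \<le> b" "z = P + rad *\<^sub>R dir \<psi>"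
      by (auto simp: in_sector_iff)
    \<comment> \<open>Cramer's rule for \<open>dir \<psi>\<close> in the basis \<open>dir a\<close>,
      \<open>dir b\<close>.\<close>
    have d: "sin del *\<^sub>R dir \<psi> = sin (b - \<psi>) *\<^sub>R dir a + sin (\<psi> - a) *\<^sub>R dir b"
    proof -
      have 1: "sin (b - a) * cos \<psi> = sin (b - \<psi>) * cos a + sin (\<psi> - a) * cos b"
        unfolding sin_diff by (simp add: algebra_simps)
      have 2: "sin (b - a) * sin \<psi> = sin (b - \<psi>) * sin a + sin (\<psi> - a) * sin b"
        unfolding sin_diff by (simp add: algebra_simps)
      show ?thesis using 1 2 by (simp add: vec2_eq_iff del_def)
    qed
    define v w where "v = rad * sin (b - \<psi>) / (x * sin del)" and "w = rad * sin (\<psi> - a) / (y * sin del)"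
    have "0 \<le> sin (b - \<psi>)" "0 \<le> sin (\<psi> - a)" using h ab by (auto intro!: sin_ge_zero)
    then have v0: "0 \<le> v" and w0: "0 \<le> w" using h sd x y by (auto simp: v_def w_def)
    have "v \<le> r * (1 / x) / sin del"
    proof -
      have "rad * sin (b - \<psi>) \<le> r * 1" using h r \<open>0 \<le> sin (b - \<psi>)\<close> by (intro mult_mono) auto
      then show ?thesis using x sd by (simp add: v_def field_simps)
    qed
    moreover have "w \<le> r * (1 / y) / sin del"
    proof -
      have "rad * sin (\<psi> - a) \<le> r * 1" using h r \<open>0 \<le> sin (\<psi> - a)\<close> by (intro mult_mono) auto
      then show ?thesis using y sd by (simp add: w_def field_simps)
    qed
    ultimately have "v + w \<le> r * (1 / x + 1 / y) / sin del" by (simp add: distrib_left add_divide_distrib)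
    also have "\<dots> \<le> 1"
    proof -
      have "0 < 1 / x + 1 / y" using x y by (intro add_pos_pos) auto
      then have "r * (1 / x + 1 / y) < sin del" using r(2) by (simp add: pos_less_divide_eq)
      then show ?thesis using sd by simp
    qed
    finally have vw: "v + w \<le> 1" .
    have "rad *\<^sub>R dir \<psi> = (rad / sin del) *\<^sub>R (sin del *\<^sub>R dir \<psi>)" using sd by simp
    also have "\<dots> = (v * x) *\<^sub>R dir a + (w * y) *\<^sub>R dir b"
      unfolding d v_def w_def using x y by (simp add: scaleR_add_right)
    finally have "z = (1 - v - w) *\<^sub>R P + v *\<^sub>R (P + x *\<^sub>R dir a) + w *\<^sub>R (P + y *\<^sub>R dir b)"
      unfolding h(5) by (simp add: algebra_simps)
    then have "z \<in> ?S" unfolding in_triangle_iff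
      by (intro exI[of _ "1 - v - w"] exI[of _ v] exI[of _ w]) (use v0 w0 vw in auto)
    moreover have "z \<in> cball P r" using h by (simp add: dist_norm)
    ultimately show "z \<in> ?S \<inter> cball P r" by simp
  qed
  then show "area (?S \<inter> cball P r) = (b - a) * r^2 / 2"
    using area_sector[OF r(1), of b a] ab by (simp add: measure_translation)
qed

lemma has_angle_vertex:
  assumes "is_tri e f g P Q R"
  shows "has_angle (tri P Q R) P (ang e f g)"
proof -
  have ts: "tri_sides e f g" by (rule is_tri_sides[OF assms])
  then have pos: "0 < f" "0 < g" by (auto simp: tri_sides_def)
  obtain a sg where h: "sg = 1 \<or> sg = - 1" "Q = P + g *\<^sub>R dir a" "R = P + f *\<^sub>R dir (a + sg * ang e f g)"
    using canonical_form[OF assms] by blast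
  show ?thesis
  proof (cases "sg = 1")
    case True
    then show ?thesis using has_angle_cone[of g f "a + ang e f g" a P] pos ang_bounds[OF ts] h by simp
  next
    case False
    then have "sg = - 1" using h by simp
    then have "has_angle (tri P R Q) P (ang e f g)"
      using has_angle_cone[of f g a "a - ang e f g" P] pos ang_bounds[OF ts] h by simp
    then show ?thesis by (simp add: insert_commute)
  qed
qed

lemma ang_inner:
  assumes "V \<noteq> P" "V \<noteq> Q"
  shows "ang (dist P Q) (dist V Q) (dist V P) = arccos ((P - V) \<bullet> (Q - V) / (norm (P - V) * norm (Q - V)))"
proof -
  have "(dist P Q)^2 = (norm ((P - V) - (Q - V)))^2" by (simp add: dist_norm)
  also have "\<dots> = (norm (P - V))^2 + (norm (Q - V))^2 - 2 * ((P - V) \<bullet> (Q - V))"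
    by (simp only: power2_norm_eq_inner inner_diff_left[of "P - V" "Q - V"] inner_diff_right[of _ "P - V" "Q - V"])
      (simp add: inner_commute)
  finally have "(dist V Q)^2 + (dist V P)^2 - (dist P Q)^2 = 2 * ((P - V) \<bullet> (Q - V))"
    by (simp add: dist_norm norm_minus_commute)
  then show ?thesis unfolding ang_def by (simp add: dist_norm norm_minus_commute mult.commute)
qed

text \<open>The segment from \<open>V\<close> to \<open>Q\<close> cuts the triangle into two whose
  angles at \<open>V\<close> have opposite cosines and so add up to \<open>pi\<close>.\<close>

lemma has_angle_edge:
  assumes nc: "\<not> collinear {P, Q, R}" and l: "0 < l" "l < 1" and V: "V = (1 - l) *\<^sub>R P + l *\<^sub>R R"
  shows "has_angle (tri P Q R) V pi"
proof -
  have PR: "P \<noteq> R" using nc by (auto simp: insert_commute)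
  have VP: "P - V = (- l) *\<^sub>R (R - P)" and VR: "R - V = (1 - l) *\<^sub>R (R - P)" unfolding V by (simp_all add: algebra_simps)
  have ne: "V \<noteq> P" "V \<noteq> R" using VP VR l PR by auto
  have colV: "collinear {P, V, R}"
    unfolding collinear_alt by (intro exI[of _ P] exI[of _ "R - P"]) (use VP in \<open>auto simp: algebra_simps V intro: exI[of _ 0] exI[of _ 1] exI[of _ l]\<close>)
  have nc1: "\<not> collinear {V, P, Q}"
  proof
    assume "collinear {V, P, Q}"
    then have "collinear {Q, P, V}" "collinear {P, V, R}" using colV by (simp_all add: insert_commute)
    then have "collinear {Q, P, R}" using ne collinear_3_trans by metis
    then show False using nc by (simp add: insert_commute)
  qed
  have nc2: "\<not> collinear {V, R, Q}"
  proof
    assume "collinear {V, R, Q}"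
    then have "collinear {Q, R, V}" "collinear {R, V, P}" using colV by (simp_all add: insert_commute)
    then have "collinear {Q, R, P}" using ne collinear_3_trans by metis
    then show False using nc by (simp add: insert_commute)
  qed
  have VQ: "V \<noteq> Q" using nc1 by (auto simp: insert_commute)
  define x where "x = (R - P) \<bullet> (Q - V) / (norm (R - P) * norm (Q - V))"
  have "\<bar>x\<bar> \<le> 1"
    using Cauchy_Schwarz_ineq2[of "R - P" "Q - V"] by (auto simp: x_def abs_mult divide_le_eq_1)
  have a1: "ang (dist P Q) (dist V Q) (dist V P) = arccos (- x)"

  proof -
    have "((- l) *\<^sub>R d) \<bullet> e / (norm ((- l) *\<^sub>R d) * norm e) = - (d \<bullet> e / (norm d * norm e))" for d e :: "real^2"
      using l by simp
    then show ?thesis unfolding ang_inner[OF ne(1) VQ] VP x_def by (rule arg_cong)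
  qed
  have a2: "ang (dist R Q) (dist V Q) (dist V R) = arccos x"
    unfolding ang_inner[OF ne(2) VQ] VR x_def using l by simp
  have "has_angle (tri V P Q) V (arccos (- x))"
    unfolding a1[symmetric] using nc1 by (intro has_angle_vertex) (simp add: is_tri_def)
  then have A: "has_angle (tri P Q V) V (arccos (- x))" by (simp add: insert_commute)
  have "has_angle (tri V R Q) V (arccos x)"
    unfolding a2[symmetric] using nc2 by (intro has_angle_vertex) (simp add: is_tri_def)
  then have B: "has_angle (tri R Q V) V (arccos x)" by (simp add: insert_commute)
  have "arccos (- x) + arccos x = pi" using \<open>\<bar>x\<bar> \<le> 1\<close> by (simp add: arccos_minus)
  then have p: "pi * r^2 / 2 = arccos (- x) * r^2 / 2 + arccos x * r^2 / 2" for r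
    by (metis add_divide_distrib distrib_right)
  show ?thesis
    using A B unfolding has_angle_def
    by eventually_elim (simp only: split_triangle_additive[OF nc l V closed_cball] p)
qed

lemma triangle_point_cases:
  assumes nc: "\<not> collinear {P, Q, R}" and V: "V \<in> tri P Q R"
  shows "V \<in> {P, Q, R} \<or> has_angle (tri P Q R) V pi \<or> has_angle (tri P Q R) V (2 * pi)"
proof -
  obtain u v w where h: "0 \<le> u" "0 \<le> v" "0 \<le> w" "u + v + w = 1" "V = u *\<^sub>R P + v *\<^sub>R Q + w *\<^sub>R R"
    using V unfolding in_triangle_iff by blast
  have nc': "\<not> collinear {Q, P, R}" "\<not> collinear {P, R, Q}" using nc by (simp_all add: insert_commute)
  consider "0 < u" "0 < v" "0 < w" | "u = 0" "0 < v" "0 < w" | "v = 0" "0 < u" "0 < w" | "w = 0" "0 < u" "0 < v"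
    | "u = 0" "v = 0" | "u = 0" "w = 0" | "v = 0" "w = 0" using h(1-3) by linarith
  then show ?thesis
  proof cases
    case 1
    then have "V \<in> interior (tri P Q R)"
      using interior_convex_hull_3_minimal[OF nc] h by auto
    then show ?thesis using has_angle_interior by blast
  next
    case 2
    have v: "v = 1 - w" using h 2 by simp
    have "V = (1 - w) *\<^sub>R Q + w *\<^sub>R R" unfolding h(5) 2(1) v by simp
    then have "has_angle (tri Q P R) V pi" using 2 v by (intro has_angle_edge[OF nc'(1), of w]) auto
    then show ?thesis by (simp add: insert_commute)
  next
    case 3
    have u: "u = 1 - w" using h 3 by simp
    have "V = (1 - w) *\<^sub>R P + w *\<^sub>R R" unfolding h(5) 3(1) u by simp
    then have "has_angle (tri P Q R) V pi" using 3 u by (intro has_angle_edge[OF nc, of w]) auto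
    then show ?thesis by simp
  next
    case 4
    have u: "u = 1 - v" using h 4 by simp
    have "V = (1 - v) *\<^sub>R P + v *\<^sub>R Q" unfolding h(5) 4(1) u by simp
    then have "has_angle (tri P R Q) V pi" using 4 u by (intro has_angle_edge[OF nc'(2), of v]) auto
    then show ?thesis by (simp add: insert_commute)
  qed (use h in auto)
qed

section \<open>Self-similar tilings\<close>

text \<open>The vertices \<open>P S, Q S, R S\<close> of a tile \<open>S\<close> and \<open>A, B, C\<close> of the big triangle lie opposite to the sides
  \<open>e, f, g\<close> and \<open>s e, s f, s g\<close>.\<close>

locale self_tiling =
  fixes s e f g :: real and \<T> :: "(real^2) set set" and P Q R :: "(real^2) set \<Rightarrow> real^2" and A B C :: "real^2"
  assumes s_pos: "0 < s"
    and additive: "additive_over (tri A B C) \<T>"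
    and cover: "\<Union>\<T> = tri A B C"
    and tile: "\<And>S. S \<in> \<T> \<Longrightarrow> is_tri e f g (P S) (Q S) (R S)" "\<And>S. S \<in> \<T> \<Longrightarrow> S = tri (P S) (Q S) (R S)"
    and big: "is_tri (s * e) (s * f) (s * g) A B C"
begin

abbreviation "E \<equiv> ang e f g"
abbreviation "F \<equiv> ang f e g"
abbreviation "G \<equiv> ang g e f"

text \<open>Together with \<open>swap23\<close> this generates all relabellings, so what is proved
  for the corner \<open>A\<close> and the side \<open>BC\<close> transfers to the others.\<close>

lemma swap12: "self_tiling s f e g \<T> Q P R B A C"
proof
  show "additive_over (tri B A C) \<T>" "\<Union>\<T> = tri B A C"
    using additive cover by (simp_all add: insert_commute)
  show "is_tri (s * f) (s * e) (s * g) B A C" using is_tri_permute(1)[OF big] .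
  fix S assume S: "S \<in> \<T>"
  show "is_tri f e g (Q S) (P S) (R S)" using is_tri_permute(1)[OF tile(1)[OF S]] .
  show "S = tri (Q S) (P S) (R S)" using tile(2)[OF S] triangle_permute(1) by metis
qed (rule s_pos)

lemma swap23: "self_tiling s e g f \<T> P R Q A C B"
proof
  show "additive_over (tri A C B) \<T>" "\<Union>\<T> = tri A C B"
    using additive cover by (simp_all add: insert_commute)
  show "is_tri (s * e) (s * g) (s * f) A C B" using is_tri_permute(2)[OF big] .
  fix S assume S: "S \<in> \<T>"
  show "is_tri e g f (P S) (R S) (Q S)" using is_tri_permute(2)[OF tile(1)[OF S]] .
  show "S = tri (P S) (R S) (Q S)" using tile(2)[OF S] triangle_permute(2) by metis
qed (rule s_pos)

lemma rotate: "self_tiling s g e f \<T> R P Q C A B"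
  by (rule self_tiling.swap12[OF swap23])

lemma fin: "finite \<T>" using additive by (simp add: additive_over_def)

lemma nc_big: "\<not> collinear {A, B, C}" using big by (simp add: is_tri_def)

lemma nc_tile: "S \<in> \<T> \<Longrightarrow> \<not> collinear {P S, Q S, R S}" using tile(1) by (simp add: is_tri_def)

lemma tile_subset: "S \<in> \<T> \<Longrightarrow> S \<subseteq> tri A B C" using cover by blast

lemma tile_ex: "S \<in> \<T> \<Longrightarrow> \<exists>P Q R. is_tri e f g P Q R \<and> S = tri P Q R" using tile by blast

lemma distinct_vertices: "S \<in> \<T> \<Longrightarrow> P S \<noteq> Q S \<and> P S \<noteq> R S \<and> Q S \<noteq> R S"
  using nc_tile[of S] by (auto simp: insert_commute)

lemma tri_efg: "tri_sides e f g"
proof -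
  have "tri_sides (s * e) (s * f) (s * g)" by (rule is_tri_sides[OF big])
  then have "0 < s * e" "0 < s * f" "0 < s * g" "s * e < s * (f + g)" "s * f < s * (g + e)" "s * g < s * (e + f)"
    by (simp_all add: tri_sides_def distrib_left)
  then show ?thesis using s_pos by (simp add: tri_sides_def zero_less_mult_iff)
qed

lemma side_combination: "\<exists>n1 n2 n3. s * e = real n1 * e + real n2 * f + real n3 * g"
proof -
  obtain t where t: "level t B = level t C" "level t A < level t C" using outward_normal[OF nc_big] by blast
  have "dist B C = s * e" using big by (simp add: is_tri_def)
  then show ?thesis using side_decomposition(1)[OF additive tile_subset tile_ex nc_big refl t] by simp
qed

section \<open>Tile angles meeting at a point\<close>

definition at_vertex :: "((real^2) set \<Rightarrow> real^2) \<Rightarrow> real^2 \<Rightarrow> nat" where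
  "at_vertex X V = card {S \<in> \<T>. X S = V}"

lemma sum_at_vertex: "(\<Sum>S\<in>\<T>. if X S = V then c else 0) = real (at_vertex X V) * c"
proof -
  have "(\<Sum>S\<in>\<T>. if X S = V then c else 0) = (\<Sum>S\<in>{S \<in> \<T>. X S = V}. c)"
    using fin by (simp only: sum.inter_filter)
  then show ?thesis by (simp add: at_vertex_def)
qed

text \<open>\<open>n\<close> collects the tiles that contain \<open>V\<close> other than as a
  vertex, each with angle \<open>pi\<close> or \<open>2 pi\<close>. An extreme point of the big
  triangle is extreme in every tile containing it, hence a vertex of that tile.\<close>

lemma angle_equation:
  assumes "has_angle (tri A B C) V \<theta>"
  obtains n :: nat where "\<theta> = at_vertex P V * E + at_vertex Q V * F + at_vertex R V * G + n * pi"
    "V extreme_point_of (tri A B C) \<Longrightarrow> n = 0"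
proof -
  let ?v = "\<lambda>S. (if P S = V then E else 0) + (if Q S = V then F else 0) + (if R S = V then G else 0)"
  have ex: "\<exists>m::nat. has_angle S V (?v S + m * pi) \<and> (V extreme_point_of (tri A B C) \<longrightarrow> m = 0)"
    if S: "S \<in> \<T>" for S
  proof -
    have S': "S = tri (P S) (Q S) (R S)" by (rule tile(2)[OF S])
    note t = tile(1)[OF S]
    show ?thesis
    proof (cases "V \<in> {P S, Q S, R S}")
      case True
      have "has_angle S (P S) E" "has_angle S (Q S) F" "has_angle S (R S) G"
        using has_angle_vertex[OF t] has_angle_vertex[OF is_tri_permute(1)[OF t]] has_angle_vertex[OF is_tri_permute(3)[OF t]]
          S' triangle_permute by metis+
      then show ?thesis using True distinct_vertices[OF S] by (intro exI[of _ 0]) auto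
    next
      case False
      then have z: "?v S = 0" by auto
      show ?thesis
      proof (cases "V \<in> S")
        case True
        have a: "has_angle S V pi \<or> has_angle S V (2 * pi)"
          using triangle_point_cases[OF nc_tile[OF S], of V] True False S' by auto
        have "\<not> V extreme_point_of (tri A B C)"
        proof
          assume "V extreme_point_of (tri A B C)"
          then have "V extreme_point_of S" using tile_subset[OF S] True by (auto simp: extreme_point_of_def)
          then have "V \<in> {P S, Q S, R S}" using S' extreme_point_of_convex_hull by metis
          then show False using False by simp
        qed
        then show ?thesis using a z
          by (elim disjE) (intro exI[of _ 1] exI[of _ 2], simp; intro exI[of _ 1] exI[of _ 2]; simp)+
      next
        case False
        moreover have "closed S" using S' compact_triangle compact_imp_closed by metis
        ultimately show ?thesis using has_angle_outside[of S V] z by (intro exI[of _ 0]) auto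
      qed
    qed
  qed
  then have "\<forall>S\<in>\<T>. \<exists>m::nat. has_angle S V (?v S + m * pi) \<and> (V extreme_point_of (tri A B C) \<longrightarrow> m = 0)" by blast
  from bchoice[OF this] obtain m :: "(real^2) set \<Rightarrow> nat" where
    "\<forall>S\<in>\<T>. has_angle S V (?v S + m S * pi) \<and> (V extreme_point_of (tri A B C) \<longrightarrow> real (m S) = 0)" by (elim exE)
  then have m: "\<And>S. S \<in> \<T> \<Longrightarrow> has_angle S V (?v S + m S * pi)"
    "\<And>S. S \<in> \<T> \<Longrightarrow> V extreme_point_of (tri A B C) \<Longrightarrow> m S = 0" by simp_all
  have "has_angle (tri A B C) V (\<Sum>S\<in>\<T>. ?v S + m S * pi)"
    by (rule has_angle_sum[OF additive m(1)])
  then have "\<theta> = (\<Sum>S\<in>\<T>. ?v S + m S * pi)" using assms has_angle_unique by blast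
  also have "\<dots> = at_vertex P V * E + at_vertex Q V * F + at_vertex R V * G + (\<Sum>S\<in>\<T>. m S) * pi"
    by (simp add: sum.distrib sum_at_vertex sum_distrib_right)
  finally have 1: "\<theta> = at_vertex P V * E + at_vertex Q V * F + at_vertex R V * G + (\<Sum>S\<in>\<T>. m S) * pi" .
  have 2: "(\<Sum>S\<in>\<T>. m S) = 0" if "V extreme_point_of (tri A B C)"
    using m(2)[OF _ that] by simp
  show ?thesis by (rule that[OF 1 2])
qed

lemma corner_extreme: "A extreme_point_of (tri A B C)"
proof -
  have "\<not> affine_dependent {A, B, C}" using nc_big collinear_3_eq_affine_dependent by blast
  then show ?thesis by (simp add: extreme_point_of_convex_hull_affine_independent)
qed

lemma corner_angles: "at_vertex P A * E + at_vertex Q A * F + at_vertex R A * G = E"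
proof -
  have "ang (s * e) (s * f) (s * g) = E" by (rule ang_scale[OF s_pos])
  then have "has_angle (tri A B C) A E" using has_angle_vertex[OF big] by simp
  then show ?thesis using angle_equation corner_extreme by (metis add.right_neutral mult_zero_left of_nat_0)
qed

lemma corner_tile_vertex:
  assumes "S \<in> \<T>" "A \<in> S"
  shows "A \<in> {P S, Q S, R S}"
proof -
  have "A extreme_point_of S" using tile_subset[OF assms(1)] assms(2) corner_extreme by (auto simp: extreme_point_of_def)
  then show ?thesis using tile(2)[OF assms(1)] extreme_point_of_convex_hull by metis
qed

text \<open>Near \<open>A\<close> the big triangle consists of \<open>S0\<close> alone, so both
  sides at \<open>A\<close> carry an edge of \<open>S0\<close>. These edges differ because only
  \<open>A\<close> lies on both sides.\<close>

lemma single_corner_tile: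
  assumes S0: "S0 \<in> \<T>" "S0 = tri A X Y" and ncS: "\<not> collinear {A, X, Y}"
    and only: "\<And>S. S \<in> \<T> \<Longrightarrow> A \<in> S \<Longrightarrow> S = S0"
  shows "fits e f g (s * f) (dist A X) \<and> fits e f g (s * g) (dist A Y) \<or>
    fits e f g (s * f) (dist A Y) \<and> fits e f g (s * g) (dist A X)"
proof -
  let ?U = "tri A B C"
  let ?K = "\<Union>(\<T> - {S0})"
  have "closed S" if "S \<in> \<T>" for S using tile(2)[OF that] compact_triangle compact_imp_closed by metis
  then have "closed ?K" using fin by (intro closed_Union) auto
  moreover have "A \<notin> ?K" using only by blast
  ultimately obtain r where r: "0 < r" "ball A r \<subseteq> - ?K" by (meson ComplI open_Compl open_contains_ball)
  have near: "\<exists>d>0. A + d *\<^sub>R (Z - A) \<in> S0" if "Z \<in> ?U" "Z \<noteq> A" for Z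
  proof -
    define d where "d = min 1 (r / 2 / norm (Z - A))"
    have d: "0 < d" "d \<le> 1" using r that by (auto simp: d_def)
    have "d * norm (Z - A) \<le> r / 2" using that by (simp add: d_def min_def field_simps)
    then have "A + d *\<^sub>R (Z - A) \<in> ball A r" using r d by (simp add: dist_norm)
    moreover have "A + d *\<^sub>R (Z - A) \<in> ?U"
    proof -
      have "A \<in> ?U" by (auto intro: hull_inc)
      then have "(1 - d) *\<^sub>R A + d *\<^sub>R Z \<in> ?U" using that(1) d convexD[OF convex_convex_hull, of A _ Z "1 - d" d] by auto
      then show ?thesis by (simp add: algebra_simps)
    qed
    ultimately have "A + d *\<^sub>R (Z - A) \<in> S0" using cover r(2) by blast
    then show ?thesis using d by blast
  qed
  \<comment> \<open>If neither \<open>X\<close> nor \<open>Y\<close> lay on this supporting line,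
    \<open>S0\<close> would meet it in \<open>A\<close> only; yet it contains points of the side
    \<open>AZ\<close> other than \<open>A\<close>.\<close>
  have side: "level t X = level t A \<or> level t Y = level t A"
    if Z: "Z \<in> {B, C}" and t: "level t Z = level t A" and le: "\<And>z. z \<in> ?U \<Longrightarrow> level t z \<le> level t A" for Z t
  proof (rule ccontr)
    assume n: "\<not> ?thesis"
    have "X \<in> ?U" "Y \<in> ?U" using tile_subset[OF S0(1)] S0(2) hull_inc[of _ "{A, X, Y}" convex] by blast+
    then have lt: "level t X < level t A" "level t Y < level t A" using n le by force+
    have "Z \<in> ?U" using Z by (auto intro: hull_inc)
    moreover have ZA: "Z \<noteq> A" using Z nc_big by (auto simp: insert_commute)
    ultimately obtain d where d: "0 < d" "A + d *\<^sub>R (Z - A) \<in> S0" using near by blast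
    obtain u v w where h: "0 \<le> u" "0 \<le> v" "0 \<le> w" "u + v + w = 1" "A + d *\<^sub>R (Z - A) = u *\<^sub>R A + v *\<^sub>R X + w *\<^sub>R Y"
      using d(2) unfolding S0(2) in_triangle_iff by blast
    have "(A + d *\<^sub>R (Z - A)) \<bullet> dir t = level t A" using t by (simp add: inner_add_left inner_diff_left)
    then have "u * (level t A) + v * (level t X) + w * (level t Y) = (u + v + w) * (level t A)"
      unfolding h(5) using h(4) by (simp add: inner_add_left)
    then have z: "v * (level t A - level t X) + w * (level t A - level t Y) = 0" by (simp add: algebra_simps)
    have "0 \<le> v * (level t A - level t X)" "0 \<le> w * (level t A - level t Y)" using h lt by auto
    then have "v * (level t A - level t X) = 0" "w * (level t A - level t Y) = 0" using z by linarith+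
    then have "v = 0" "w = 0" using lt by auto
    then have "d *\<^sub>R (Z - A) = 0" using h(4,5) by simp
    then show False using d ZA by simp
  qed
  have nc1: "\<not> collinear {C, A, B}" "\<not> collinear {B, A, C}" using nc_big by (simp_all add: insert_commute)
  obtain t1 where t1: "level t1 A = level t1 B" "level t1 C < level t1 B" using outward_normal[OF nc1(1)] by blast
  obtain t2 where t2: "level t2 A = level t2 C" "level t2 B < level t2 C" using outward_normal[OF nc1(2)] by blast
  have le1: "level t1 z \<le> level t1 A" if "z \<in> ?U" for z
    using triangle_inner_le[OF that, of "dir t1" "level t1 A"] t1 by simp
  have le2: "level t2 z \<le> level t2 A" if "z \<in> ?U" for z
    using triangle_inner_le[OF that, of "dir t2" "level t2 A"] t2 by simp
  have XY1: "level t1 X = level t1 A \<or> level t1 Y = level t1 A" using side[of B t1] t1 le1 by simp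
  have XY2: "level t2 X = level t2 A \<or> level t2 Y = level t2 A" using side[of C t2] t2 le2 by simp
  have notboth: "Z = A" if Z: "Z \<in> ?U" "level t1 Z = level t1 A" "level t2 Z = level t2 A" for Z
  proof -
    obtain u v w where h: "0 \<le> u" "0 \<le> v" "0 \<le> w" "u + v + w = 1" "Z = u *\<^sub>R A + v *\<^sub>R B + w *\<^sub>R C"
      using Z(1) unfolding in_triangle_iff by blast
    have lev: "level t Z = u * (level t A) + v * (level t B) + w * (level t C)" for t
      unfolding h(5) inner_add_left inner_scaleR_left ..
    have zero: "x * (c - a) = 0" if "u + y + x = 1" "u * a + y * a + x * c = a" for a c x y :: real
    proof -
      have "x * (c - a) = (u * a + y * a + x * c) - (u + y + x) * a" by (simp add: algebra_simps)
      then show ?thesis unfolding that by simp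
    qed
    have "w * (level t1 C - level t1 A) = 0"
      by (rule zero[OF h(4)]) (use Z(2) lev[of t1] t1(1) in simp)
    then have w: "w = 0" using t1 by simp
    have "v * (level t2 B - level t2 A) = 0"
      by (rule zero[of w]) (use h(4) Z(3) lev[of t2] t2(1) in simp_all)
    then have "v = 0" using t2 by simp
    then show ?thesis using h w by simp
  qed
  have inU: "X \<in> ?U" "Y \<in> ?U" using tile_subset[OF S0(1)] S0(2) hull_inc[of _ "{A, X, Y}" convex] by blast+
  have ne: "X \<noteq> A" "Y \<noteq> A" using ncS by (auto simp: insert_commute)
  have U': "?U = tri C A B" "?U = tri B A C" by (simp_all add: insert_commute)
  have d: "dist A B = s * g" "dist A C = s * f" using big by (auto simp: is_tri_def)
  have S0': "S0 = tri A Y X" "\<not> collinear {A, Y, X}" using S0 ncS by (simp_all add: insert_commute)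
  have fitB: "fits e f g (s * g) (dist X' Y')"
    if "S0 = tri X' Y' Z'" "\<not> collinear {X', Y', Z'}" "level t1 X' = level t1 B" "level t1 Y' = level t1 B" for X' Y' Z'
    by (rule side_decomposition(2)[OF additive tile_subset tile_ex nc1(1) U'(1) t1 S0(1) that, unfolded d])
  have fitC: "fits e f g (s * f) (dist X' Y')"
    if "S0 = tri X' Y' Z'" "\<not> collinear {X', Y', Z'}" "level t2 X' = level t2 C" "level t2 Y' = level t2 C" for X' Y' Z'
    by (rule side_decomposition(2)[OF additive tile_subset tile_ex nc1(2) U'(2) t2 S0(1) that, unfolded d])
  show ?thesis
  proof (cases "level t1 X = level t1 A")
    case True
    then have "level t2 X \<noteq> level t2 A" using notboth[OF inU(1)] ne by blast
    then have "level t2 Y = level t2 A" using XY2 by blast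
    then show ?thesis using True fitB[OF S0(2) ncS] fitC[OF S0'] t1(1) t2(1) by simp
  next
    case False
    then have 1: "level t1 Y = level t1 A" using XY1 by blast
    then have "level t2 Y \<noteq> level t2 A" using notboth[OF inU(2)] ne by blast
    then have "level t2 X = level t2 A" using XY2 by blast
    then show ?thesis using 1 fitB[OF S0'] fitC[OF S0(2) ncS] t1(1) t2(1) by simp
  qed
qed

lemma corner: "corner_ok s e f g (at_vertex P A) (at_vertex Q A) (at_vertex R A)"
  unfolding corner_ok_def
proof (intro conjI impI)
  show "at_vertex P A * E + at_vertex Q A * F + at_vertex R A * G = E" by (rule corner_angles)
  assume one: "at_vertex P A + at_vertex Q A + at_vertex R A = 1"
  have finc: "finite {S \<in> \<T>. X S = A}" for X :: "(real^2) set \<Rightarrow> real^2" using fin by simp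
  have empty: "{S \<in> \<T>. X S = A} = {}" if "at_vertex X A = 0" for X using that finc[of X] by (simp add: at_vertex_def)
  have single: "\<exists>S0. {S \<in> \<T>. X S = A} = {S0}" if "at_vertex X A = 1" for X
    using that by (simp add: at_vertex_def card_1_singleton_iff)
  have concl: "\<exists>l1 l2. {l1, l2} = {x, y} \<and> fits e f g (s * f) l1 \<and> fits e f g (s * g) l2"
    if X: "at_vertex X A = 1" and others: "at_vertex Y A = 0" "at_vertex Z A = 0"
      and perm: "\<And>S. {X S, Y S, Z S} = {P S, Q S, R S}"
      and xy: "\<And>S. S \<in> \<T> \<Longrightarrow> dist (X S) (Y S) = x" "\<And>S. S \<in> \<T> \<Longrightarrow> dist (X S) (Z S) = y" for X Y Z x y
  proof -
    obtain S0 where S0: "{S \<in> \<T>. X S = A} = {S0}" using single[OF X] by blast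
    then have m: "S0 \<in> \<T>" "X S0 = A" by auto
    have only: "S = S0" if "S \<in> \<T>" "A \<in> S" for S
      using corner_tile_vertex[OF that] that(1) S0 empty[OF others(1)] empty[OF others(2)] unfolding perm[symmetric] by blast
    have "S0 = tri A (Y S0) (Z S0)" "\<not> collinear {A, Y S0, Z S0}"
      using tile(2)[OF m(1)] nc_tile[OF m(1)] unfolding perm[symmetric] m(2) .
    from single_corner_tile[OF m(1) this only] have "fits e f g (s * f) x \<and> fits e f g (s * g) y \<or> fits e f g (s * f) y \<and> fits e f g (s * g) x"
      using xy[OF m(1)] m(2) by simp
    then show ?thesis by (metis insert_commute)
  qed
  note d = tile(1)[unfolded is_tri_def]
  consider "at_vertex P A = 1" "at_vertex Q A = 0" "at_vertex R A = 0" | "at_vertex P A = 0" "at_vertex Q A = 1" "at_vertex R A = 0"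
    | "at_vertex P A = 0" "at_vertex Q A = 0" "at_vertex R A = 1" using one by linarith
  then show "\<exists>l1 l2. (at_vertex P A = 1 \<and> {l1, l2} = {f, g} \<or> at_vertex Q A = 1 \<and> {l1, l2} = {e, g} \<or>
      at_vertex R A = 1 \<and> {l1, l2} = {e, f}) \<and> fits e f g (s * f) l1 \<and> fits e f g (s * g) l2"
  proof cases
    case 1
    then show ?thesis using concl[of P R Q f g] d by auto
  next
    case 2
    then show ?thesis using concl[of Q R P e g] d by (auto simp: dist_commute)
  next
    case 3
    then show ?thesis using concl[of R Q P e f] d by (auto simp: dist_commute)
  qed
qed

text \<open>Double counting: the angles of all tiles sum to \<open>pi\<close> times the number of
  tile angles \<open>G\<close>. At each point the angle sum is at least \<open>pi\<close> times the
  number of \<open>G\<close> there, and at \<open>C\<close> it is strictly larger.\<close>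

lemma vertex_count:
  assumes small: "\<And>p q r h. h \<in> {1, 2} \<Longrightarrow> real p * E + real q * F + real r * G = real h * pi \<Longrightarrow> r \<le> h"
    and A: "at_vertex R A = 0" and B: "at_vertex R B = 0" and C: "at_vertex R C = 0"
  shows False
proof -
  let ?U = "tri A B C"
  have pos: "0 < E" "0 < F" "0 < G"
    using ang_bounds(1) tri_efg by (auto simp: tri_sides_def)
  have sum: "E + F + G = pi" by (rule ang_sum[OF tri_efg])
  define a where "a V = at_vertex P V * E + at_vertex Q V * F + at_vertex R V * G" for V
  \<comment> \<open>\<open>C\<close> is inserted so that the strict inequality there is part of the
    sum.\<close>
  define W where "W = insert C (P ` \<T> \<union> Q ` \<T> \<union> R ` \<T>)"
  have finW: "finite W" using fin by (simp add: W_def)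
  have total: "(\<Sum>V\<in>W. real (at_vertex X V)) = real (card \<T>)" if "X ` \<T> \<subseteq> W" for X
  proof -
    have "(\<Sum>V\<in>W. real (at_vertex X V)) = (\<Sum>V\<in>W. \<Sum>S\<in>\<T>. if X S = V then 1 else 0)"
      using sum_at_vertex[of X _ 1] by simp
    also have "\<dots> = (\<Sum>S\<in>\<T>. \<Sum>V\<in>W. if X S = V then 1 else 0)" by (rule sum.swap)
    also have "\<dots> = (\<Sum>S\<in>\<T>. 1)" using that finW by (intro sum.cong) (auto simp: image_subset_iff)
    finally show ?thesis by simp
  qed
  have sub: "P ` \<T> \<subseteq> W" "Q ` \<T> \<subseteq> W" "R ` \<T> \<subseteq> W" by (auto simp: W_def)
  have "(\<Sum>V\<in>W. a V) = card \<T> * E + card \<T> * F + card \<T> * G"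
    unfolding a_def using total[OF sub(1)] total[OF sub(2)] total[OF sub(3)] by (simp add: sum.distrib flip: sum_distrib_right)
  also have "\<dots> = (\<Sum>V\<in>W. real (at_vertex R V)) * pi"
    unfolding total[OF sub(3)] sum[symmetric] by (simp add: algebra_simps)
  finally have bal: "(\<Sum>V\<in>W. a V) = (\<Sum>V\<in>W. real (at_vertex R V) * pi)" by (simp add: sum_distrib_right)
  have le: "real (at_vertex R V) * pi \<le> a V" for V
  proof (cases "V \<in> {A, B, C} \<or> V \<notin> ?U \<or> a V = 0")
    case True
    have "at_vertex R V = 0"
    proof (cases "V \<in> {A, B, C}")
      case False
      then consider "V \<notin> ?U" | "a V = 0" using True by blast
      then show ?thesis
      proof cases
        case 1
        have "R S \<in> ?U" if "S \<in> \<T>" for S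
        proof -
          have "R S \<in> tri (P S) (Q S) (R S)" by (auto intro: hull_inc)
          then show ?thesis using tile(2)[OF that] tile_subset[OF that] by blast
        qed
        then have "{S \<in> \<T>. R S = V} = {}" using 1 by blast
        then show ?thesis by (simp only: at_vertex_def card.empty)
      next
        case 2
        have "0 \<le> at_vertex P V * E" "0 \<le> at_vertex Q V * F" "0 \<le> at_vertex R V * G" using pos by simp_all
        then have "at_vertex R V * G = 0" using 2 unfolding a_def by linarith
        then show ?thesis using pos by simp
      qed
    qed (use A B C in auto)
    then show ?thesis using pos by (simp add: a_def)
  next
    case False
    then have V: "V \<in> ?U" "V \<notin> {A, B, C}" and aV: "a V \<noteq> 0" by auto
    from triangle_point_cases[OF nc_big V(1)] V(2) obtain h0 :: nat where h0: "h0 \<in> {1, 2}" "has_angle ?U V (h0 * pi)"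
      by (metis insertCI mult_1 of_nat_1 of_nat_numeral)
    \<comment> \<open>Tiles that contain \<open>V\<close> other than as a vertex account for
      \<open>n pi\<close>; the remaining multiple \<open>h0 - n\<close> is again 1 or 2.\<close>
    obtain n :: nat where n: "h0 * pi = a V + n * pi" using angle_equation[OF h0(2)] unfolding a_def by metis
    have "0 \<le> a V" using pos by (simp add: a_def)
    then have "real n * pi < real h0 * pi" using n aV by linarith
    then have nh: "n < h0" by simp
    have aV': "a V = real (h0 - n) * pi" using n nh by (simp add: of_nat_diff algebra_simps)
    have "h0 - n \<in> {1, 2}" using nh h0(1) by auto
    then have "at_vertex R V \<le> h0 - n" using aV' by (intro small) (simp_all add: a_def)
    then show ?thesis unfolding aV' by (intro mult_right_mono) auto
  qed
  have "0 < a C"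
  proof -
    interpret C': self_tiling s g e f \<T> R P Q C A B
      by (rule rotate)
    have "at_vertex R C * G + at_vertex P C * ang e g f + at_vertex Q C * ang f g e = G"
      using C'.corner_angles by simp
    then have "a C = G" by (simp add: a_def ang_commute)
    then show ?thesis using pos by simp
  qed
  then have "real (at_vertex R C) * pi < a C" using C by simp
  then have "(\<Sum>V\<in>W. real (at_vertex R V) * pi) < (\<Sum>V\<in>W. a V)"
    using finW le by (intro sum_strict_mono_ex1) (auto simp: W_def)
  then show False using bal by simp
qed

end

section \<open>Combination of the cases\<close>

lemma self_tiling_typeI:
  assumes "self_tiling s e f g \<T> P Q R A B C" and s: "s^2 = real N" "0 < s" "s \<notin> \<rat>" and I: "typeI s e f g"
  shows "(\<exists>a b::int. int N = a^2 + b^2) \<or> (\<exists>k::int. int N = 3 * k^2)"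
proof -
  interpret self_tiling s e f g \<T> P Q R A B C by fact
  interpret B': self_tiling s f e g \<T> Q P R B A C by (rule swap12)
  interpret C': self_tiling s g e f \<T> R P Q C A B
    by (rule rotate)
  show ?thesis
  proof (rule typeI_conclusion[OF tri_efg s I])
    show "\<exists>j k l. corner_ok s g e f j k l" using C'.corner by blast
    show False
      if small: "\<And>p q r h. h \<in> {1, 2} \<Longrightarrow> real p * E + real q * F + real r * G = real h * pi \<Longrightarrow> r \<le> h"
        and c: "\<And>j k l. corner_ok s e f g j k l \<Longrightarrow> l = 0" "\<And>j k l. corner_ok s f e g j k l \<Longrightarrow> l = 0"
        "\<And>j k l. corner_ok s g e f j k l \<Longrightarrow> j = 0"
      using small c(1)[OF corner] c(2)[OF B'.corner] c(3)[OF C'.corner] by (rule vertex_count)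
    show "\<exists>k::int. s * (g - eps * f - del * e) = k * (g - eps * f - del * e)"
      if "eps \<in> {1, - 1}" "del \<in> {1, - 1}" "\<And>t. w t \<in> {1, - 1}" "\<And>t. w (t + pi) = - w t"
        "\<And>t. w (t + E) = eps * w t" "\<And>t. w (t + F) = del * w t" for w eps del
      by (rule weighted_length_additive[OF additive s_pos tile_ex big refl that])
  qed
qed

lemma self_tiling_typeII:
  assumes "self_tiling s e f g \<T> P Q R A B C" and s: "s^2 = real N" "0 < s" "s \<notin> \<rat>" and II: "typeII s e f g"
  shows "(\<exists>a b::int. int N = a^2 + b^2) \<or> (\<exists>k::int. int N = 3 * k^2)"
proof -
  interpret self_tiling s e f g \<T> P Q R A B C by fact
  interpret B': self_tiling s f e g \<T> Q P R B A C by (rule swap12)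
  have "typeI s e g f \<or> typeI s f g e"
    using corner B'.corner by (intro typeII_reduces_to_typeI[OF tri_efg s II]) blast+
  then show ?thesis
    using self_tiling_typeI[OF swap23 s] self_tiling_typeI[OF self_tiling.swap23[OF swap12] s] by blast
qed

lemma self_tiling_conclusion:
  assumes "self_tiling s e f g \<T> P Q R A B C" and s: "s^2 = real N" "0 < s" "s \<notin> \<rat>"
  shows "(\<exists>a b::int. int N = a^2 + b^2) \<or> (\<exists>k::int. int N = 3 * k^2)"
proof -
  interpret self_tiling s e f g \<T> P Q R A B C by fact
  interpret B': self_tiling s f e g \<T> Q P R B A C by (rule swap12)
  interpret C': self_tiling s g e f \<T> R P Q C A B
    by (rule rotate)
  have pos: "0 < e" "0 < f" "0 < g" using tri_efg by (auto simp: tri_sides_def)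
  obtain a1 a2 a3 where 1: "s * e = real a1 * e + real a2 * f + real a3 * g" using side_combination by blast
  obtain b1 b2 b3 where "s * f = real b1 * f + real b2 * e + real b3 * g" using B'.side_combination by blast
  then have 2: "s * f = real b2 * e + real b1 * f + real b3 * g" by simp
  obtain c1 c2 c3 where "s * g = real c1 * g + real c2 * e + real c3 * f" using C'.side_combination by blast
  then have 3: "s * g = real c2 * e + real c3 * f + real c1 * g" by simp
  show ?thesis
    using matrix_types[OF s(1,3) pos 1 2 3]
      self_tiling_typeI[OF assms(1) s] self_tiling_typeI[OF swap23 s] self_tiling_typeI[OF B'.swap23 s]
      self_tiling_typeII[OF assms(1) s] self_tiling_typeII[OF swap23 s] self_tiling_typeII[OF B'.swap23 s]
    by argo
qed

section \<open>Similarities of the plane and the reduction to labelled tilings\<close>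

text \<open>Translated so as to fix 0 and divided by \<open>r\<close>, the similarity becomes an
  isometry fixing the origin, hence orthogonal.\<close>

lemma similarity_linear:
  fixes h :: "real^2 \<Rightarrow> real^2"
  assumes r: "0 < r" and h: "\<And>x y. dist (h x) (h y) = r * dist x y"
  obtains L where "orthogonal_transformation L" "\<And>x. h x = r *\<^sub>R L x + h 0"
proof -
  define L where "L x = (1 / r) *\<^sub>R (h x - h 0)" for x
  have "dist (L x) (L y) = dist x y" for x y
  proof -
    have "L x - L y = (1 / r) *\<^sub>R (h x - h y)" by (simp add: L_def algebra_simps)
    then show ?thesis using h[of x y] r by (simp add: dist_norm)
  qed
  then have "orthogonal_transformation L" by (simp add: orthogonal_transformation_isometry) (simp add: L_def)
  moreover have "h x = r *\<^sub>R L x + h 0" for x using r by (simp add: L_def)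
  ultimately show ?thesis using that by blast
qed

lemma similarity_image:
  fixes h :: "real^2 \<Rightarrow> real^2"
  assumes r: "0 < r" and h: "\<And>x y. dist (h x) (h y) = r * dist x y"
  shows "h ` (tri a b c) = tri (h a) (h b) (h c)"
    and "area (h ` (tri a b c)) = r^2 * area (tri a b c)"
    and "is_tri e f g a b c \<Longrightarrow> is_tri (r * e) (r * f) (r * g) (h a) (h b) (h c)"
proof -
  obtain L where L: "orthogonal_transformation L" "\<And>x. h x = r *\<^sub>R L x + h 0"
    using similarity_linear[OF r h] by blast
  have lin: "linear (\<lambda>x. r *\<^sub>R L x)"
    using orthogonal_transformation_linear[OF L(1)] by (rule linear_compose_scale_right)
  have im: "h ` X = (\<lambda>x. h 0 + x) ` ((\<lambda>x. r *\<^sub>R L x) ` X)" for X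
    unfolding image_image by (intro image_cong refl) (metis L(2) add.commute)
  show "h ` (tri a b c) = tri (h a) (h b) (h c)"
    unfolding im[of "tri a b c"] convex_hull_linear_image[OF lin] convex_hull_translation[symmetric] im[symmetric]
    by simp
  have "h ` X = (\<lambda>x. r *\<^sub>R x + h 0) ` (L ` X)" for X
    unfolding image_image by (intro image_cong refl) (rule L(2))
  then show "area (h ` (tri a b c)) = r^2 * area (tri a b c)"
    using measure_lebesgue_affine[of r "h 0" "L ` (tri a b c)"] r
      measure_orthogonal_image[OF L(1) lmeasurable_compact[OF compact_triangle[of a b c]]] by simp
  show "is_tri (r * e) (r * f) (r * g) (h a) (h b) (h c)" if "is_tri e f g a b c"
  proof -
    have "collinear {a, b, c}" if "collinear {h a, h b, h c}"
      using that r unfolding collinear_between_cases between h distrib_left[symmetric] by simp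
    then show ?thesis using that by (auto simp: is_tri_def h)
  qed
qed

theorem theorem1:
  fixes N :: nat and A B C :: "real^2" and T :: "(real^2) set"
  assumes "N > 0"
    and "\<not> collinear {A, B, C}"
    and "is_triangle T"
    and "similar_figures T (convex hull {A, B, C})"
    and "\<exists>\<T>. is_tiling N (convex hull {A, B, C}) T \<T>"
  shows "(\<exists>k::int. int N = k\<^sup>2) \<or> (\<exists>a b::int. int N = a\<^sup>2 + b\<^sup>2) \<or> (\<exists>k::int. int N = 3 * k\<^sup>2)"
proof -
  obtain a b c where nc: "\<not> collinear {a, b, c}" and T: "T = convex hull {a, b, c}"
    using assms(3) by (auto simp: is_triangle_def)
  define e f g where "e = dist b c" and "f = dist a c" and "g = dist a b"
  have tri: "is_tri e f g a b c" using nc by (simp add: is_tri_def e_def f_def g_def)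
  obtain r h where r: "0 < r" and h: "\<And>x y. dist (h x) (h y) = r * dist x y" and hT: "h ` T = convex hull {A, B, C}"
    using assms(4) unfolding similar_figures_def by blast
  obtain \<T> where tiling: "is_tiling N (convex hull {A, B, C}) T \<T>" using assms(5) by blast
  have fin: "finite \<T>" and card: "card \<T> = N" and un: "\<Union>\<T> = convex hull {A, B, C}"
    and disj: "pairwise (\<lambda>S S'. interior S \<inter> interior S' = {}) \<T>"
    and cong: "\<And>S. S \<in> \<T> \<Longrightarrow> congruent_figures T S"
    using tiling by (auto simp: is_tiling_def)
  have U: "convex hull {A, B, C} = tri (h a) (h b) (h c)"
    using hT similarity_image(1)[OF r h] T by metis
  have "\<forall>S\<in>\<T>. \<exists>k. (\<forall>x y. dist (k x) (k y) = dist x y) \<and> k ` T = S"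
    using cong unfolding congruent_figures_def by blast
  \<comment> \<open>One congruence is fixed for each tile; the images of \<open>a\<close>,
    \<open>b\<close>, \<open>c\<close> label its vertices.\<close>
  from bchoice[OF this] obtain k where k: "\<forall>S\<in>\<T>. (\<forall>x y. dist (k S x) (k S y) = dist x y) \<and> k S ` T = S" by (elim exE)
  have iso: "dist (k S x) (k S y) = 1 * dist x y" "k S ` T = S" if "S \<in> \<T>" for S x y using k that by simp_all
  have tile: "is_tri e f g (k S a) (k S b) (k S c)" "S = convex hull {k S a, k S b, k S c}" "area S = area T"
    if S: "S \<in> \<T>" for S
    using similarity_image[OF zero_less_one iso(1)[OF S], where a = a and b = b and c = c] iso(2)[OF S] tri unfolding T by auto
  have "additive_over (\<Union>\<T>) \<T>"
  proof (rule tiling_additive[OF fin _ disj])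
    show "convex S \<and> compact S" if "S \<in> \<T>" for S
      using tile(2)[OF that] compact_triangle convex_convex_hull by metis
  qed
  then have add: "additive_over (tri (h a) (h b) (h c)) \<T>" unfolding un U .
  have st: "self_tiling r e f g \<T> (\<lambda>S. k S a) (\<lambda>S. k S b) (\<lambda>S. k S c) (h a) (h b) (h c)"
  proof
    show "\<Union>\<T> = tri (h a) (h b) (h c)" using un U by simp
    show "is_tri (r * e) (r * f) (r * g) (h a) (h b) (h c)" by (rule similarity_image(3)[OF r h tri])
  qed (use r add tile in auto)
  \<comment> \<open>Comparing areas gives \<open>r^2 = N\<close> once the area of \<open>T\<close>
    is known to be nonzero.\<close>
  have "r^2 * area T = area (tri (h a) (h b) (h c))"
    using similarity_image[OF r h, where a = a and b = b and c = c] T by simp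
  also have "\<dots> = (\<Sum>S\<in>\<T>. area S)"
    using add closed_UNIV unfolding additive_over_def by (metis (no_types, lifting) Int_UNIV_right sum.cong)
  also have "\<dots> = real N * area T" using tile(3) card by simp
  finally have "r^2 * area T = real N * area T" .
  moreover have "area T \<noteq> 0"
  proof
    assume "area T = 0"
    moreover have "T \<in> lmeasurable" unfolding T by (intro lmeasurable_compact compact_triangle)
    ultimately have "negligible T" using negligible_iff_measure by blast
    then have "interior T = {}" unfolding T using negligible_convex_interior convex_convex_hull by blast
    \<comment> \<open>The centroid is an interior point.\<close>
    moreover have "(1/3) *\<^sub>R a + (1/3) *\<^sub>R b + (1/3) *\<^sub>R c \<in> interior T"
    proof -
      have dim: "DIM(real^2) = 2" by simp
      show ?thesis unfolding T interior_convex_hull_3_minimal[OF nc dim] mem_Collect_eq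
        by (intro exI[of _ "1/3"]) simp
    qed
    ultimately show False by simp
  qed
  ultimately have r2: "r^2 = real N" by simp
  show ?thesis
  proof (cases "r \<in> \<rat>")
    case True
    have "sqrt (real N) = r" using r2 r by (metis less_imp_le real_sqrt_unique)
    then show ?thesis using sqrt_rational_imp_square[of N] True by blast
  next
    case False
    then show ?thesis using self_tiling_conclusion[OF st r2 r False] by blast
  qed
qed

end
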